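(* Let $\ell$ be any non-negative integer and let $a\ge 3$ be a fixed integer. Then, as $b\to\infty$ through integers $b>a$ with $\gcd(a,b)=1$, $$\pi_{\ell,a,b}=\left(\frac{a-2}{2(\ell a+a-1)}+o(1)\right)\pi\bigl(g_{\ell,a,b}\bigr).$$
   Context: For relatively prime positive integers $a<b$ and a non-negative integer $\ell$, let $r(n)$ denote the number of pairs $(x,y)\in\mathbb{Z}_{\ge 0}^2$ with $n=ax+by$. Let $S_\ell(a,b)=\{n\in\mathbb{Z}_{\ge0}: r(n)\ge \ell+1\}$ and $G_\ell(a,b)=\mathbb{Z}_{\ge 0}\setminus S_\ell(a,b)$. Let $g_{\ell,a,b}$ be the largest integer $n$ with $r(n)\le \ell$ (it equals $(\ell+1)ab-a-b$). Let $\pi_{\ell,a,b}$ be the number of primes $p\le g_{\ell,a,b}$ with $p\in S_\ell(a,b)$, i.e. having at least $\ell+1$ representations $p=ax+by$ with $x,y\ge0$. $\pi(x)$ denotes the number of primes not exceeding $x$. *)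

theory Defs
  imports Complex_Main "HOL-Computational_Algebra.Primes" "HOL-Library.Landau_Symbols"
begin

(* The arguments a and b are meant to be positive; the set counted here is then finite. *)
definition num_reps :: "nat \<Rightarrow> nat \<Rightarrow> int \<Rightarrow> nat" where
  "num_reps a b n = card {(x :: nat, y :: nat). n = int a * int x + int b * int y}"

definition S :: "nat \<Rightarrow> nat \<Rightarrow> nat \<Rightarrow> nat set" where
  "S l a b = {n. num_reps a b (int n) \<ge> l + 1}"

(* The Greatest operator is only meaningful when a maximum exists, which is the case for
   positive coprime a and b.  The value is an integer because it is -1 for l = 0 and
   min a b = 1. *)
definition frobenius :: "nat \<Rightarrow> nat \<Rightarrow> nat \<Rightarrow> int" where
  "frobenius l a b = (GREATEST n. num_reps a b n \<le> l)"

definition prime_pi :: "real \<Rightarrow> nat" where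
  "prime_pi x = card {p :: nat. prime p \<and> real p \<le> x}"

definition frobenius_prime_pi :: "nat \<Rightarrow> nat \<Rightarrow> nat \<Rightarrow> nat" where
  "frobenius_prime_pi l a b = card {p :: nat. prime p \<and> int p \<le> frobenius l a b \<and> p \<in> S l a b}"

end

theory Submission
  imports Defs "HOL-Complex_Analysis.Complex_Analysis" "HOL-Number_Theory.Number_Theory"
    "HOL-Real_Asymp.Real_Asymp"
begin

text \<open>
  If \<open>y < a\<close> is the solution of \<open>b y \<equiv> n\<close> modulo \<open>a\<close>, then \<open>n\<close> has more than \<open>l\<close> representations
  iff \<open>n \<ge> b (y + a l)\<close>. Hence the primes in question are counted by differences of the counting
  functions of the residue classes \<open>b y\<close>, up to the finitely many primes dividing \<open>a\<close>, and the prime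
  number theorem in arithmetic progressions reduces the claim to
  \<open>\<Sum>(a - 1 - y) = \<phi>(a) (a - 2) / 2\<close>, summed over \<open>y < a\<close> coprime to \<open>a\<close>.

  The prime number theorem in the form \<open>\<psi>(n; a, c) \<sim> n / N\<close>, with \<open>N\<close> the number of characters, is
  obtained from Newman's Tauberian theorem applied to \<open>\<Sum>(\<psi>(n; a, c) / n - 1 / N) n\<^sup>-\<^sup>s\<close>. The
  holomorphic continuation of this series to \<open>Re s \<ge> 1\<close> rests on the non-vanishing of the
  L-functions on that half-plane, which follows for all characters at once from Landau's lemma on
  series with nonnegative coefficients.
\<close>

section \<open>Dirichlet series\<close>

text \<open>The class of \<open>b * y\<close> modulo \<open>a\<close> moves with \<open>b\<close>,
  but only among finitely many classes, so asymptotics for each fixed class suffice. Every count is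
  normalised by the common scale \<open>ln b / b\<close>. This scale and the number of characters
  both cancel in the final quotient, so that number is never identified with the totient.

  The classical obstacle to non-vanishing is a real character at the point 1. Here a possible zero
  at \<open>1 + it\<close> is first moved to 1 by twisting the coefficients with
  \<open>n powr (-it)\<close>. At 1 the square of the principal series has a double pole, which is
  met by two zeros: that of the twisted series and that of its conjugate. When these two series
  coincide the count of zeros is still two, so real characters are treated like all others.

  Newman's theorem wants bounded coefficients, which the von Mangoldt function does not have. Its
  summatory function divided by \<open>n\<close> does, by Chebyshev's upper bound. What Newman's
  theorem then delivers is only convergence of a logarithmically weighted average, and monotonicity
  of the summatory function turns it into a limit.\<close>

definition dseries :: "(nat \<Rightarrow> complex) \<Rightarrow> complex \<Rightarrow> complex" where
  "dseries c s = (\<Sum>n. c n * of_nat n powr (-s))"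

text \<open>Demanding convergence only strictly to the right of the bound makes the property closed
  under infima, which Landau's argument uses. The index 0 is harmless throughout, because
  \<open>0 powr z = 0\<close>.\<close>

definition abs_conv :: "(nat \<Rightarrow> complex) \<Rightarrow> real \<Rightarrow> bool" where
  "abs_conv c \<sigma>0 \<longleftrightarrow> (\<forall>\<sigma>>\<sigma>0. summable (\<lambda>n. norm (c n) * real n powr (-\<sigma>)))"

lemma norm_nat_powr: "norm ((of_nat n :: complex) powr s) = real n powr Re s"
  by (subst norm_powr_real_powr) auto

lemma open_Re_gt: "open {s::complex. Re s > x}"
  by (simp add: open_halfspace_Re_gt)

lemma abs_conv_summable:
  assumes "abs_conv c \<sigma>0" "Re s > \<sigma>0"
  shows "summable (\<lambda>n. norm (c n * of_nat n powr (-s)))"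
  using assms by (auto simp: abs_conv_def norm_mult norm_nat_powr)

lemma dseries_sums:
  assumes "abs_conv c \<sigma>0" "Re s > \<sigma>0"
  shows "(\<lambda>n. c n * of_nat n powr (-s)) sums dseries c s"
  unfolding dseries_def
  by (rule summable_sums[OF summable_norm_cancel[OF abs_conv_summable[OF assms]]])

lemma has_field_derivative_nat_powr:
  "((\<lambda>s::complex. of_nat n powr (-s)) has_field_derivative (- of_real (ln (real n)) * of_nat n powr (-s))) (at s)"
proof (cases "n = 0")
  case False
  then have "Ln (of_nat n) = of_real (ln (real n))"
    using Ln_of_real[of "real n"] by simp
  moreover have "((\<lambda>s::complex. of_nat n powr (-s)) has_field_derivative (Ln (of_nat n) * of_nat n powr (-s)) * (-1)) (at s)"
    using False by (intro DERIV_chain2[OF has_field_derivative_powr_right]) (auto intro!: derivative_eq_intros)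
  ultimately show ?thesis by simp
qed auto

lemma dseries_has_field_derivative:
  assumes "abs_conv c \<sigma>0" "Re s > \<sigma>0"
  shows "(dseries c has_field_derivative dseries (\<lambda>n. - (c n * of_real (ln (real n)))) s) (at s)"
proof -
  let ?S = "{s. Re s > \<sigma>0}"
  let ?f = "\<lambda>n s. c n * of_nat n powr (-s)"
  let ?f' = "\<lambda>n s. - (c n * of_real (ln (real n))) * of_nat n powr (-s)"
  have "\<exists>g g'. \<forall>x \<in> ?S. ((\<lambda>n. ?f n x) sums g x) \<and> ((\<lambda>n. ?f' n x) sums g' x) \<and> (g has_field_derivative g' x) (at x)"
  proof (rule series_and_derivative_comparison_local)
    show "open ?S" by (rule open_Re_gt)
    show "(?f n has_field_derivative ?f' n x) (at x)" for n x
      by (rule DERIV_cong, rule DERIV_cmult, rule has_field_derivative_nat_powr) auto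
    fix x assume x: "x \<in> ?S"
    \<comment> \<open>Half the distance to the boundary abscissa: the ball of this radius stays to
      the right of \<open>\<sigma>0 + d\<close>, where the series of norms is a uniform
      majorant.\<close>
    define d where "d = (Re x - \<sigma>0) / 2"
    have d: "d > 0" "\<sigma>0 + d > \<sigma>0" using x by (auto simp: d_def)
    have "norm (?f n y) \<le> norm (c n) * real n powr (-(\<sigma>0 + d))" if "y \<in> ball x d" for y n
    proof -
      have "\<bar>Re x - Re y\<bar> < d" using that abs_Re_le_cmod[of "x - y"] by (simp add: dist_norm)
      moreover have "Re x = \<sigma>0 + 2 * d" by (simp add: d_def field_simps)
      ultimately have "Re y \<ge> \<sigma>0 + d" by linarith
      then have "real n powr (- Re y) \<le> real n powr (-(\<sigma>0 + d))" if "n > 0"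
        using that by (intro powr_mono) auto
      then show ?thesis by (cases "n = 0") (auto simp: norm_mult norm_nat_powr intro!: mult_left_mono)
    qed
    moreover have "summable (\<lambda>n. norm (c n) * real n powr (-(\<sigma>0 + d)))"
      using assms(1) d unfolding abs_conv_def by blast
    ultimately show "\<exists>d h. 0 < d \<and> summable h \<and> (\<forall>\<^sub>F n in sequentially. \<forall>y\<in>ball x d \<inter> ?S. norm (?f n y) \<le> h n)"
      using d by (intro exI[of _ d] exI[of _ "\<lambda>n. norm (c n) * real n powr (-(\<sigma>0 + d))"]) auto
  qed
  then obtain g g' where g: "\<And>x. x \<in> ?S \<Longrightarrow> (\<lambda>n. ?f n x) sums g x"
    "\<And>x. x \<in> ?S \<Longrightarrow> (\<lambda>n. ?f' n x) sums g' x"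
    "\<And>x. x \<in> ?S \<Longrightarrow> (g has_field_derivative g' x) (at x)" by blast
  have eq: "dseries c x = g x" if "x \<in> ?S" for x
    using g(1)[OF that] unfolding dseries_def by (simp add: sums_iff)
  have "g' s = dseries (\<lambda>n. - (c n * of_real (ln (real n)))) s"
    using g(2)[of s] assms(2) unfolding dseries_def by (auto simp: sums_iff)
  moreover have "(dseries c has_field_derivative g' s) (at s)"
    using g(3)[of s] assms(2) eq open_Re_gt[of \<sigma>0]
    by (intro has_field_derivative_transform_within_open[OF g(3)]) auto
  ultimately show ?thesis by simp
qed

lemma dseries_holomorphic:
  assumes "abs_conv c \<sigma>0"
  shows "dseries c holomorphic_on {s. Re s > \<sigma>0}"
  using dseries_has_field_derivative[OF assms] open_Re_gt
  by (auto simp: holomorphic_on_open)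

lemma abs_conv_le:
  assumes "abs_conv c \<sigma>0" "\<And>n. norm (d n) \<le> K * norm (c n)"
  shows "abs_conv d \<sigma>0"
  unfolding abs_conv_def
proof safe
  fix \<sigma> assume "\<sigma> > \<sigma>0"
  then have s: "summable (\<lambda>n. K * (norm (c n) * real n powr (-\<sigma>)))"
    using assms(1) by (auto simp: abs_conv_def intro: summable_mult)
  have "norm (d n) * real n powr (-\<sigma>) \<le> (K * norm (c n)) * real n powr (-\<sigma>)" for n
    by (intro mult_right_mono assms) auto
  then show "summable (\<lambda>n. norm (d n) * real n powr (-\<sigma>))"
    by (intro summable_comparison_test'[OF s]) (auto simp: mult_ac)
qed

lemma abs_conv_add:
  assumes "abs_conv c \<sigma>0" "abs_conv d \<sigma>0"
  shows "abs_conv (\<lambda>n. c n + d n) \<sigma>0"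
  unfolding abs_conv_def
proof safe
  fix \<sigma> :: real assume "\<sigma> > \<sigma>0"
  then have s: "summable (\<lambda>n. norm (c n) * real n powr (-\<sigma>) + norm (d n) * real n powr (-\<sigma>))"
    using assms by (intro summable_add) (auto simp: abs_conv_def)
  show "summable (\<lambda>n. norm (c n + d n) * real n powr (-\<sigma>))"
    by (rule summable_comparison_test'[OF s])
       (auto simp: distrib_right[symmetric] intro!: mult_right_mono norm_triangle_ineq)
qed

lemma abs_conv_const: "abs_conv (\<lambda>_. 1) 1"
  by (auto simp: abs_conv_def summable_real_powr_iff)

lemma abs_conv_bounded: "(\<And>n. norm (c n) \<le> K) \<Longrightarrow> abs_conv c 1"
  by (rule abs_conv_le[OF abs_conv_const]) auto

lemma abs_conv_bounded_over_n:
  assumes "\<And>n. norm (A n) \<le> K"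
  shows "abs_conv (\<lambda>n. A n / of_nat n) 0"
  unfolding abs_conv_def
proof safe
  fix \<sigma> :: real assume "\<sigma> > 0"
  then have s: "summable (\<lambda>n. K * real n powr (-\<sigma>-1))"
    by (intro summable_mult) (auto simp: summable_real_powr_iff)
  have "norm (A n / of_nat n) * real n powr (-\<sigma>) \<le> K * real n powr (-\<sigma>-1)" for n
  proof (cases "n = 0")
    case False
    then have "norm (A n / of_nat n) * real n powr (-\<sigma>) = norm (A n) * real n powr (-\<sigma>-1)"
      by (auto simp: norm_divide powr_diff)
    also have "\<dots> \<le> K * real n powr (-\<sigma>-1)" by (intro mult_right_mono assms) auto
    finally show ?thesis .
  qed auto
  then show "summable (\<lambda>n. norm (A n / of_nat n) * real n powr (-\<sigma>))"
    by (intro summable_comparison_test'[OF s]) auto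
qed

lemma abs_conv_ln: "abs_conv (\<lambda>n. of_real (ln (real n))) 1"
  unfolding abs_conv_def
proof safe
  fix \<sigma> :: real assume s: "\<sigma> > 1"
  \<comment> \<open>Half of the excess over 1 pays for \<open>ln n \<le> n powr d / d\<close> and
    leaves the summable exponent \<open>1 + d\<close>.\<close>
  define d where "d = (\<sigma> - 1) / 2"
  have d: "d > 0" using s by (auto simp: d_def)
  have sm: "summable (\<lambda>n. (1/d) * real n powr (-(1+d)))"
    using d by (intro summable_mult) (auto simp: summable_real_powr_iff)
  have "norm (norm (complex_of_real (ln (real n))) * real n powr (-\<sigma>)) \<le> (1/d) * real n powr (-(1+d))" for n
  proof (cases "n = 0")
    case False
    then have "ln (real n) \<le> real n powr d / d" using d by (intro ln_powr_bound) auto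
    then have "ln (real n) * real n powr (-\<sigma>) \<le> real n powr d / d * real n powr (-\<sigma>)"
      by (intro mult_right_mono) auto
    also have "\<dots> = (1/d) * real n powr (d + - \<sigma>)" by (simp only: powr_add) auto
    also have "d + - \<sigma> = -(1+d)" by (auto simp: d_def field_simps)
    finally show ?thesis using False by (simp add: abs_mult)
  qed auto
  then show "summable (\<lambda>n. norm (complex_of_real (ln (real n))) * real n powr (-\<sigma>))"
    by (intro summable_comparison_test'[OF sm]) blast
qed

text \<open>With \<open>A n = n\<close> partial summation gives \<open>\<zeta>(s) = s \<zeta>(s) + \<Sum>n (n\<^sup>-\<^sup>s - (n+1)\<^sup>-\<^sup>s - s n\<^sup>-\<^sup>s\<^sup>-\<^sup>1)\<close>, where
  the last series converges for \<open>Re s > 0\<close>. The same remainder term serves for all continuations.\<close>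

definition powr_diff_rem :: "nat \<Rightarrow> complex \<Rightarrow> complex" where
  "powr_diff_rem n s = of_nat n powr (-s) - of_nat (Suc n) powr (-s) - s * of_nat n powr (-s-1)"

text \<open>Up to sign this is the first-order Taylor remainder of \<open>x powr (-s)\<close>
  between \<open>n\<close> and \<open>n + 1\<close>; the bound is the second derivative
  \<open>s * (s + 1) * x powr (-s-2)\<close> at the left end, where it is largest.\<close>

lemma norm_powr_diff_rem:
  assumes "n > 0" "Re s > 0"
  shows "norm (powr_diff_rem n s) \<le> norm s * norm (s + 1) * real n powr (-Re s - 2)"
proof -
  define f where "f = (\<lambda>i::nat. if i = 0 then (\<lambda>x. x powr (-s)) else if i = 1 then (\<lambda>x. -s * x powr (-s-1)) else (\<lambda>x. s * (s+1) * (x::complex) powr (-s-2)))"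
  let ?S = "closed_segment (of_nat n) (of_nat (Suc n)) :: complex set"
  have S: "\<exists>t. x = of_real t \<and> t \<ge> real n" if "x \<in> ?S" for x
  proof -
    have "closed_segment (of_nat n) (of_nat (Suc n)) = (of_real ` closed_segment (real n) (real (Suc n)) :: complex set)"
      by (metis closed_segment_of_real of_real_of_nat_eq)
    with that show ?thesis by (auto simp: closed_segment_eq_real_ivl)
  qed
  have nr: "x \<notin> \<real>\<^sub>\<le>\<^sub>0" if "x \<in> ?S" for x
    using S[OF that] assms by auto
  have "norm (f 0 (of_nat (Suc n)) - (\<Sum>i\<le>1. f i (of_nat n) * (of_nat (Suc n) - of_nat n) ^ i / fact i))
        \<le> (norm s * norm (s + 1) * real n powr (-Re s - 2)) * norm (of_nat (Suc n) - of_nat n :: complex) ^ Suc 1 / fact 1"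
  proof (rule complex_Taylor)
    show "convex ?S" by auto
    fix i x assume x: "x \<in> ?S" and i: "i \<le> (1::nat)"
    show "(f i has_field_derivative f (Suc i) x) (at x within ?S)"
    proof (cases "i = 0")
      case True
      show ?thesis unfolding f_def True
        by (auto intro!: derivative_eq_intros nr x)
    next
      case False
      then have "i = 1" using i by auto
      then show ?thesis unfolding f_def
        by (auto intro!: derivative_eq_intros nr x simp: algebra_simps)
    qed
  next
    fix x assume x: "x \<in> ?S"
    then obtain t where t: "x = of_real t" "t \<ge> real n" using S by blast
    have "norm (x powr (-s-2)) = t powr (-Re s - 2)"
      using t assms by (subst norm_powr_real_powr) auto
    also have "\<dots> \<le> real n powr (-Re s - 2)"
      using t assms by (intro powr_mono2') auto
    finally show "norm (f (Suc 1) x) \<le> norm s * norm (s + 1) * real n powr (-Re s - 2)"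
      by (auto simp: f_def norm_mult intro!: mult_left_mono)
  qed auto
  moreover have "f 0 (of_nat (Suc n)) - (\<Sum>i\<le>1. f i (of_nat n) * (of_nat (Suc n) - of_nat n) ^ i / fact i) = - powr_diff_rem n s"
    by (simp add: f_def powr_diff_rem_def)
  ultimately show ?thesis by simp
qed

text \<open>Linear growth of \<open>A\<close> costs one of the two powers gained in the Taylor
  remainder. What is left, \<open>n powr (-Re s - 1)\<close>, still converges locally uniformly for
  \<open>Re s > 0\<close>, one unit further left than the original series.\<close>

lemma powr_diff_rem_series:
  assumes A: "\<And>n. norm (A n) \<le> K * real n"
  shows powr_diff_rem_series_holomorphic:
      "(\<lambda>s. \<Sum>n. A n * powr_diff_rem n s) holomorphic_on {s. Re s > 0}"
    and powr_diff_rem_series_sums: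
      "Re s > 0 \<Longrightarrow> (\<lambda>n. A n * powr_diff_rem n s) sums (\<Sum>n. A n * powr_diff_rem n s)"
proof -
  let ?S = "{s. Re s > (0::real)}"
  let ?f = "\<lambda>n s. A n * powr_diff_rem n s"
  have K: "K \<ge> 0" using order_trans[OF norm_ge_zero A[of 1]] by auto
  have bd: "norm (?f n s) \<le> K * norm s * norm (s + 1) * real n powr (-Re s - 1)" if "Re s > 0" for n s
  proof (cases "n = 0")
    case True
    then show ?thesis using A[of 0] by auto
  next
    case False
    have "norm (?f n s) \<le> (K * real n) * (norm s * norm (s + 1) * real n powr (-Re s - 2))"
      unfolding norm_mult using A[of n] False that norm_powr_diff_rem[of n s] K by (intro mult_mono) auto
    also have "real n powr (-Re s - 1) = real n * real n powr (-Re s - 2)"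
      using False by (simp add: powr_diff power2_eq_square)
    then have "(K * real n) * (norm s * norm (s + 1) * real n powr (-Re s - 2)) = K * norm s * norm (s + 1) * real n powr (-Re s - 1)"
      by (simp add: mult_ac)
    finally show ?thesis .
  qed
  have "\<exists>g g'. \<forall>x \<in> ?S. ((\<lambda>n. ?f n x) sums g x) \<and> ((\<lambda>n. deriv (?f n) x) sums g' x) \<and> (g has_field_derivative g' x) (at x)"
  proof (rule series_and_derivative_comparison_local)
    show "open ?S" by (rule open_Re_gt)
    have "?f n field_differentiable at x" if "x \<in> ?S" for n x
    proof (cases "n = 0")
      case True then show ?thesis using A[of 0] by auto
    next
      case False
      then show ?thesis unfolding powr_diff_rem_def
        by (intro derivative_intros holomorphic_on_imp_differentiable_at[of _ UNIV] holomorphic_intros) auto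
    qed
    then show "(?f n has_field_derivative deriv (?f n) x) (at x)" if "x \<in> ?S" for n x
      using that field_differentiable_derivI by blast
    fix x assume x: "x \<in> ?S"
    define d where "d = Re x / 2"
    have d: "d > 0" using x by (auto simp: d_def)
    let ?h = "\<lambda>n. (K * (norm x + d) * (norm x + d + 1)) * real n powr (-d - 1)"
    have "norm (?f n y) \<le> ?h n" if "y \<in> ball x d" for y n
    proof -
      have *: "norm (x - y) < d" using that by (auto simp: dist_norm)
      have "\<bar>Re x - Re y\<bar> < d" using * abs_Re_le_cmod[of "x - y"] by simp
      moreover have "Re x = 2 * d" by (simp add: d_def)
      ultimately have Re: "Re y \<ge> d" by linarith
      have y: "norm y \<le> norm x + d" using * norm_triangle_sub[of y x] by (simp add: norm_minus_commute)
      have y1: "norm (y + 1) \<le> norm x + d + 1" using norm_triangle_ineq[of y 1] y by simp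
      have "norm (?f n y) \<le> K * norm y * norm (y + 1) * real n powr (-Re y - 1)"
        using Re d by (intro bd) auto
      also have "\<dots> \<le> ?h n"
      proof (cases "n = 0")
        case False
        then have "real n powr (-Re y - 1) \<le> real n powr (-d - 1)"
          using Re by (intro powr_mono) auto
        then show ?thesis using K y y1 d by (intro mult_mono) auto
      qed auto
      finally show ?thesis .
    qed
    moreover have "summable ?h"
      using d by (intro summable_mult) (auto simp: summable_real_powr_iff)
    ultimately show "\<exists>d h. 0 < d \<and> summable h \<and> (\<forall>\<^sub>F n in sequentially. \<forall>y\<in>ball x d \<inter> ?S. norm (?f n y) \<le> h n)"
      using d by (intro exI[of _ d] exI[of _ ?h]) auto
  qed
  then obtain g g' where g: "\<And>x. x \<in> ?S \<Longrightarrow> (\<lambda>n. ?f n x) sums g x"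
    "\<And>x. x \<in> ?S \<Longrightarrow> (g has_field_derivative g' x) (at x)" by blast
  have eq: "(\<Sum>n. ?f n x) = g x" if "x \<in> ?S" for x
    using g(1)[OF that] by (simp add: sums_iff)
  have "g holomorphic_on ?S" using g(2) open_Re_gt by (auto simp: holomorphic_on_open)
  then show "(\<lambda>s. \<Sum>n. A n * powr_diff_rem n s) holomorphic_on ?S"
    by (rule holomorphic_transform) (use eq in auto)
  show "Re s > 0 \<Longrightarrow> (\<lambda>n. A n * powr_diff_rem n s) sums (\<Sum>n. A n * powr_diff_rem n s)"
    using g(1)[of s] eq[of s] by auto
qed

text \<open>Abel summation, with the difference of consecutive powers split into its derivative part
  \<open>s * n powr (-s-1)\<close> and the remainder. The derivative part is again a Dirichlet
  series, with the averages \<open>A n / n\<close> as coefficients.\<close>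

lemma dseries_by_parts:
  fixes c :: "nat \<Rightarrow> complex"
  defines "A \<equiv> (\<lambda>n. \<Sum>k=1..n. c k)"
  assumes c: "abs_conv c 1" and A: "\<And>n. norm (A n) \<le> K * real n" and s: "Re s > 1"
  shows "dseries c s = s * dseries (\<lambda>n. A n / of_nat n) s + (\<Sum>n. A n * powr_diff_rem n s)"
proof -
  have *: "(\<Sum>n<N. c n * of_nat n powr (-s)) =
      (\<Sum>n<N. A n * (of_nat n powr (-s) - of_nat (Suc n) powr (-s))) + (if N = 0 then 0 else A (N-1) * of_nat N powr (-s))" for N
  proof (induction N)
    case (Suc N)
    show ?case
    proof (cases "N = 0")
      case False
      then have "A N = A (N - 1) + c N" unfolding A_def
        by (cases N) auto
      with Suc False show ?thesis by (simp add: algebra_simps)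
    qed (auto simp: A_def)
  qed auto
  have K: "K \<ge> 0" using order_trans[OF norm_ge_zero A[of 1]] by auto
  \<comment> \<open>The boundary term of the summation dies because \<open>A\<close> grows at most
    linearly and \<open>Re s > 1\<close>.\<close>
  have lim0: "(\<lambda>N. if N = 0 then 0 else A (N-1) * of_nat N powr (-s)) \<longlonglongrightarrow> 0"
  proof (rule Lim_null_comparison)
    show "\<forall>\<^sub>F N in sequentially. norm (if N = 0 then 0 else A (N-1) * of_nat N powr (-s)) \<le> K * real N powr (1 - Re s)"
    proof (rule always_eventually, rule allI)
      fix N
      show "norm (if N = 0 then 0 else A (N-1) * of_nat N powr (-s)) \<le> K * real N powr (1 - Re s)"
      proof (cases "N = 0")
        case False
        have "norm (A (N-1)) \<le> K * real N"
          using A[of "N-1"] False K by (smt (verit) mult_left_mono diff_le_self of_nat_mono)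
        then have "norm (A (N-1) * of_nat N powr (-s)) \<le> (K * real N) * real N powr (-Re s)"
          by (auto simp: norm_mult norm_nat_powr intro!: mult_right_mono)
        also have "\<dots> = K * real N powr (1 - Re s)"
          using False by (simp add: powr_diff powr_minus field_simps)
        finally show ?thesis using False by simp
      qed auto
    qed
    show "(\<lambda>N. K * real N powr (1 - Re s)) \<longlonglongrightarrow> 0"
      using s by real_asymp
  qed
  have "(\<lambda>N. (\<Sum>n<N. c n * of_nat n powr (-s)) - (if N = 0 then 0 else A (N-1) * of_nat N powr (-s))) \<longlonglongrightarrow> dseries c s - 0"
    by (intro tendsto_diff lim0) (use dseries_sums[OF c s] in \<open>simp add: sums_def\<close>)
  then have 1: "(\<lambda>n. A n * (of_nat n powr (-s) - of_nat (Suc n) powr (-s))) sums dseries c s"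
    unfolding sums_def * by simp
  have "abs_conv (\<lambda>n. A n / of_nat n) 1"
  proof (rule abs_conv_bounded)
    fix n show "norm (A n / of_nat n) \<le> K" using A[of n] K by (cases "n = 0") (auto simp: norm_divide field_simps)
  qed
  from sums_mult[OF dseries_sums[OF this s], of s]
  have 2: "(\<lambda>n. s * (A n / of_nat n * of_nat n powr (-s))) sums (s * dseries (\<lambda>n. A n / of_nat n) s)" .
  have 3: "(\<lambda>n. A n * powr_diff_rem n s) sums (\<Sum>n. A n * powr_diff_rem n s)"
    using s by (intro powr_diff_rem_series_sums[OF A]) auto
  have "s * (A n / of_nat n * of_nat n powr (-s)) + A n * powr_diff_rem n s = A n * (of_nat n powr (-s) - of_nat (Suc n) powr (-s))" for n
  proof (cases "n = 0")
    case False
    then show ?thesis by (simp add: powr_diff_rem_def powr_diff field_simps)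
  qed (auto simp: A_def)
  with sums_add[OF 2 3] have "(\<lambda>n. A n * (of_nat n powr (-s) - of_nat (Suc n) powr (-s))) sums
     (s * dseries (\<lambda>n. A n / of_nat n) s + (\<Sum>n. A n * powr_diff_rem n s))" by simp
  with 1 show ?thesis using sums_unique2 by blast
qed

section \<open>Continuation to the half-plane \<open>Re s > 0\<close>\<close>

lemma zeta_continuation:
  obtains H where "H holomorphic_on {s. Re s > 0}" "\<And>s. Re s > 1 \<Longrightarrow> dseries (\<lambda>_. 1) s = 1 / (s - 1) + H s"
proof -
  define Z where "Z = (\<lambda>s. - (\<Sum>n. of_nat n * powr_diff_rem n s))"
  have bd: "norm (of_nat n :: complex) \<le> 1 * real n" for n by auto
  have holo: "Z holomorphic_on {s. Re s > 0}"
    unfolding Z_def by (intro holomorphic_intros powr_diff_rem_series_holomorphic[OF bd])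
  have eq: "(s - 1) * dseries (\<lambda>_. 1) s = Z s" if s: "Re s > 1" for s
  proof -
    have "dseries (\<lambda>n. (\<Sum>k=1..n. 1) / of_nat n) s = dseries (\<lambda>_. 1) s"
      unfolding dseries_def by (rule suminf_cong) auto
    then show ?thesis
      using dseries_by_parts[of "\<lambda>_. 1" 1 s] abs_conv_const s
      by (simp add: Z_def algebra_simps)
  qed
  have "(\<lambda>n. of_nat n * powr_diff_rem n 1) sums (0 - 1 :: complex)"
  proof -
    \<comment> \<open>At \<open>s = 1\<close> the terms telescope, since
      \<open>n * (1/n - 1/(n+1) - 1/n^2) = 1/(n+1) - 1/n\<close>. The value 1 at index 0 makes the
      zeroth difference vanish. The sum fixes the residue at 1.\<close>
    define g where "g = (\<lambda>n. if n = 0 then 1 else 1 / of_nat n :: complex)"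
    have "g \<longlonglongrightarrow> 0" unfolding g_def
      by (rule Lim_transform_eventually[OF lim_1_over_n]) (auto intro: eventually_mono[OF eventually_gt_at_top[of 0]])
    from telescope_sums[OF this] have 1: "(\<lambda>n. g (Suc n) - g n) sums (0 - g 0)" .
    have "g (Suc n) - g n = of_nat n * powr_diff_rem n 1" for n
    proof (cases "n = 0")
      case False
      have "(of_nat n :: complex) + 1 \<noteq> 0" by (metis of_nat_Suc of_nat_eq_0_iff nat.distinct(1) add.commute)
      moreover have "(of_nat n :: complex) powr (-2) = 1 / of_nat n ^ 2"
        using False by (simp add: powr_minus inverse_eq_divide)
      ultimately show ?thesis using False
        by (simp add: g_def powr_diff_rem_def powr_minus divide_simps power2_eq_square) (simp add: algebra_simps)
    qed (auto simp: g_def powr_diff_rem_def)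
    then have "(\<lambda>n. of_nat n * powr_diff_rem n 1) = (\<lambda>n. g (Suc n) - g n)" by auto
    with 1 show ?thesis by (simp add: g_def)
  qed
  then have Z1: "Z 1 = 1" by (simp add: Z_def sums_iff)
  define H where "H = (\<lambda>s. if s = 1 then deriv Z 1 else Z s / (s - 1) - Z 1 / (s - 1))"
  have "H holomorphic_on {s. Re s > 0}"
    unfolding H_def by (rule pole_theorem_open[OF holo open_Re_gt]) auto
  moreover have "dseries (\<lambda>_. 1) s = 1 / (s - 1) + H s" if "Re s > 1" for s
  proof -
    have "s \<noteq> 1" using that by auto
    moreover from this have "dseries (\<lambda>_. 1) s = Z s / (s - 1)" using eq[OF that] by (simp add: eq_divide_eq mult.commute)
    ultimately show ?thesis by (simp add: H_def Z1)
  qed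
  ultimately show thesis using that by blast
qed

text \<open>Subtracting the mean \<mu> leaves coefficients with bounded partial sums, and then the
  averages \<open>B n / n\<close> form a series converging absolutely for \<open>Re s > 0\<close>.
  The pole comes back only through \<mu> times the zeta series.\<close>

lemma dseries_continuation:
  fixes f :: "nat \<Rightarrow> complex"
  assumes f: "\<And>n. norm (f n) \<le> M" and A: "\<And>n. norm ((\<Sum>k=1..n. f k) - of_nat n * \<mu>) \<le> K"
  obtains H where "H holomorphic_on {s. Re s > 0}" "\<And>s. Re s > 1 \<Longrightarrow> dseries f s = \<mu> / (s - 1) + H s"
proof -
  obtain H0 where H0: "H0 holomorphic_on {s. Re s > 0}" "\<And>s. Re s > 1 \<Longrightarrow> dseries (\<lambda>_. 1) s = 1 / (s - 1) + H0 s"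
    using zeta_continuation by blast
  define c where "c = (\<lambda>n. f n - \<mu>)"
  define B where "B = (\<lambda>n. \<Sum>k=1..n. c k)"
  have B: "norm (B n) \<le> K" for n
    using A[of n] by (simp add: B_def c_def sum_subtractf)
  have K: "K \<ge> 0" using order_trans[OF norm_ge_zero B[of 0]] .
  have Bn: "norm (B n) \<le> K * real n" for n
  proof (cases "n = 0")
    case False
    then have "K * 1 \<le> K * real n" using K by (intro mult_left_mono) auto
    then show ?thesis using B[of n] by linarith
  qed (simp add: B_def)
  have c: "abs_conv c 1"
  proof (rule abs_conv_bounded)
    fix n show "norm (c n) \<le> M + norm \<mu>"
      using norm_triangle_ineq4[of "f n" \<mu>] f[of n] by (simp add: c_def)
  qed
  define H where "H = (\<lambda>s. s * dseries (\<lambda>n. B n / of_nat n) s + (\<Sum>n. B n * powr_diff_rem n s))"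
  have "H holomorphic_on {s. Re s > 0}"
    unfolding H_def
    by (intro holomorphic_intros powr_diff_rem_series_holomorphic[OF Bn] dseries_holomorphic abs_conv_bounded_over_n[OF B])
  moreover have "dseries f s = dseries c s + \<mu> * dseries (\<lambda>_. 1) s" if "Re s > 1" for s
  proof -
    have "(\<lambda>n. c n * of_nat n powr (-s) + \<mu> * (1 * of_nat n powr (-s))) sums (dseries c s + \<mu> * dseries (\<lambda>_. 1) s)"
      by (intro sums_add sums_mult dseries_sums[OF _ that] c abs_conv_const)
    then show ?thesis unfolding dseries_def[of f]
      by (simp add: c_def sums_iff algebra_simps)
  qed
  moreover have "dseries c s = H s" if "Re s > 1" for s
    unfolding H_def B_def using Bn by (intro dseries_by_parts[OF c _ that]) (auto simp: B_def)
  ultimately have "H holomorphic_on {s. Re s > 0}"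
    "\<And>s. Re s > 1 \<Longrightarrow> dseries f s = H s + \<mu> * (1 / (s - 1) + H0 s)"
    using H0(2) by simp_all
  moreover from this have "\<And>s. Re s > 1 \<Longrightarrow> dseries f s = \<mu> / (s - 1) + (H s + \<mu> * H0 s)"
    by (simp add: distrib_left)
  ultimately show thesis
    using that[of "\<lambda>s. H s + \<mu> * H0 s"] H0(1) by (simp add: holomorphic_on_add holomorphic_on_mult)
qed

section \<open>Completely multiplicative coefficients\<close>

lemma nat_mult_powr: "(of_nat (m * n) :: complex) powr s = of_nat m powr s * of_nat n powr s"
  using powr_times_real[of "of_nat m" "of_nat n" s] by simp

lemma dseries_minus:
  assumes "abs_conv c \<sigma>0" "Re s > \<sigma>0"
  shows "dseries (\<lambda>n. - c n) s = - dseries c s"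
  using sums_minus[OF dseries_sums[OF assms]] by (simp add: dseries_def[of "\<lambda>n. - c n"] sums_iff)

text \<open>Absolute convergence allows the double sum over \<open>(d, k)\<close> to be regrouped by
  the product \<open>n = d * k\<close>. The index 0 is cut out first, because it has infinitely many
  divisors.\<close>

lemma dseries_mult:
  assumes f: "abs_conv f 1" and g: "abs_conv g 1" and s: "Re s > 1"
    and h: "\<And>n. n > 0 \<Longrightarrow> h n = (\<Sum>d | d dvd n. f d * g (n div d))"
  shows "dseries h s = dseries f s * dseries g s"
proof -
  let ?t = "\<lambda>c n. c n * of_nat n powr (-s)"
  let ?I = "{0::nat<..}"
  have hs: "(?t c has_sum dseries c s) ?I" if "abs_conv c 1" for c
  proof -
    have "(?t c has_sum dseries c s) UNIV"
      by (rule norm_summable_imp_has_sum[OF abs_conv_summable[OF that s] dseries_sums[OF that s]])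
    then show ?thesis by (subst has_sum_cong_neutral[where T = UNIV and g = "?t c"]) auto
  qed
  have nrm: "(\<lambda>n. norm (?t c n)) summable_on ?I" if "abs_conv c 1" for c
    by (rule summable_on_subset_banach[OF summable_nonneg_imp_summable_on[OF abs_conv_summable[OF that s]]]) auto
  have "(\<lambda>(d, k). norm (?t f d) * norm (?t g k)) summable_on ?I \<times> ?I"
  proof (rule summable_on_SigmaI)
    fix d assume "d \<in> ?I"
    have "((\<lambda>k. norm (?t f d) * norm (?t g k)) has_sum (norm (?t f d) * infsum (\<lambda>k. norm (?t g k)) ?I)) ?I"
      by (intro has_sum_cmult_right has_sum_infsum nrm g)
    then show "((\<lambda>k. case (d, k) of (d, k) \<Rightarrow> norm (?t f d) * norm (?t g k)) has_sum (norm (?t f d) * infsum (\<lambda>k. norm (?t g k)) ?I)) ?I"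
      by simp
  next
    show "(\<lambda>d. norm (?t f d) * infsum (\<lambda>k. norm (?t g k)) ?I) summable_on ?I"
      by (intro summable_on_cmult_left nrm f)
  qed auto
  then have "(\<lambda>x. norm (case x of (d, k) \<Rightarrow> ?t f d * ?t g k)) summable_on ?I \<times> ?I"
    by (simp add: case_prod_unfold norm_mult)
  then have sm: "(\<lambda>(d, k). ?t f d * ?t g k) summable_on ?I \<times> ?I"
    by (rule abs_summable_summable)
  have "((\<lambda>(d, k). ?t f d * ?t g k) has_sum (dseries f s * dseries g s)) (?I \<times> ?I)"
  proof (rule has_sum_SigmaI[OF _ _ sm])
    fix d assume "d \<in> ?I"
    have "((\<lambda>k. ?t f d * ?t g k) has_sum (?t f d * dseries g s)) ?I"
      by (intro has_sum_cmult_right hs g)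
    then show "((\<lambda>k. case (d, k) of (d, k) \<Rightarrow> ?t f d * ?t g k) has_sum (?t f d * dseries g s)) ?I" by simp
  next
    show "((\<lambda>d. ?t f d * dseries g s) has_sum (dseries f s * dseries g s)) ?I"
      by (intro has_sum_cmult_left hs f)
  qed
  also have "?this \<longleftrightarrow> ((\<lambda>(n, d). ?t f d * ?t g (n div d)) has_sum (dseries f s * dseries g s)) (Sigma ?I (\<lambda>n. {d. d dvd n}))"
    by (rule has_sum_reindex_bij_witness[of _ "\<lambda>(n, d). (d, n div d)" "\<lambda>(d, k). (d * k, d)"])
       (auto intro: Nat.gr0I elim!: dvdE)
  finally have "((\<lambda>n. \<Sum>d | d dvd n. ?t f d * ?t g (n div d)) has_sum (dseries f s * dseries g s)) ?I"
    by (rule has_sum_SigmaD) (auto intro!: has_sum_finite)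
  also have "?this \<longleftrightarrow> (?t h has_sum (dseries f s * dseries g s)) ?I"
  proof (rule has_sum_cong)
    fix n assume n: "n \<in> ?I"
    have "?t h n = (\<Sum>d | d dvd n. f d * g (n div d) * of_nat n powr (-s))"
      using h[of n] n by (simp add: sum_distrib_right)
    also have "\<dots> = (\<Sum>d | d dvd n. ?t f d * ?t g (n div d))"
    proof (rule sum.cong)
      fix d assume "d \<in> {d. d dvd n}"
      then have "n = d * (n div d)" by simp
      then have "(of_nat n :: complex) powr (-s) = of_nat d powr (-s) * of_nat (n div d) powr (-s)"
        using nat_mult_powr[of d "n div d" "-s"] by metis
      then show "f d * g (n div d) * of_nat n powr (-s) = ?t f d * ?t g (n div d)" by simp
    qed auto
    finally show "(\<Sum>d | d dvd n. ?t f d * ?t g (n div d)) = ?t h n" by simp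
  qed
  also have "\<dots> \<longleftrightarrow> (?t h has_sum (dseries f s * dseries g s)) UNIV"
    by (rule has_sum_cong_neutral) auto
  finally show ?thesis
    unfolding dseries_def[of h] by (metis has_sum_imp_sums sums_unique)
qed

locale completely_multiplicative =
  fixes chi :: "nat \<Rightarrow> complex"
  assumes chi_1: "chi 1 = 1" and chi_mult: "chi (m * n) = chi m * chi n" and chi_le: "norm (chi n) \<le> 1"
begin

definition chi_mangoldt :: "nat \<Rightarrow> complex" where
  "chi_mangoldt n = chi n * of_real (mangoldt n)"

lemma abs_conv_chi: "abs_conv chi 1"
  by (rule abs_conv_bounded[OF chi_le])

lemma abs_conv_chi_mangoldt: "abs_conv chi_mangoldt 1"
proof (rule abs_conv_le[OF abs_conv_ln])
  fix n :: nat
  show "norm (chi_mangoldt n) \<le> 1 * norm (complex_of_real (ln (real n)))"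
  proof (cases "n = 0")
    case False
    then have "(mangoldt n :: real) \<le> ln n" by (intro mangoldt_le) auto
    then show ?thesis using chi_le[of n] mangoldt_nonneg[of n] False
      using mult_left_le_one_le[of "mangoldt n" "norm (chi n)"] by (simp add: chi_mangoldt_def norm_mult)
  qed (auto simp: chi_mangoldt_def)
qed

text \<open>The identity \<open>\<Sum>d dvd n. mangoldt d = ln n\<close>, twisted by the
  multiplicative \<open>chi\<close>. It is stated without a quotient, because non-vanishing is going
  to be deduced from it.\<close>

lemma dseries_chi_deriv:
  assumes "Re s > 1"
  shows "(dseries chi has_field_derivative - dseries chi_mangoldt s * dseries chi s) (at s)"
proof -
  have "dseries (\<lambda>n. chi n * of_real (ln (real n))) s = dseries chi_mangoldt s * dseries chi s"
  proof (rule dseries_mult[OF abs_conv_chi_mangoldt abs_conv_chi assms])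
    fix n :: nat assume "n > 0"
    have "(\<Sum>d | d dvd n. chi_mangoldt d * chi (n div d)) = (\<Sum>d | d dvd n. chi n * of_real (mangoldt d))"
    proof (rule sum.cong)
      fix d assume "d \<in> {d. d dvd n}"
      then have "chi n = chi d * chi (n div d)" using chi_mult[of d "n div d"] by simp
      then show "chi_mangoldt d * chi (n div d) = chi n * of_real (mangoldt d)" by (simp add: chi_mangoldt_def)
    qed auto
    also have "\<dots> = chi n * (\<Sum>d | d dvd n. mangoldt d)" by (simp add: sum_distrib_left)
    also have "(\<Sum>d | d dvd n. mangoldt d :: complex) = of_real (ln (real n))"
      using \<open>n > 0\<close> by (intro mangoldt_sum) auto
    finally show "chi n * of_real (ln (real n)) = (\<Sum>d | d dvd n. chi_mangoldt d * chi (n div d))" by simp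
  qed
  moreover have "dseries (\<lambda>n. - (chi n * of_real (ln (real n)))) s = - dseries (\<lambda>n. chi n * of_real (ln (real n))) s"
  proof (rule dseries_minus[OF _ assms])
    show "abs_conv (\<lambda>n. chi n * of_real (ln (real n))) 1"
      by (rule abs_conv_le[OF abs_conv_ln, of _ 1])
         (auto simp: norm_mult intro!: mult_left_le_one_le chi_le)
  qed
  ultimately show ?thesis using dseries_has_field_derivative[OF abs_conv_chi assms] by simp
qed

text \<open>The leading term 1 outweighs the rest: the terms from index 2 on are dominated by a
  telescoping series with sum \<open>1/2\<close>.\<close>

lemma dseries_chi_3: "dseries chi 3 \<noteq> 0"
proof
  assume 0: "dseries chi 3 = 0"
  define t where "t = (\<lambda>n. chi n * of_nat n powr (-3))"
  have "t sums 0" unfolding t_def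
    using dseries_sums[OF abs_conv_chi, of 3] 0 by simp
  then have "(\<lambda>n. t (n + 2)) sums (0 - (\<Sum>n<2. t n))" by (rule sums_split_initial_segment)
  moreover have "(\<Sum>n<2. t n) = 1" using chi_1 by (simp add: t_def numeral_2_eq_2)
  ultimately have 1: "(\<lambda>n. t (n + 2)) sums (-1)" by simp
  have b: "norm (t (n + 2)) \<le> 1/2 * (inverse (real (Suc n)) - inverse (real (Suc (Suc n))))" for n
  proof -
    have "norm (t (n + 2)) \<le> 1 * (real n + 2) powr (-3)"
      unfolding t_def norm_mult norm_nat_powr by (intro mult_mono chi_le) (auto simp: add.commute)
    also have "\<dots> = 1 / (real n + 2) ^ 3" by (simp add: powr_minus field_simps)
    also have "\<dots> \<le> 1/2 * (1 / (real n + 1) - 1 / (real n + 2))"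
      by (simp add: divide_simps power3_eq_cube) (simp add: algebra_simps)
    finally show ?thesis by (simp add: inverse_eq_divide algebra_simps)
  qed
  have 2: "(\<lambda>n. 1/2 * (inverse (real (Suc n)) - inverse (real (Suc (Suc n))))) sums (1/2 * (inverse (real (Suc 0)) - 0))"
    by (intro sums_mult telescope_sums') (rule LIMSEQ_inverse_real_of_nat)
  have "norm (\<Sum>n. t (n + 2)) \<le> (\<Sum>n. 1/2 * (inverse (real (Suc n)) - inverse (real (Suc (Suc n)))))"
    by (rule norm_suminf_le) (use 2 b in \<open>auto simp: sums_iff\<close>)
  with 1 2 show False by (simp add: sums_iff)
qed

text \<open>This replaces the Euler product. The series solves a linear equation
  \<open>L' = - D * L\<close> on a convex domain, so \<open>L * exp E\<close> is constant for a
  primitive \<open>E\<close> of \<open>D\<close>, and non-vanishing at the single point 3 spreads to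
  the whole half-plane.\<close>

lemma dseries_chi_nonzero:
  assumes "Re s > 1"
  shows "dseries chi s \<noteq> 0"
proof -
  let ?S = "{s. Re s > (1::real)}"
  have cv: "convex ?S" by (rule convex_halfspace_Re_gt)
  obtain E where E: "\<And>x. x \<in> ?S \<Longrightarrow> (E has_field_derivative dseries chi_mangoldt x) (at x within ?S)"
    using holomorphic_convex_primitive'[OF cv open_Re_gt dseries_holomorphic[OF abs_conv_chi_mangoldt]] by blast
  have "((\<lambda>s. dseries chi s * exp (E s)) has_field_derivative 0) (at x within ?S)" if "x \<in> ?S" for x
    by (rule DERIV_cong, rule DERIV_mult[OF has_field_derivative_at_within[OF dseries_chi_deriv] DERIV_chain2[OF DERIV_exp E]])
       (use that in auto)
  then obtain c where c: "\<And>x. x \<in> ?S \<Longrightarrow> dseries chi x * exp (E x) = c"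
    using has_field_derivative_zero_constant[OF cv, of "\<lambda>s. dseries chi s * exp (E s)"] by blast
  have "c \<noteq> 0" using c[of 3] dseries_chi_3 by auto
  then show ?thesis using c[of s] assms by auto
qed

end

section \<open>Landau's lemma\<close>

lemma abs_conv_of_summable:
  assumes "summable (\<lambda>n. norm (c n) * real n powr (-x))"
  shows "abs_conv c x"
  unfolding abs_conv_def
proof safe
  fix \<sigma> assume "\<sigma> > x"
  have "norm (c n) * real n powr (-\<sigma>) \<le> norm (c n) * real n powr (-x)" for n
  proof (cases "n = 0")
    case False
    then show ?thesis using \<open>\<sigma> > x\<close> by (intro mult_left_mono powr_mono) auto
  qed auto
  then show "summable (\<lambda>n. norm (c n) * real n powr (-\<sigma>))"
    by (intro summable_comparison_test'[OF assms]) auto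
qed

lemma higher_deriv_dirichlet_polynomial:
  fixes c :: "nat \<Rightarrow> complex"
  shows
  "(deriv ^^ m) (\<lambda>s. \<Sum>n<M. c n * of_nat n powr (-s)) =
   (\<lambda>s. \<Sum>n<M. c n * (- of_real (ln (real n))) ^ m * of_nat n powr (-s))"
proof (induction m)
  case (Suc m)
  have "((\<lambda>s. \<Sum>n<M. c n * (- of_real (ln (real n))) ^ m * of_nat n powr (-s)) has_field_derivative
      (\<Sum>n<M. c n * (- of_real (ln (real n))) ^ m * (- of_real (ln (real n)) * of_nat n powr (-s)))) (at s)" for s :: complex
    by (intro DERIV_sum DERIV_cmult has_field_derivative_nat_powr)
  then have "deriv (\<lambda>s. \<Sum>n<M. c n * (- of_real (ln (real n))) ^ m * of_nat n powr (-s)) =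
      (\<lambda>s. \<Sum>n<M. c n * (- of_real (ln (real n))) ^ m * (- of_real (ln (real n)) * of_nat n powr (-s)))"
    by (intro ext DERIV_imp_deriv)
  then show ?case unfolding funpow.simps o_apply Suc.IH by (simp add: mult_ac)
qed auto

lemma dirichlet_polynomial_uniform_limit:
  assumes "abs_conv c \<sigma>0" "x > \<sigma>0"
  shows "uniform_limit {s. Re s > x} (\<lambda>M s. \<Sum>n<M. c n * of_nat n powr (-s)) (dseries c) sequentially"
  unfolding dseries_def
proof (rule Weierstrass_m_test)
  show "summable (\<lambda>n. norm (c n) * real n powr (-x))"
    using assms by (auto simp: abs_conv_def)
  fix n s assume s: "s \<in> {s. Re s > x}"
  show "norm (c n * of_nat n powr (-s)) \<le> norm (c n) * real n powr (-x)"
  proof (cases "n = 0")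
    case False
    then show ?thesis unfolding norm_mult norm_nat_powr using s
      by (intro mult_left_mono powr_mono) auto
  qed auto
qed

text \<open>Landau's argument: all Taylor coefficients of a Dirichlet series with nonnegative coefficients
  have alternating signs, so the Taylor series to the left of the centre may be rearranged.\<close>

lemma summable_left_of_holomorphic_ball:
  fixes a :: "nat \<Rightarrow> real"
  assumes a: "\<And>n. a n \<ge> 0" and conv: "abs_conv (\<lambda>n. of_real (a n)) \<sigma>0" and x: "x > \<sigma>0"
    and H: "H holomorphic_on ball (of_real x) r"
    and eq: "\<And>s. s \<in> ball (of_real x) r \<Longrightarrow> Re s > \<sigma>0 \<Longrightarrow> H s = dseries (\<lambda>n. of_real (a n)) s"
    and \<rho>: "0 \<le> \<rho>" "\<rho> < r"
  shows "summable (\<lambda>n. a n * real n powr (-(x - \<rho>)))"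
proof -
  define c where "c = (\<lambda>n. complex_of_real (a n))"
  define P where "P = (\<lambda>M s. \<Sum>n<M. c n * of_nat n powr (-s))"
  define y where "y = (\<sigma>0 + x) / 2"
  have y: "y > \<sigma>0" "x > y" using x by (auto simp: y_def)
  define T where "T = (\<lambda>m. (deriv ^^ m) H (of_real x) / fact m * (-of_real \<rho>) ^ m)"
  \<comment> \<open>The share of the first \<open>M\<close> coefficients in the \<open>m\<close>-th
    Taylor term at \<open>x - \<rho>\<close>. The signs of \<open>(- ln n) ^ m\<close> and
    \<open>(- \<rho>) ^ m\<close> cancel, so every summand is nonnegative and \<open>t\<close>
    increases with \<open>M\<close>.\<close>
  define t where "t = (\<lambda>M m. \<Sum>n<M. a n * real n powr (-x) * ((\<rho> * ln (real n)) ^ m / fact m))"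
  have ul: "uniform_limit {s. Re s > y} P (dseries c) sequentially"
    unfolding P_def c_def by (rule dirichlet_polynomial_uniform_limit[OF conv y(1)])
  have lim: "(\<lambda>M. (deriv ^^ m) (P M) (of_real x)) \<longlonglongrightarrow> (deriv ^^ m) H (of_real x)" for m
  proof -
    have "(\<lambda>M. (deriv ^^ m) (P M) (of_real x)) \<longlonglongrightarrow> (deriv ^^ m) (dseries c) (of_real x)"
    proof (rule higher_deriv_complex_uniform_limit[OF ul])
      have "(\<lambda>s. of_nat n powr (-s)) holomorphic_on A" for n A
        using has_field_derivative_nat_powr by (meson field_differentiable_at_within field_differentiable_def holomorphic_on_def)
      then show "\<forall>\<^sub>F M in sequentially. P M holomorphic_on {s. Re s > y}"
        unfolding P_def by (intro always_eventually allI holomorphic_intros)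
    qed (use y open_Re_gt in auto)
    also have "(deriv ^^ m) (dseries c) (of_real x) = (deriv ^^ m) H (of_real x)"
    proof (rule higher_deriv_transform_within_open)
      let ?B = "ball (of_real x) r \<inter> {s. Re s > \<sigma>0}"
      show "H holomorphic_on ?B" by (rule holomorphic_on_subset[OF H]) auto
      show "dseries c holomorphic_on ?B"
        by (rule holomorphic_on_subset[OF dseries_holomorphic[OF conv[folded c_def]]]) auto
      show "open ?B" by (intro open_Int open_ball open_Re_gt)
      show "of_real x \<in> ?B" using x \<rho> by auto
    qed (use eq in \<open>auto simp: c_def\<close>)
    finally show ?thesis .
  qed
  have P_t: "(deriv ^^ m) (P M) (of_real x) / fact m * (-of_real \<rho>) ^ m = of_real (t M m)" for M m
  proof -
    have "(deriv ^^ m) (P M) (of_real x) / fact m * (-of_real \<rho>) ^ m =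
       (\<Sum>n<M. c n * (- of_real (ln (real n))) ^ m * of_nat n powr (- of_real x) / fact m * (-of_real \<rho>) ^ m)"
      unfolding P_def higher_deriv_dirichlet_polynomial by (simp add: sum_distrib_right sum_divide_distrib)
    also have "\<dots> = (\<Sum>n<M. of_real (a n * real n powr (-x) * ((\<rho> * ln (real n)) ^ m / fact m)))"
    proof (rule sum.cong)
      fix n
      have "(of_nat n :: complex) powr (- of_real x) = of_real (real n powr (-x))"
        using powr_of_real[of "real n" "-x"] by simp
      moreover have "(- of_real (ln (real n))) ^ m * (-of_real \<rho>) ^ m = (complex_of_real ((\<rho> * ln (real n)) ^ m))"
        by (simp add: power_mult_distrib[symmetric] mult.commute)
      ultimately show "c n * (- of_real (ln (real n))) ^ m * of_nat n powr (- of_real x) / fact m * (-of_real \<rho>) ^ m =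
         of_real (a n * real n powr (-x) * ((\<rho> * ln (real n)) ^ m / fact m))"
        by (simp add: c_def field_simps)
    qed auto
    finally show ?thesis by (simp add: t_def)
  qed
  have lim_t: "(\<lambda>M. t M m) \<longlonglongrightarrow> Re (T m)" for m
  proof -
    have "(\<lambda>M. (deriv ^^ m) (P M) (of_real x) / fact m * (-of_real \<rho>) ^ m) \<longlonglongrightarrow> T m"
      unfolding T_def by (intro tendsto_intros lim) auto
    from tendsto_Re[OF this] show ?thesis unfolding P_t by simp
  qed
  have ln_nonneg: "ln (real n) \<ge> 0" for n by (cases "n = 0") auto
  have t_mono: "t M m \<le> t M' m" if "M \<le> M'" for M M' m
    unfolding t_def using that a ln_nonneg \<rho> by (intro sum_mono2) auto
  have t_le: "t M m \<le> Re (T m)" for M m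
    by (rule LIMSEQ_le_const[OF lim_t]) (use t_mono in blast)
  have "T sums H (of_real x - of_real \<rho>)"
    unfolding T_def using holomorphic_power_series[OF H, of "of_real x - of_real \<rho>"] \<rho>
    by (simp add: dist_norm)
  from sums_Re[OF this] have T: "(\<lambda>m. Re (T m)) sums Re (H (of_real x - of_real \<rho>))" .
  \<comment> \<open>Summing over \<open>m\<close> first turns the exponential series into
    \<open>n powr \<rho>\<close>. Comparison with the Taylor series term by term then bounds every
    partial sum by one number independent of \<open>M\<close>.\<close>
  have partial: "(\<Sum>n<M. a n * real n powr (-(x - \<rho>))) \<le> Re (H (of_real x - of_real \<rho>))" for M
  proof -
    have "(t M) sums (\<Sum>n<M. a n * real n powr (-x) * exp (\<rho> * ln (real n)))"
      unfolding t_def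
    proof (intro sums_sum sums_mult)
      fix n show "(\<lambda>m. (\<rho> * ln (real n)) ^ m / fact m) sums exp (\<rho> * ln (real n))"
        using exp_converges[of "\<rho> * ln (real n)"] by (simp add: divide_inverse mult.commute)
    qed
    moreover have "(\<Sum>n<M. a n * real n powr (-x) * exp (\<rho> * ln (real n))) = (\<Sum>n<M. a n * real n powr (-(x - \<rho>)))"
      by (intro sum.cong) (auto simp: powr_def exp_add[symmetric] algebra_simps)
    ultimately show ?thesis using sums_le[OF t_le _ T] by simp
  qed
  show ?thesis
    by (rule summableI_nonneg_bounded[OF _ partial]) (use a in auto)
qed

text \<open>On the real axis \<open>\<bar>F\<bar>\<close> is nonincreasing wherever the Dirichlet series converges, so
  \<open>F\<close> cannot vanish at the abscissa of convergence, and \<open>-F'/F\<close> continues the series beyond it.\<close>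

lemma landau_log_derivative:
  fixes a :: "nat \<Rightarrow> real"
  assumes a: "\<And>n. a n \<ge> 0" and conv: "abs_conv (\<lambda>n. of_real (a n)) 1"
    and U: "open U" "convex U" "\<And>x. x > 0 \<Longrightarrow> of_real x \<in> U" and F: "F holomorphic_on U"
    and deriv: "\<And>s. s \<in> U \<Longrightarrow> Re s > 1 \<Longrightarrow> deriv F s = - dseries (\<lambda>n. of_real (a n)) s * F s"
    and F2: "F 2 \<noteq> 0"
  shows "abs_conv (\<lambda>n. of_real (a n)) 0"
proof -
  let ?c = "\<lambda>n. complex_of_real (a n)"
  let ?D = "dseries ?c"
  define X where "X = {\<sigma>. 0 \<le> \<sigma> \<and> \<sigma> \<le> 1 \<and> abs_conv ?c \<sigma>}"
  define x where "x = Inf X"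
  have X: "1 \<in> X" "bdd_below X" using conv by (auto simp: X_def)
  have x0: "x \<ge> 0" unfolding x_def by (rule cInf_greatest) (use X in \<open>auto simp: X_def\<close>)
  have x1: "x \<le> 1" unfolding x_def by (rule cInf_lower[OF X])
  have conv_x: "abs_conv ?c x"
    unfolding abs_conv_def
  proof safe
    fix \<sigma> assume "\<sigma> > x"
    then obtain \<sigma>' where "\<sigma>' \<in> X" "\<sigma>' < \<sigma>" unfolding x_def using X cInf_less_iff[of X \<sigma>] by auto
    then show "summable (\<lambda>n. norm (?c n) * real n powr (-\<sigma>))"
      by (auto simp: X_def abs_conv_def)
  qed
  show ?thesis
  proof (cases "x = 0")
    case True then show ?thesis using conv_x by simp
  next
    case False
    then have xpos: "x > 0" using x0 by simp
    define V where "V = U \<inter> {s. Re s > x}"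
    have V: "open V" "convex V" unfolding V_def
      by (auto intro!: open_Int convex_Int U open_Re_gt convex_halfspace_Re_gt)
    have 2: "2 \<in> V" using U(3)[of 2] x1 by (auto simp: V_def)
    have F_V: "F holomorphic_on V" by (rule holomorphic_on_subset[OF F]) (auto simp: V_def)
    have D_V: "?D holomorphic_on V" by (rule holomorphic_on_subset[OF dseries_holomorphic[OF conv_x]]) (auto simp: V_def)
    \<comment> \<open>The equation is known only for \<open>Re s > 1\<close>; both sides are
      holomorphic on the connected set \<open>V\<close>, so it persists up to the abscissa
      \<open>x\<close>.\<close>
    have dF: "deriv F s = - ?D s * F s" if "s \<in> V" for s
    proof (rule analytic_continuation_open[of "V \<inter> {s. Re s > 1}" V "deriv F"])
      show "open (V \<inter> {s. Re s > 1})" by (intro open_Int V open_Re_gt)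
      show "V \<inter> {s. Re s > 1} \<noteq> {}" using 2 by auto
      show "connected V" by (rule convex_connected[OF V(2)])
      show "deriv F holomorphic_on V" by (rule holomorphic_deriv[OF F_V V(1)])
      show "(\<lambda>s. - ?D s * F s) holomorphic_on V" by (intro holomorphic_intros D_V F_V)
    qed (use V that deriv in \<open>auto simp: V_def\<close>)
    obtain E where E: "\<And>s. s \<in> V \<Longrightarrow> (E has_field_derivative ?D s) (at s within V)"
      using holomorphic_convex_primitive'[OF V(2,1) D_V] by blast
    have "((\<lambda>s. F s * exp (E s)) has_field_derivative 0) (at s within V)" if "s \<in> V" for s
    proof -
      have "(F has_field_derivative deriv F s) (at s within V)"
        by (rule has_field_derivative_at_within[OF holomorphic_derivI[OF F_V V(1) that]])
      from DERIV_mult[OF this DERIV_chain2[OF DERIV_exp E[OF that]]] show ?thesis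
        by (rule DERIV_cong) (simp add: dF[OF that])
    qed
    then obtain C where C: "\<And>s. s \<in> V \<Longrightarrow> F s * exp (E s) = C"
      using has_field_derivative_zero_constant[OF V(2), of "\<lambda>s. F s * exp (E s)"] by blast
    have F_nz: "F s \<noteq> 0" if "s \<in> V" for s using C[OF that] C[OF 2] F2 by auto
    have D_nonneg: "Re (?D (of_real u)) \<ge> 0" "Im (?D (of_real u)) = 0" if "u > x" for u
    proof -
      have eq: "?c n * of_nat n powr (- of_real u) = of_real (a n * real n powr (-u))" for n
        using powr_of_real[of "real n" "-u"] by simp
      have *: "(\<lambda>n. of_real (a n * real n powr (-u))) sums ?D (of_real u)"
        using dseries_sums[OF conv_x, of "of_real u"] that unfolding eq by simp
      show "Re (?D (of_real u)) \<ge> 0"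
        by (rule sums_le[OF _ sums_zero sums_Re[OF *]]) (use a in auto)
      show "Im (?D (of_real u)) = 0"
        using sums_Im[OF *] by (simp add: sums_iff)
    qed
    \<comment> \<open>\<open>E\<close> is a primitive of a series that is real and nonnegative on
      the real axis, so \<open>Re E\<close> does not decrease from \<open>u\<close> to 2, while
      \<open>norm F * exp (Re E)\<close> is constant.\<close>
    have lower: "norm (F (of_real u)) \<ge> norm (F 2)" if u: "x < u" "u < 2" for u
    proof -
      have seg: "closed_segment (of_real u) 2 \<subseteq> V"
        by (rule closed_segment_subset[OF _ 2 V(2)]) (use u xpos U(3)[of u] in \<open>auto simp: V_def\<close>)
      have "\<exists>z. z \<in> closed_segment (of_real u) 2 \<and> Re (E 2) - Re (E (of_real u)) = Re (?D z * (2 - of_real u))"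
      proof (rule complex_mvt_line)
        fix z :: complex assume "z \<in> closed_segment (of_real u) 2"
        then have "z \<in> V" using seg by blast
        then show "(E has_field_derivative ?D z) (at z)"
          using E[of z] at_within_open[OF _ V(1), of z] by simp
      qed
      then obtain z where z: "z \<in> closed_segment (of_real u) 2" "Re (E 2) - Re (E (of_real u)) = Re (?D z * (2 - of_real u))"
        by blast
      have "closed_segment (of_real u) 2 = (of_real ` closed_segment u 2 :: complex set)"
        by (metis closed_segment_of_real of_real_numeral)
      then obtain v where v: "z = of_real v" "v \<ge> u"
        using z(1) u by (auto simp: closed_segment_eq_real_ivl)
      have "Re (?D z * (2 - of_real u)) \<ge> 0" using D_nonneg[of v] v u by simp
      then have "Re (E (of_real u)) \<le> Re (E 2)" using z(2) by linarith
      moreover have "norm (F (of_real u)) * exp (Re (E (of_real u))) = norm (F 2) * exp (Re (E 2))"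
      proof -
        have "of_real u \<in> V" using seg ends_in_segment(1) by blast
        then have "norm (F (of_real u) * exp (E (of_real u))) = norm (F 2 * exp (E 2))"
          using C[of "of_real u"] C[OF 2] by simp
        then show ?thesis by (simp add: norm_mult)
      qed
      ultimately have "norm (F 2) * exp (Re (E (of_real u))) \<le> norm (F (of_real u)) * exp (Re (E (of_real u)))"
        using mult_left_mono[of "exp (Re (E (of_real u)))" "exp (Re (E 2))" "norm (F 2)"] by simp
      then show ?thesis by simp
    qed
    have contF: "continuous_on U F" by (rule holomorphic_on_imp_continuous_on[OF F])
    have xU: "of_real x \<in> U" using U(3) xpos by simp
    have "norm (F (of_real x)) \<ge> norm (F 2)"
    proof (rule tendsto_lowerbound)
      show "((\<lambda>u. norm (F (of_real u))) \<longlongrightarrow> norm (F (of_real x))) (at_right x)"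
      proof (intro tendsto_norm isCont_tendsto_compose[of _ F])
        show "isCont F (of_real x)" using contF U(1) xU by (simp add: continuous_on_eq_continuous_at)
      qed (intro tendsto_intros)
      show "\<forall>\<^sub>F u in at_right x. norm (F 2) \<le> norm (F (of_real u))"
        by (rule eventually_mono[OF eventually_at_right_real[of x 2]]) (use x1 lower in auto)
    qed auto
    then have "F (of_real x) \<noteq> 0" using F2 by auto
    moreover have "open {s \<in> U. F s \<noteq> 0}"
      using continuous_open_preimage[OF contF U(1), of "- {0}"] by (simp add: vimage_def Int_def open_Compl)
    ultimately obtain e0 where e0: "e0 > 0" "ball (of_real x) e0 \<subseteq> {s \<in> U. F s \<noteq> 0}"
      using xU by (metis (mono_tags, lifting) mem_Collect_eq openE)
    \<comment> \<open>The cap by \<open>x\<close> keeps the new abscissa \<open>x - e/8\<close>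
      nonnegative, as membership in \<open>X\<close> requires.\<close>
    define e where "e = min e0 x"
    have e: "e > 0" "e \<le> x" "ball (of_real x) e \<subseteq> {s \<in> U. F s \<noteq> 0}"
      using e0 xpos by (auto simp: e_def)
    have sub: "ball (of_real (x + e/4)) (e/2) \<subseteq> ball (complex_of_real x) e"
    proof
      fix z assume "z \<in> ball (complex_of_real (x + e/4)) (e/2)"
      moreover have "dist (complex_of_real (x + e/4)) (of_real x) = e/4"
        using e by (simp add: dist_norm)
      ultimately show "z \<in> ball (of_real x) e"
        using dist_triangle[of "complex_of_real x" z "of_real (x + e/4)"] e by (auto simp: dist_commute)
    qed
    \<comment> \<open>The centre \<open>x + e/4\<close> lies where the series converges, and the
      disc of radius \<open>e/2\<close> around it stays within distance \<open>e\<close> of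
      \<open>x\<close>. Moving left by \<open>3*e/8 < e/2\<close> reaches \<open>x - e/8\<close>,
      beyond the supposed infimum.\<close>
    have "summable (\<lambda>n. a n * real n powr (-(x + e/4 - 3*e/8)))"
    proof (rule summable_left_of_holomorphic_ball[OF a conv_x])
      show "(\<lambda>s. - deriv F s / F s) holomorphic_on ball (of_real (x + e/4)) (e/2)"
        using sub e(3)
        by (intro holomorphic_intros holomorphic_on_subset[OF holomorphic_deriv[OF F U(1)]] holomorphic_on_subset[OF F]) auto
      fix s assume s: "s \<in> ball (of_real (x + e/4)) (e/2)" "Re s > x"
      then have "s \<in> V" using sub e(3) by (auto simp: V_def)
      then show "- deriv F s / F s = ?D s" using dF F_nz by simp
    qed (use e in auto)
    then have "abs_conv ?c (x + e/4 - 3*e/8)"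
      using a by (intro abs_conv_of_summable) simp
    then have "x + e/4 - 3*e/8 \<in> X" using e x1 by (auto simp: X_def)
    then have "x \<le> x + e/4 - 3*e/8" unfolding x_def by (rule cInf_lower[OF _ X(2)])
    then show ?thesis using e by simp
  qed
qed

section \<open>Non-vanishing on the line of abscissa 1\<close>

lemma mangoldt_square: "mangoldt (n ^ 2) = mangoldt n"
proof (cases "n = 0")
  case False
  then have "primepow (n ^ 2) \<longleftrightarrow> primepow n" by (subst primepow_power_iff_nat) auto
  then show ?thesis by (auto simp: mangoldt_def aprimedivisor_primepow_power)
qed auto

lemma dseries_add:
  assumes "abs_conv c \<sigma>0" "abs_conv d \<sigma>0" "Re s > \<sigma>0"
  shows "dseries (\<lambda>n. c n + d n) s = dseries c s + dseries d s"
  using sums_add[OF dseries_sums[OF assms(1,3)] dseries_sums[OF assms(2,3)]]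
  by (simp add: dseries_def[of "\<lambda>n. c n + d n"] sums_iff distrib_right)

lemma dseries_cnj: "dseries (\<lambda>n. cnj (c n)) s = cnj (dseries c (cnj s))" if "abs_conv c \<sigma>0" "Re s > \<sigma>0"
proof -
  have "(\<lambda>n. cnj (c n * of_nat n powr (- cnj s))) sums cnj (dseries c (cnj s))"
    using dseries_sums[OF that(1), of "cnj s"] that(2) unfolding sums_cnj by simp
  moreover have "cnj (c n * of_nat n powr (- cnj s)) = cnj (c n) * of_nat n powr (-s)" for n
    by (simp add: cnj_powr)
  ultimately show ?thesis unfolding dseries_def[of "\<lambda>n. cnj (c n)"] by (simp only: sums_iff)
qed

text \<open>If \<open>K 1 = 0\<close>, then \<open>F = (\<Sum>\<xi>(n) n\<^sup>-\<^sup>s)\<^sup>2 (\<Sum>\<omega>(n) n\<^sup>-\<^sup>s) (\<Sum>cnj (\<omega>(n)) n\<^sup>-\<^sup>s)\<close> has no pole at \<open>1\<close>, and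
  \<open>-F'/F\<close> has the coefficients \<open>\<Lambda>(n) (2 \<xi>(n) + 2 Re \<omega>(n)) \<ge> 0\<close>, so it converges at \<open>1/2\<close> by Landau's
  lemma. Since \<open>\<omega>(n\<^sup>2) = \<omega>(n)\<^sup>2\<close>, the terms at \<open>n\<close> and \<open>n\<^sup>2\<close> cannot both be small, which forces
  \<open>\<Sum>\<Lambda>(n) \<xi>(n) / n\<close> to converge and contradicts the pole of \<open>\<Sum>\<xi>(n) n\<^sup>-\<^sup>s\<close>.\<close>

lemma nonvanishing_at_1:
  assumes c0: "completely_multiplicative \<xi>" and \<omega>: "completely_multiplicative \<omega>"
    and norm: "\<And>n. \<xi> n = of_real (norm (\<omega> n))" "\<And>n. norm (\<omega> n) \<in> {0, 1}"
    and U: "open U" "convex U" "\<And>x. x > 0 \<Longrightarrow> of_real x \<in> U" "cnj ` U = U"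
    and P: "P holomorphic_on U" "\<And>s. s \<in> U \<Longrightarrow> Re s > 1 \<Longrightarrow> dseries \<xi> s = P s / (s - 1)" "P 1 \<noteq> 0"
    and K: "K holomorphic_on U" "\<And>s. s \<in> U \<Longrightarrow> Re s > 1 \<Longrightarrow> dseries \<omega> s = K s"
  shows "K 1 \<noteq> 0"
proof
  assume K1: "K 1 = 0"
  interpret c0: completely_multiplicative "\<xi>" by (rule c0)
  interpret w: completely_multiplicative \<omega> by (rule \<omega>)
  interpret w': completely_multiplicative "\<lambda>n. cnj (\<omega> n)"
    by unfold_locales (use w.chi_1 w.chi_mult w.chi_le in auto)
  \<comment> \<open>Continues the series with conjugated coefficients; this is where the symmetry of
    \<open>U\<close> under conjugation enters.\<close>
  define K' where "K' = cnj \<circ> K \<circ> cnj"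
  have K': "K' holomorphic_on U" unfolding K'_def
    by (rule holomorphic_on_compose_cnj_cnj) (use U K in auto)
  have K'1: "K' 1 = 0" by (simp add: K'_def K1)
  have cnjU: "cnj s \<in> U" if "s \<in> U" for s using that U(4) by blast
  have K'_eq: "dseries (\<lambda>n. cnj (\<omega> n)) s = K' s" if "s \<in> U" "Re s > 1" for s
    using dseries_cnj[OF w.abs_conv_chi that(2)] K(2)[OF cnjU] that by (simp add: K'_def)
  define q where "q = (\<lambda>k z. if z = 1 then deriv k 1 else (k z - k 1) / (z - 1 :: complex))"
  have q: "q k holomorphic_on U" if "k holomorphic_on U" for k
    unfolding q_def by (rule pole_lemma_open[OF that U(1)])
  \<comment> \<open>Each \<open>q\<close> divides out a zero at 1, and these two factors
    \<open>s - 1\<close> are exactly compensated by the two factors hidden in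
    \<open>P s ^ 2\<close>. For \<open>Re s > 1\<close> this is therefore the product
    \<open>G\<close> of the four series.\<close>
  define F where "F = (\<lambda>s. P s ^ 2 * q K s * q K' s)"
  have F: "F holomorphic_on U"
    unfolding F_def by (intro holomorphic_intros P(1) q K K')
  define G where "G = (\<lambda>s. dseries \<xi> s ^ 2 * dseries \<omega> s * dseries (\<lambda>n. cnj (\<omega> n)) s)"
  have FG: "F s = G s" if "s \<in> U" "Re s > 1" for s
  proof -
    have "s - 1 \<noteq> 0" using that by auto
    then show ?thesis using that
      by (simp add: F_def G_def P(2) K(2) K'_eq q_def K1 K'1 power2_eq_square field_simps)
  qed
  define a where "a = (\<lambda>n. mangoldt n * (2 * norm (\<omega> n) + 2 * Re (\<omega> n)))"
  have a_nonneg: "a n \<ge> 0" for n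
    using mangoldt_nonneg[of n] abs_Re_le_cmod[of "\<omega> n"] by (auto simp: a_def)
  have a_eq: "complex_of_real (a n) = (c0.chi_mangoldt n + c0.chi_mangoldt n) + (w.chi_mangoldt n + w'.chi_mangoldt n)" for n
  proof -
    have "2 * complex_of_real (Re (\<omega> n)) = \<omega> n + cnj (\<omega> n)" by (simp add: complex_eq_iff)
    then show ?thesis unfolding a_def c0.chi_mangoldt_def w.chi_mangoldt_def w'.chi_mangoldt_def norm(1)
      by (simp add: algebra_simps)
  qed
  note ac = c0.abs_conv_chi_mangoldt w.abs_conv_chi_mangoldt w'.abs_conv_chi_mangoldt
  have conv_a: "abs_conv (\<lambda>n. of_real (a n)) 1"
    unfolding a_eq by (intro abs_conv_add ac)
  have D: "dseries (\<lambda>n. of_real (a n)) s = 2 * dseries c0.chi_mangoldt s + dseries w.chi_mangoldt s + dseries w'.chi_mangoldt s"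
    if "Re s > 1" for s
    unfolding a_eq dseries_add[OF abs_conv_add[OF ac(1,1)] abs_conv_add[OF ac(2,3)] that]
      dseries_add[OF ac(1,1) that] dseries_add[OF ac(2,3) that] by simp
  have "abs_conv (\<lambda>n. of_real (a n)) 0"
  proof (rule landau_log_derivative[OF a_nonneg conv_a U(1-3) F])
    have 2: "2 \<in> U" using U(3)[of 2] by simp
    show "F 2 \<noteq> 0"
      using FG[OF 2] c0.dseries_chi_nonzero[of 2] w.dseries_chi_nonzero[of 2] w'.dseries_chi_nonzero[of 2]
      by (auto simp: G_def)
    fix s assume s: "s \<in> U" "Re s > 1"
    have "(G has_field_derivative (- dseries (\<lambda>n. of_real (a n)) s * F s)) (at s)"
      unfolding G_def
      by (rule derivative_eq_intros c0.dseries_chi_deriv w.dseries_chi_deriv w'.dseries_chi_deriv s refl)+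
         (simp add: FG[OF s] G_def D[OF s(2)] power2_eq_square algebra_simps)
    then have "(F has_field_derivative (- dseries (\<lambda>n. of_real (a n)) s * F s)) (at s)"
      by (rule has_field_derivative_transform_within_open[of _ _ _ "U \<inter> {s. Re s > 1}"])
         (use s FG U open_Re_gt in auto)
    then show "deriv F s = - dseries (\<lambda>n. of_real (a n)) s * F s" by (rule DERIV_imp_deriv)
  qed
  then have sa: "summable (\<lambda>n. a n * real n powr (-1/2))"
    using a_nonneg unfolding abs_conv_def by (auto dest!: spec[of _ "1/2"])
  have "summable ((\<lambda>n. a n * real n powr (-1/2)) \<circ> (\<lambda>n. n ^ 2))"
    by (rule summable_reindex[OF sa]) (use a_nonneg in \<open>auto simp: inj_def\<close>)
  then have sb: "summable (\<lambda>n. a n * real n powr (-1/2) + a (n ^ 2) * real (n ^ 2) powr (-1/2))"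
    using sa by (intro summable_add) (auto simp: o_def)
  define b where "b = (\<lambda>n. mangoldt n * norm (\<omega> n))"
  have b0: "b n \<ge> 0" for n using mangoldt_nonneg[of n] by (simp add: b_def)
  have sm: "summable (\<lambda>n. b n * real n powr (-1))"
  proof (rule summable_comparison_test'[OF sb, of 0])
    fix n :: nat
    show "norm (b n * real n powr (-1)) \<le> a n * real n powr (-1/2) + a (n ^ 2) * real (n ^ 2) powr (-1/2)"
    proof (cases "n = 0 \<or> norm (\<omega> n) = 0")
      case True
      then show ?thesis using a_nonneg by (auto simp: b_def)
    next
      case False
      then have n: "n > 0" "norm (\<omega> n) = 1" using norm(2)[of n] by auto
      define c where "c = Re (\<omega> n)"
      have c1: "c^2 + Im (\<omega> n) ^ 2 = 1" using cmod_power2[of "\<omega> n"] n(2) by (simp add: c_def)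
      have sq: "\<omega> (n ^ 2) = \<omega> n ^ 2" using w.chi_mult[of n n] by (simp add: power2_eq_square)
      have w2: "Re (\<omega> (n ^ 2)) = 2 * c^2 - 1" "norm (\<omega> (n ^ 2)) = 1"
      proof -
        have "Re (\<omega> n ^ 2) = c^2 - Im (\<omega> n) ^ 2" by (simp add: c_def power2_eq_square)
        then show "Re (\<omega> (n ^ 2)) = 2 * c^2 - 1" using c1 sq by simp
        show "norm (\<omega> (n ^ 2)) = 1" unfolding sq norm_power n(2) by simp
      qed
      have c: "c \<ge> -1" using abs_Re_le_cmod[of "\<omega> n"] n(2) by (simp add: c_def)
      have p2: "real (n ^ 2) powr (-1/2) = real n powr (-1)"
      proof -
        have "real (n ^ 2) = real n powr 2" using n by simp
        then show ?thesis by (simp only: powr_powr) simp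
      qed
      \<comment> \<open>With \<open>c\<close> the cosine of the argument of
        \<open>\<omega> n\<close>, the coefficient at \<open>n^2\<close> is
        \<open>mangoldt n * 4 * c^2\<close>, and its weight at abscissa \<open>1/2\<close> is again
        \<open>1/n\<close>. The sum of both factors is at least 1, since
        \<open>1 + 2*c + 4*c^2 = ((4*c+1)^2 + 3) / 4\<close>.\<close>
      have "b n * real n powr (-1) \<le> (mangoldt n * (2 + 2 * c + 4 * c^2)) * real n powr (-1)"
      proof -
        have "(4*c+1)^2 \<ge> 0" by simp
        then have "1 \<le> 2 + 2 * c + 4 * c^2" by (simp add: power2_eq_square algebra_simps)
        then have "mangoldt n * 1 \<le> mangoldt n * (2 + 2 * c + 4 * c^2)"
          by (intro mult_left_mono mangoldt_nonneg)
        then have "mangoldt n * 1 * real n powr (-1) \<le> mangoldt n * (2 + 2 * c + 4 * c^2) * real n powr (-1)"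
          by (rule mult_right_mono) simp
        then show ?thesis unfolding b_def n(2) .
      qed
      also have "\<dots> = mangoldt n * (2 + 2 * c) * real n powr (-1) + a (n ^ 2) * real (n ^ 2) powr (-1/2)"
        unfolding p2 a_def mangoldt_square w2 by (simp add: algebra_simps)
      also have "mangoldt n * (2 + 2 * c) * real n powr (-1) \<le> mangoldt n * (2 + 2 * c) * real n powr (-1/2)"
        using n c mangoldt_nonneg[of n] by (intro mult_left_mono powr_mono) auto
      finally show ?thesis using b0[of n] by (simp add: a_def n c_def)
    qed
  qed
  define M where "M = (\<Sum>n. b n * real n powr (-1))"
  have D0: "norm (dseries c0.chi_mangoldt (of_real x)) \<le> M" if "x > 1" for x
    unfolding dseries_def M_def
  proof (rule norm_suminf_le[OF _ sm])
    fix n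
    have "norm (c0.chi_mangoldt n * of_nat n powr (- of_real x)) = b n * real n powr (-x)"
      by (simp add: norm_mult norm_nat_powr c0.chi_mangoldt_def b_def norm(1) mult.commute)
    also have "\<dots> \<le> b n * real n powr (-1)"
    proof (cases "n = 0")
      case False
      then have "real n powr (-x) \<le> real n powr (-1)" using that by (intro powr_mono) auto
      then show ?thesis by (rule mult_left_mono[OF _ b0])
    qed auto
    finally show "norm (c0.chi_mangoldt n * of_nat n powr (- of_real x)) \<le> b n * real n powr (-1)" .
  qed
  have 1: "1 \<in> U" using U(3)[of 1] by simp
  \<comment> \<open>The derivative of \<open>P s / (s - 1)\<close> computed in two ways. As
    \<open>x\<close> tends to 1 from the right, the left side vanishes because the von Mangoldt
    series is bounded by \<open>M\<close>, whereas the right side tends to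
    \<open>P 1\<close>.\<close>
  have eq: "of_real (x - 1) * (dseries c0.chi_mangoldt (of_real x) * P (of_real x)) = P (of_real x) - of_real (x - 1) * deriv P (of_real x)"
    if "x > 1" for x
  proof -
    let ?s = "complex_of_real x"
    have s: "?s \<in> U" "Re ?s > 1" "?s - 1 \<noteq> 0" using that U(3)[of x] by auto
    have "((\<lambda>s. P s / (s - 1)) has_field_derivative ((deriv P ?s * (?s - 1) - P ?s) / (?s - 1)^2)) (at ?s)"
      using s by (auto intro!: derivative_eq_intros holomorphic_derivI[OF P(1) U(1)] simp: power2_eq_square)
    then have "(dseries \<xi> has_field_derivative ((deriv P ?s * (?s - 1) - P ?s) / (?s - 1)^2)) (at ?s)"
      by (rule has_field_derivative_transform_within_open[of _ _ _ "U \<inter> {s. Re s > 1}"])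
         (use s U open_Re_gt P(2) in auto)
    from DERIV_unique[OF this c0.dseries_chi_deriv[OF s(2)]]
    have "(deriv P ?s * (?s - 1) - P ?s) / (?s - 1)^2 = - dseries c0.chi_mangoldt ?s * (P ?s / (?s - 1))"
      using P(2)[OF s(1,2)] by simp
    moreover have "e * (d * p) = p - e * p'" if "(p' * e - p) / e^2 = - d * (p / e)" "e \<noteq> 0" for e d p p' :: complex
      using that by (simp add: divide_eq_eq power2_eq_square) (simp add: algebra_simps)
    ultimately show ?thesis using s(3) unfolding of_real_diff of_real_1 by blast
  qed
  have lim: "((\<lambda>x. P (of_real x) - of_real (x - 1) * deriv P (of_real x)) \<longlongrightarrow> P 1 - of_real (1 - 1) * deriv P 1) (at_right 1)"
  proof -
    have "isCont P 1" "isCont (deriv P) 1"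
      using holomorphic_on_imp_continuous_on[OF P(1)] holomorphic_on_imp_continuous_on[OF holomorphic_deriv[OF P(1) U(1)]]
        U(1) 1 by (auto simp: continuous_on_eq_continuous_at)
    then show ?thesis
      by (intro tendsto_intros isCont_tendsto_compose[of _ P] isCont_tendsto_compose[of _ "deriv P"])
         (auto intro!: tendsto_eq_intros)
  qed
  have "((\<lambda>x. of_real (x - 1) * (dseries c0.chi_mangoldt (of_real x) * P (of_real x))) \<longlongrightarrow> 0) (at_right 1)"
  proof (rule Lim_null_comparison)
    show "\<forall>\<^sub>F x in at_right 1. norm (of_real (x - 1) * (dseries c0.chi_mangoldt (of_real x) * P (of_real x))) \<le> (x - 1) * (M * norm (P (of_real x)))"
      by (rule eventually_mono[OF eventually_at_right_less])
         (auto simp: norm_mult simp del: of_real_diff intro!: mult_left_mono mult_right_mono D0)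
    have "isCont P (of_real 1)" using holomorphic_on_imp_continuous_on[OF P(1)] U(1) 1 by (auto simp: continuous_on_eq_continuous_at)
    then have "((\<lambda>x. (x - 1) * (M * norm (P (of_real x)))) \<longlongrightarrow> (1 - 1) * (M * norm (P (of_real 1)))) (at_right 1)"
      by (intro tendsto_intros isCont_tendsto_compose[of _ P])
    then show "((\<lambda>x. (x - 1) * (M * norm (P (of_real x)))) \<longlongrightarrow> 0) (at_right 1)" by simp
  qed
  moreover have "((\<lambda>x. of_real (x - 1) * (dseries c0.chi_mangoldt (of_real x) * P (of_real x))) \<longlongrightarrow> P 1) (at_right 1)"
    using lim by (subst tendsto_cong[OF eventually_mono[OF eventually_at_right_less eq]]) auto
  ultimately have "P 1 = 0" using tendsto_unique[OF trivial_limit_at_right_real] by blast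
  then show False using P(3) by simp
qed

section \<open>Dirichlet characters\<close>

locale dirichlet_char =
  fixes q :: nat and chi :: "nat \<Rightarrow> complex"
  assumes q_pos: "q > 0" and chi_one: "chi 1 = 1" and chi_mult': "chi (m * n) = chi m * chi n"
    and chi_eq_0_iff: "chi n = 0 \<longleftrightarrow> \<not> coprime n q"
    and chi_cong: "[m = n] (mod q) \<Longrightarrow> chi m = chi n"
begin

lemma chi_power: "chi (n ^ k) = chi n ^ k"
  by (induction k) (use chi_one chi_mult' in auto)

lemma chi_power_totient: "coprime n q \<Longrightarrow> chi n ^ totient q = 1"
  using chi_cong[OF euler_theorem[of n q]] chi_power[of n "totient q"] chi_one by simp

lemma norm_chi: "norm (chi n) = of_bool (coprime n q)"
proof (cases "coprime n q")
  case True
  then have "norm (chi n) ^ totient q = 1" using chi_power_totient by (metis norm_one norm_power)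
  then have "norm (chi n) = 1"
    using power_eq_imp_eq_base[of "norm (chi n)" "totient q" 1] q_pos by simp
  then show ?thesis using True by simp
qed (use chi_eq_0_iff in auto)

lemma completely_multiplicative: "completely_multiplicative chi"
  by unfold_locales (use chi_one chi_mult' norm_chi in auto)

text \<open>The residue of the series at 1. Keeping it as a number lets principal and other
  characters share one continuation; which of them have mean 0 is settled later.\<close>

definition mean :: complex where "mean = (\<Sum>k<q. chi k) / of_nat q"

lemma sum_period: "(\<Sum>k=m..<m+q. chi k) = of_nat q * mean"
proof (induction m)
  case 0 then show ?case using q_pos by (simp add: mean_def atLeast0LessThan)
next
  case (Suc m)
  have "chi (m + q) = chi m" by (rule chi_cong) (simp add: cong_def)
  moreover have "(\<Sum>k=m..<m+q. chi k) + chi (m + q) = chi m + (\<Sum>k=Suc m..<Suc m+q. chi k)"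
    using q_pos by (simp add: sum.atLeast_Suc_lessThan[of m "m+q"] algebra_simps)
  ultimately show ?case using Suc by simp
qed

text \<open>Full periods contribute exactly \<open>q * mean\<close>, so only a remainder of fewer
  than \<open>q\<close> terms survives, and it costs at most \<open>q\<close> in each of the two
  quantities. The induction removes one period at a time and therefore needs an arbitrary starting
  point.\<close>

lemma norm_sum_le: "norm ((\<Sum>k=1..n. chi k) - of_nat n * mean) \<le> 2 * real q"
proof -
  have mean_le: "norm mean \<le> 1"
  proof -
    have "norm (\<Sum>k<q. chi k) \<le> (\<Sum>k<q. 1)" by (rule order_trans[OF norm_sum sum_mono]) (simp add: norm_chi)
    then show ?thesis using q_pos by (simp add: mean_def norm_divide)
  qed
  have "norm ((\<Sum>k=m..<m+n. chi k) - of_nat n * mean) \<le> 2 * real q" for m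
  proof (induction n arbitrary: m rule: less_induct)
    case (less n)
    show ?case
    proof (cases "n < q")
      case True
      have "norm (\<Sum>k=m..<m+n. chi k) \<le> (\<Sum>k=m..<m+n. 1)"
        by (rule order_trans[OF norm_sum sum_mono]) (simp add: norm_chi)
      moreover have "norm (of_nat n * mean) \<le> real n * 1" unfolding norm_mult by (intro mult_mono mean_le) auto
      ultimately have "norm ((\<Sum>k=m..<m+n. chi k) - of_nat n * mean) \<le> real n + real n"
        using norm_triangle_ineq4[of "\<Sum>k=m..<m+n. chi k" "of_nat n * mean"] by simp
      then show ?thesis using True by simp
    next
      case False
      then have "(\<Sum>k=m..<m+n. chi k) = (\<Sum>k=m..<m+q. chi k) + (\<Sum>k=m+q..<m+q+(n-q). chi k)"
        by (subst sum.atLeastLessThan_concat) auto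
      then have "(\<Sum>k=m..<m+n. chi k) - of_nat n * mean = (\<Sum>k=m+q..<m+q+(n-q). chi k) - of_nat (n-q) * mean"
        using False by (simp add: sum_period of_nat_diff algebra_simps)
      then show ?thesis using less[of "n - q" "m + q"] False q_pos by simp
    qed
  qed
  from this[of 1] show ?thesis by (simp add: atLeastLessThanSuc_atLeastAtMost)
qed

lemma continuation:
  obtains H where "H holomorphic_on {s. Re s > 0}" "\<And>s. Re s > 1 \<Longrightarrow> dseries chi s = mean / (s - 1) + H s"
  using dseries_continuation[of chi 1, OF _ norm_sum_le] norm_chi by (metis of_bool_less_eq_one)

text \<open>The twist translates the argument of the series by \<open>it\<close>, so a zero at
  \<open>1 + it\<close> becomes a zero at 1 of a series of the same kind.\<close>

lemma shifted: "completely_multiplicative (\<lambda>n. chi n * of_nat n powr (-\<i> * of_real t))"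
proof
  fix m n :: nat
  show "norm (chi n * of_nat n powr (-\<i> * of_real t)) \<le> 1"
    unfolding norm_mult norm_nat_powr norm_chi by (cases "n = 0") auto
  show "chi (m * n) * of_nat (m * n) powr (-\<i> * of_real t) =
     chi m * of_nat m powr (-\<i> * of_real t) * (chi n * of_nat n powr (-\<i> * of_real t))"
    unfolding nat_mult_powr chi_mult' by simp
qed (use chi_one in simp)

end

lemma dirichlet_char_principal:
  assumes "q > 0" shows "dirichlet_char q (\<lambda>n. of_bool (coprime n q))"
proof
  fix m n :: nat
  show "of_bool (coprime m q) = (of_bool (coprime n q) :: complex)" if "[m = n] (mod q)"
    using coprime_cong_cong_left[OF that] by simp
qed (use assms in auto)

lemma principal_mean:
  assumes "q > 1" shows "dirichlet_char.mean q (\<lambda>n. of_bool (coprime n q)) \<noteq> 0"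
proof -
  interpret dirichlet_char q "\<lambda>n. of_bool (coprime n q)"
    by (rule dirichlet_char_principal) (use assms in auto)
  have "(\<Sum>k<q. of_bool (coprime k q) :: complex) = of_nat (card {k\<in>{..<q}. coprime k q})"
    by (simp add: sum_of_bool_eq Int_def)
  moreover have "1 \<in> {k\<in>{..<q}. coprime k q}" using assms by auto
  then have "card {k\<in>{..<q}. coprime k q} \<noteq> 0" by (subst card_eq_0_iff) auto
  ultimately show ?thesis using assms by (simp add: mean_def del: sum_of_bool_eq)
qed

context dirichlet_char begin

lemma log_deriv_continuation:
  assumes "q > 1"
  obtains W R where "open W" "{s. Re s \<ge> 1} \<subseteq> W" "R holomorphic_on W"
    "\<And>s. Re s > 1 \<Longrightarrow> dseries (\<lambda>n. chi n * of_real (mangoldt n)) s = of_bool (mean \<noteq> 0) / (s - 1) + R s"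
proof -
  interpret cm: completely_multiplicative chi by (rule completely_multiplicative)
  obtain H where H: "H holomorphic_on {s. Re s > 0}" "\<And>s. Re s > 1 \<Longrightarrow> dseries chi s = mean / (s - 1) + H s"
    using continuation by blast
  let ?p = "\<lambda>n. of_bool (coprime n q) :: complex"
  interpret pr: dirichlet_char q ?p by (rule dirichlet_char_principal) (use assms in auto)
  obtain H0 where H0: "H0 holomorphic_on {s. Re s > 0}" "\<And>s. Re s > 1 \<Longrightarrow> dseries ?p s = pr.mean / (s - 1) + H0 s"
    using pr.continuation by blast
  have prm: "pr.mean \<noteq> 0" by (rule principal_mean[OF assms])
  have nz: "mean / (s - 1) + H s \<noteq> 0" if s: "Re s = 1" and "mean = 0 \<or> s \<noteq> 1" for s
  proof -
    define t where "t = Im s"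
    have s_eq: "s = 1 + \<i> * of_real t" using s by (simp add: t_def complex_eq_iff)
    \<comment> \<open>The strip \<open>U\<close> has to contain the positive reals and to be
      symmetric, but must miss the pole of the translated series at \<open>1 - it\<close>, whose
      imaginary part has absolute value \<open>h\<close> when \<open>t\<close> is nonzero. For
      \<open>t = 0\<close> the mean is 0, there is no pole, and any width works.\<close>
    define h where "h = (if t = 0 then 1 else \<bar>t\<bar>)"
    have h: "h > 0" by (simp add: h_def)
    define U where "U = {s. Re s > 0 \<and> - h < Im s \<and> Im s < h}"
    have U_eq: "U = {s. Re s > 0} \<inter> ({s. Im s > -h} \<inter> {s. Im s < h})" by (auto simp: U_def)
    have U: "open U" "convex U" unfolding U_eq
      by (auto intro!: open_Int convex_Int open_Re_gt open_halfspace_Im_gt open_halfspace_Im_lt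
            convex_halfspace_Re_gt convex_halfspace_Im_gt convex_halfspace_Im_lt)
    have cnjU: "cnj ` U = U"
    proof -
      have "cnj z \<in> U" if "z \<in> U" for z using that by (auto simp: U_def)
      moreover have "z \<in> cnj ` U" if "z \<in> U" for z using that by (intro image_eqI[of _ _ "cnj z"]) (auto simp: U_def)
      ultimately show ?thesis by auto
    qed
    define K where "K = (\<lambda>z. mean / (z + \<i> * of_real t - 1) + H (z + \<i> * of_real t))"
    let ?w = "\<lambda>n. chi n * of_nat n powr (-\<i> * of_real t)"
    have "K 1 \<noteq> 0"
    proof (rule nonvanishing_at_1[where P = "\<lambda>z. pr.mean + (z - 1) * H0 z" and \<omega> = ?w and \<xi> = ?p and U = U])
      show "completely_multiplicative ?p" by (rule pr.completely_multiplicative)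
      show "completely_multiplicative ?w" by (rule shifted)
      show "norm (?w n) \<in> {0, 1}" for n
        unfolding norm_mult norm_nat_powr norm_chi by (cases "n = 0") auto
      show "?p n = of_real (norm (?w n))" for n
        unfolding norm_mult norm_nat_powr norm_chi using assms by (cases "n = 0") auto
      show "(\<lambda>z. pr.mean + (z - 1) * H0 z) holomorphic_on U"
        by (intro holomorphic_intros holomorphic_on_subset[OF H0(1)]) (auto simp: U_def)
      show "dseries ?p s = (pr.mean + (s - 1) * H0 s) / (s - 1)" if "Re s > 1" for s
      proof -
        have "s \<noteq> 1" using that by auto
        then show ?thesis using H0(2)[OF that] by (simp add: add_divide_distrib)
      qed
      have hol: "(\<lambda>z. H (z + \<i> * of_real t)) holomorphic_on U"
        by (rule holomorphic_on_compose_gen[of "\<lambda>z. z + \<i> * of_real t" U H, unfolded o_def, OF _ H(1)])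
           (auto intro!: holomorphic_intros simp: U_def)
      show "K holomorphic_on U"
      proof (cases "mean = 0")
        case True then show ?thesis using hol by (simp add: K_def)
      next
        case False
        then have t: "t \<noteq> 0" using that(2) s_eq by auto
        have "z + \<i> * of_real t - 1 \<noteq> 0" if "z \<in> U" for z
          using that t by (auto simp: U_def h_def complex_eq_iff)
        then show ?thesis unfolding K_def by (intro holomorphic_intros hol) auto
      qed
      show "dseries ?w z = K z" if "z \<in> U" "Re z > 1" for z
      proof -
        have "dseries ?w z = dseries chi (z + \<i> * of_real t)"
          unfolding dseries_def by (rule suminf_cong) (simp add: powr_add[symmetric] mult_ac algebra_simps)
        then show ?thesis using H(2)[of "z + \<i> * of_real t"] that by (simp add: K_def)
      qed
    qed (use U cnjU prm h in \<open>auto simp: U_def\<close>)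
    then show ?thesis by (simp add: K_def s_eq)
  qed
  \<comment> \<open>The series cleared of its pole. The removed factor \<open>s - 1\<close> is what
    produces the principal part of the logarithmic derivative, so its residue is 1 or 0 whatever the
    value of the mean.\<close>
  define P where "P = (if mean = 0 then H else (\<lambda>s. mean + (s - 1) * H s))"
  have P: "P holomorphic_on {s. Re s > 0}" unfolding P_def by (auto intro!: holomorphic_intros H(1))
  have P_eq: "P s = (if mean = 0 then 1 else s - 1) * (mean / (s - 1) + H s)" if "s \<noteq> 1" for s
    using that by (simp add: P_def distrib_left)
  have P_nz: "P s \<noteq> 0" if "Re s \<ge> 1" for s
  proof (cases "Re s = 1")
    case True
    show ?thesis
    proof (cases "s = 1")
      case True
      then show ?thesis using nz[of s] by (cases "mean = 0") (auto simp: P_def)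
    next
      case False
      then show ?thesis using nz[OF True] P_eq[of s] by auto
    qed
  next
    case False
    then have "Re s > 1" "s \<noteq> 1" using that by auto
    then show ?thesis using cm.dseries_chi_nonzero[of s] H(2)[of s] P_eq[of s] by auto
  qed
  define W where "W = {s \<in> {s. Re s > 0}. P s \<noteq> 0}"
  have "open W" unfolding W_def
    using continuous_open_preimage[OF holomorphic_on_imp_continuous_on[OF P] open_Re_gt, of "- {0}"]
    by (simp add: vimage_def Int_def open_Compl)
  moreover have "{s. Re s \<ge> 1} \<subseteq> W" using P_nz by (auto simp: W_def)
  moreover have "(\<lambda>s. - deriv P s / P s) holomorphic_on W"
    by (intro holomorphic_intros holomorphic_on_subset[OF holomorphic_deriv[OF P open_Re_gt]] holomorphic_on_subset[OF P])
       (auto simp: W_def)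
  moreover have "dseries (\<lambda>n. chi n * of_real (mangoldt n)) s = of_bool (mean \<noteq> 0) / (s - 1) + (- deriv P s / P s)"
    if s: "Re s > 1" for s
  proof -
    let ?D = "dseries (\<lambda>n. chi n * of_real (mangoldt n))"
    let ?e = "\<lambda>s. if mean = 0 then 1 else s - 1 :: complex"
    have s1: "s - 1 \<noteq> 0" using s by auto
    have D: "(dseries chi has_field_derivative - ?D s * dseries chi s) (at s)"
      using cm.dseries_chi_deriv[OF s] by (simp add: cm.chi_mangoldt_def[abs_def])
    have PL: "P z = ?e z * dseries chi z" if "Re z > 1" for z
    proof -
      have "z \<noteq> 1" using that by auto
      then show ?thesis using P_eq[of z] H(2)[OF that] by simp
    qed
    have "((\<lambda>z. ?e z * dseries chi z) has_field_derivative (of_bool (mean \<noteq> 0) * dseries chi s - ?D s * P s)) (at s)"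
    proof (cases "mean = 0")
      case True
      then show ?thesis using D PL[OF s] by simp
    next
      case False
      have "((\<lambda>z. (z - 1) * dseries chi z) has_field_derivative ((1 - 0) * dseries chi s + (- ?D s * dseries chi s) * (s - 1))) (at s)"
        by (intro DERIV_mult DERIV_diff DERIV_ident DERIV_const D)
      then show ?thesis using False PL[OF s] by (simp add: mult_ac)
    qed
    then have "(P has_field_derivative (of_bool (mean \<noteq> 0) * dseries chi s - ?D s * P s)) (at s)"
      by (rule has_field_derivative_transform_within_open[of _ _ _ "{s. Re s > 1}"])
         (use s open_Re_gt PL in auto)
    then have "deriv P s = of_bool (mean \<noteq> 0) * dseries chi s - ?D s * P s" by (rule DERIV_imp_deriv)
    moreover have Pn: "P s \<noteq> 0" using P_nz[of s] s by simp
    ultimately have "?D s = (of_bool (mean \<noteq> 0) * dseries chi s - deriv P s) / P s" by (simp add: eq_divide_eq)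
    also have "\<dots> = of_bool (mean \<noteq> 0) * dseries chi s / P s + (- deriv P s / P s)"
      by (simp add: diff_divide_distrib)
    also have "of_bool (mean \<noteq> 0) * dseries chi s / P s = of_bool (mean \<noteq> 0) / (s - 1)"
      using PL[OF s] Pn s1 by (cases "mean = 0") auto
    finally show ?thesis .
  qed
  ultimately show thesis using that by blast
qed

end

text \<open>A homomorphism on a subgroup of the unit group modulo \<open>q\<close>, with the
  subgroup represented by all naturals in its classes. Closure under inverses comes for free from
  Euler's theorem, and \<open>f\<close> is unconstrained outside \<open>H\<close>.\<close>

definition partial_char :: "nat \<Rightarrow> nat set \<Rightarrow> (nat \<Rightarrow> complex) \<Rightarrow> bool" where
  "partial_char q H f \<longleftrightarrow> 1 \<in> H \<and> f 1 = 1 \<and> (\<forall>m\<in>H. coprime m q) \<and>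
     (\<forall>m\<in>H. \<forall>n\<in>H. m * n \<in> H \<and> f (m * n) = f m * f n) \<and>
     (\<forall>m\<in>H. \<forall>n. [m = n] (mod q) \<longrightarrow> n \<in> H \<and> f n = f m)"

lemma partial_charD:
  assumes "partial_char q H f"
  shows "1 \<in> H" "f 1 = 1" "\<And>m. m \<in> H \<Longrightarrow> coprime m q"
    "\<And>m n. m \<in> H \<Longrightarrow> n \<in> H \<Longrightarrow> m * n \<in> H"
    "\<And>m n. m \<in> H \<Longrightarrow> n \<in> H \<Longrightarrow> f (m * n) = f m * f n"
    "\<And>m n. m \<in> H \<Longrightarrow> [m = n] (mod q) \<Longrightarrow> n \<in> H"
    "\<And>m n. m \<in> H \<Longrightarrow> [m = n] (mod q) \<Longrightarrow> f n = f m"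
proof -
  from assms have "\<forall>m\<in>H. coprime m q" and "\<forall>m\<in>H. \<forall>n\<in>H. m * n \<in> H \<and> f (m * n) = f m * f n"
    and c: "\<forall>m\<in>H. \<forall>n. [m = n] (mod q) \<longrightarrow> n \<in> H \<and> f n = f m" and "1 \<in> H" "f 1 = 1"
    unfolding partial_char_def by - (elim conjE, assumption)+
  then show "1 \<in> H" "f 1 = 1" "\<And>m. m \<in> H \<Longrightarrow> coprime m q"
    "\<And>m n. m \<in> H \<Longrightarrow> n \<in> H \<Longrightarrow> m * n \<in> H"
    "\<And>m n. m \<in> H \<Longrightarrow> n \<in> H \<Longrightarrow> f (m * n) = f m * f n" by blast+
  show "n \<in> H" "f n = f m" if "m \<in> H" "[m = n] (mod q)" for m n
    using bspec[OF c that(1), THEN spec, of n] that(2) by simp_all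
qed

lemma partial_char_power:
  assumes "partial_char q H f" "m \<in> H"
  shows "m ^ k \<in> H \<and> f (m ^ k) = f m ^ k"
  by (induction k) (use partial_charD(1,2,4,5)[OF assms(1)] assms(2) in auto)

text \<open>Division inside \<open>H\<close>: the power \<open>h ^ (totient q - 1)\<close> inverts
  \<open>h\<close> modulo \<open>q\<close> and lies in \<open>H\<close> with
  \<open>h\<close>.\<close>

lemma partial_char_cancel:
  assumes pc: "partial_char q H f" and q: "q > 0" and h: "h \<in> H" "h' \<in> H" "[h * x = h'] (mod q)"
  shows "x \<in> H" "f h * f x = f h'"
proof -
  note D = partial_charD[OF pc]
  define i where "i = h ^ (totient q - 1)"
  have i: "i \<in> H" using partial_char_power[OF pc h(1)] by (simp add: i_def)
  have "i * h = h ^ totient q" using power_minus_mult[of "totient q" h] q by (simp add: i_def)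
  then have "[i * h = 1] (mod q)" using euler_theorem[OF D(3)[OF h(1)]] by simp
  then have "[i * h * x = 1 * x] (mod q)" by (rule cong_scalar_right)
  moreover have "[i * (h * x) = i * h'] (mod q)" using h(3) by (rule cong_scalar_left)
  ultimately have "[i * h' = x] (mod q)"
    unfolding mult.assoc[symmetric] mult_1 by (rule cong_trans[OF cong_sym, rotated])
  then show x: "x \<in> H" using D(4)[OF i h(2)] D(6) by blast
  show "f h * f x = f h'" using D(5)[OF h(1) x] D(7)[OF h(2) cong_sym[OF h(3)]] by simp
qed

lemma partial_char_nonzero:
  assumes "partial_char q H f" "q > 0" "h \<in> H"
  shows "f h \<noteq> 0"
proof -
  note D = partial_charD[OF assms(1)]
  have "f (h ^ totient q) = f 1"
    by (rule D(7)[OF D(1) cong_sym[OF euler_theorem[OF D(3)[OF assms(3)]]]])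
  then have 1: "f h ^ totient q = 1" using partial_char_power[OF assms(1,3), of "totient q"] D(2) by metis
  have "totient q > 0" using assms(2) by simp
  show ?thesis
  proof
    assume "f h = 0"
    with 1 zero_power[OF \<open>totient q > 0\<close>, where 'a = complex] show False by simp
  qed
qed

text \<open>Elements of the larger subgroup are \<open>h * g ^ k\<close> and get the value
  \<open>f h * z ^ k\<close>. Here \<open>d\<close> is the order of \<open>g\<close> modulo
  \<open>H\<close>, so the only relation to respect is \<open>z ^ d = f (g ^ d)\<close>; the freedom
  in choosing the root \<open>z\<close> is exploited for separation.\<close>

lemma partial_char_extend:
  assumes pc: "partial_char q H f" and q: "q > 0" and g: "coprime g q"
    and d: "d > 0" "g ^ d \<in> H" "\<And>k. k > 0 \<Longrightarrow> g ^ k \<in> H \<Longrightarrow> d \<le> k" and z: "z ^ d = f (g ^ d)"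
  obtains H' f' where "partial_char q H' f'" "H \<subseteq> H'" "\<And>h. h \<in> H \<Longrightarrow> f' h = f h" "g \<in> H'" "f' g = z"
proof -
  note D = partial_charD[OF pc]
  define R where "R = (\<lambda>m v. \<exists>h\<in>H. \<exists>k. [m = h * g ^ k] (mod q) \<and> v = f h * z ^ k)"
  have uniq_le: "f h * z ^ k = f h' * z ^ k'"
    if "h \<in> H" "h' \<in> H" "[h * g ^ k = h' * g ^ k'] (mod q)" "k \<le> k'" for h h' k k'
  proof -
    define j where "j = k' - k"
    have k': "k' = j + k" using that(4) by (simp add: j_def)
    have cg: "coprime (g ^ k) q" using g by simp
    have "[h = h' * g ^ j] (mod q)"
      using that(3) unfolding k' power_add mult.assoc[symmetric] by (simp add: cong_mult_rcancel_nat[OF cg])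
    from partial_char_cancel[OF pc q that(2,1) cong_sym[OF this]]
    have gj: "g ^ j \<in> H" "f h' * f (g ^ j) = f h" by auto
    have pw: "g ^ (d * (j div d)) \<in> H" "f (g ^ (d * (j div d))) = z ^ (d * (j div d))"
      using partial_char_power[OF pc d(2), of "j div d"] z by (auto simp: power_mult)
    have "g ^ (d * (j div d)) * g ^ (j mod d) = g ^ j" by (simp add: power_add[symmetric])
    \<comment> \<open>Dividing \<open>g ^ j\<close> by a power of \<open>g ^ d\<close> stays in
      \<open>H\<close>; minimality of \<open>d\<close> leaves no nonzero remainder.\<close>
    then have "g ^ (j mod d) \<in> H" using partial_char_cancel(1)[OF pc q pw(1) gj(1)] by simp
    then have "j mod d = 0" using d(3)[of "j mod d"] mod_less_divisor[OF d(1), of j] by linarith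
    then have "d * (j div d) = j" by auto
    then have "f (g ^ j) = z ^ j" using pw by simp
    then show ?thesis using gj(2) k' by (simp add: power_add mult_ac)
  qed
  have uniq: "v = w" if vw: "R m v" "R m w" for m v w
  proof -
    obtain h k h' k' where *: "h \<in> H" "h' \<in> H" "[m = h * g ^ k] (mod q)" "[m = h' * g ^ k'] (mod q)"
      "v = f h * z ^ k" "w = f h' * z ^ k'" using vw unfolding R_def by blast
    have c: "[h * g ^ k = h' * g ^ k'] (mod q)" by (rule cong_trans[OF cong_sym[OF *(3)] *(4)])
    show ?thesis
    proof (cases "k \<le> k'")
      case True
      then show ?thesis using uniq_le[OF *(1,2) c] *(5,6) by simp
    next
      case False
      then show ?thesis using uniq_le[OF *(2,1) cong_sym[OF c]] *(5,6) by simp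
    qed
  qed
  define f' where "f' = (\<lambda>m. THE v. R m v)"
  have f': "f' m = v" if "R m v" for m v
    unfolding f'_def using that uniq by blast
  have Rmult: "R (m * n) (v * w)" if vw: "R m v" "R n w" for m n v w
  proof -
    obtain h k h' k' where *: "h \<in> H" "h' \<in> H" "[m = h * g ^ k] (mod q)" "[n = h' * g ^ k'] (mod q)"
      "v = f h * z ^ k" "w = f h' * z ^ k'" using vw unfolding R_def by blast
    have "[m * n = h * g ^ k * (h' * g ^ k')] (mod q)" by (rule cong_mult[OF *(3,4)])
    moreover have "h * g ^ k * (h' * g ^ k') = h * h' * g ^ (k + k')" by (simp add: power_add mult_ac)
    moreover have "v * w = f (h * h') * z ^ (k + k')" using * D(5) by (simp add: power_add mult_ac)
    ultimately show ?thesis unfolding R_def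
      by (intro bexI[OF _ D(4)[OF *(1,2)]] exI[of _ "k + k'"] conjI) simp_all
  qed
  have Rcong: "R n v" if Rm: "R m v" and mn: "[m = n] (mod q)" for m n v
  proof -
    obtain h k where *: "h \<in> H" "[m = h * g ^ k] (mod q)" "v = f h * z ^ k" using Rm unfolding R_def by blast
    have "[n = h * g ^ k] (mod q)" by (rule cong_trans[OF cong_sym[OF mn] *(2)])
    then show ?thesis using *(1,3) unfolding R_def by blast
  qed
  have RH: "R h (f h)" if "h \<in> H" for h
    unfolding R_def by (rule bexI[OF _ that], rule exI[of _ 0]) auto
  have Rg: "R g z"
    unfolding R_def by (rule bexI[OF _ D(1)], rule exI[of _ 1]) (use D(2) in auto)
  have Rcop: "coprime m q" if R: "R m v" for m v
  proof -
    obtain h k where "h \<in> H" "[m = h * g ^ k] (mod q)" using R unfolding R_def by blast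
    then show ?thesis using D(3)[of h] g coprime_cong_cong_left[of m "h * g ^ k" q] by simp
  qed
  show thesis
  proof (rule that[of "{m. \<exists>v. R m v}" f'])
    show "partial_char q {m. \<exists>v. R m v} f'"
      unfolding partial_char_def
    proof (intro conjI ballI allI impI)
      show "1 \<in> {m. \<exists>v. R m v}" using RH[OF D(1)] by blast
      show "f' 1 = 1" using f'[OF RH[OF D(1)]] D(2) by simp
      fix m assume "m \<in> {m. \<exists>v. R m v}"
      then obtain v where m: "R m v" by blast
      show "coprime m q" by (rule Rcop[OF m])
      fix n
      show "n \<in> {m. \<exists>v. R m v}" if "[m = n] (mod q)" using Rcong[OF m that] by blast
      show "f' n = f' m" if "[m = n] (mod q)" using f'[OF m] f'[OF Rcong[OF m that]] by simp
      assume "n \<in> {m. \<exists>v. R m v}"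
      then obtain w where n: "R n w" by blast
      show "m * n \<in> {m. \<exists>v. R m v}" using Rmult[OF m n] by blast
      show "f' (m * n) = f' m * f' n" using f'[OF Rmult[OF m n]] f'[OF m] f'[OF n] by simp
    qed
  qed (use RH Rg f' in auto)
qed

lemma ex_least_power:
  assumes "partial_char q H f" "q > 0" "coprime g q"
  obtains d where "d > 0" "g ^ d \<in> H" "\<And>k. k > 0 \<Longrightarrow> g ^ k \<in> H \<Longrightarrow> d \<le> k"
proof -
  have ex: "totient q > 0 \<and> g ^ totient q \<in> H"
    using partial_charD(1,6)[OF assms(1)] cong_sym[OF euler_theorem[OF assms(3)]] assms(2) by auto
  show thesis
    by (rule that[of "LEAST k. k > 0 \<and> g ^ k \<in> H"])
       (use LeastI[of "\<lambda>k. k > 0 \<and> g ^ k \<in> H", OF ex] Least_le[of "\<lambda>k. k > 0 \<and> g ^ k \<in> H"] in blast)+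
qed

text \<open>The residues below \<open>q\<close> are adjoined one after the other, each with some
  \<open>d\<close>-th root of the prescribed value, which is obtained from the complex
  logarithm.\<close>

lemma partial_char_extend_to_char:
  assumes pc: "partial_char q H f" and q: "q > 0"
  obtains \<psi> where "dirichlet_char q \<psi>" "\<And>h. h \<in> H \<Longrightarrow> \<psi> h = f h"
proof -
  have "\<exists>H' f'. partial_char q H' f' \<and> H \<subseteq> H' \<and> (\<forall>h\<in>H. f' h = f h) \<and> (\<forall>g<j. coprime g q \<longrightarrow> g \<in> H')" for j
  proof (induction j)
    case 0 then show ?case using pc by blast
  next
    case (Suc j)
    then obtain H1 f1 where 1: "partial_char q H1 f1" "H \<subseteq> H1" "\<forall>h\<in>H. f1 h = f h" "\<forall>g<j. coprime g q \<longrightarrow> g \<in> H1"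
      by blast
    show ?case
    proof (cases "coprime j q")
      case False
      then show ?thesis using 1 less_Suc_eq by metis
    next
      case True
      obtain d where d: "d > 0" "j ^ d \<in> H1" "\<And>k. k > 0 \<Longrightarrow> j ^ k \<in> H1 \<Longrightarrow> d \<le> k"
        using ex_least_power[OF 1(1) q True] by metis
      have "exp (Ln (f1 (j ^ d)) / of_nat d) ^ d = f1 (j ^ d)"
        using exp_divide_power_eq[OF d(1), of "Ln (f1 (j ^ d))"] partial_char_nonzero[OF 1(1) q d(2)] by simp
      then obtain H2 f2 where "partial_char q H2 f2" "H1 \<subseteq> H2" "\<And>h. h \<in> H1 \<Longrightarrow> f2 h = f1 h" "j \<in> H2"
        using partial_char_extend[OF 1(1) q True d] by metis
      then show ?thesis using 1 less_Suc_eq by (intro exI[of _ H2] exI[of _ f2]) auto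
    qed
  qed
  then obtain H' f' where H': "partial_char q H' f'" "H \<subseteq> H'" "\<And>h. h \<in> H \<Longrightarrow> f' h = f h"
    "\<And>g. g < q \<Longrightarrow> coprime g q \<Longrightarrow> g \<in> H'" by metis
  note D = partial_charD[OF H'(1)]
  have all: "n \<in> H' \<longleftrightarrow> coprime n q" for n
  proof
    assume "coprime n q"
    then have "n mod q \<in> H'" using H'(4) q by simp
    then show "n \<in> H'" using D(6)[of "n mod q" n] by (simp add: cong_def)
  qed (rule D(3))
  have "dirichlet_char q (\<lambda>n. if coprime n q then f' n else 0)"
  proof
    fix m n
    show "(if coprime m q then f' m else 0) = (if coprime n q then f' n else 0)" if "[m = n] (mod q)"
      using coprime_cong_cong_left[OF that] D(7)[OF _ that] all by auto
  qed (use q D(2,5) all partial_char_nonzero[OF H'(1) q] in auto)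
  then show thesis
    by (rule that) (use H'(2,3) all in auto)
qed

text \<open>Over the trivial subgroup \<open>n\<close> has order \<open>d > 1\<close>, so it may be
  sent to a \<open>d\<close>-th root of unity other than 1.\<close>

lemma separating_char:
  assumes q: "q > 0" and n: "coprime n q" "\<not> [n = 1] (mod q)"
  obtains \<psi> where "dirichlet_char q \<psi>" "\<psi> n \<noteq> 1"
proof -
  let ?H = "{m. [m = 1] (mod q)}"
  have pc: "partial_char q ?H (\<lambda>_. 1)"
    unfolding partial_char_def mem_Collect_eq
  proof (intro conjI ballI allI impI; (simp only: mem_Collect_eq)?)
    fix m assume m: "[m = 1] (mod q)"
    show "coprime m q" using coprime_cong_cong_left[OF m] by simp
    show "[m * n = 1] (mod q)" if "[n = 1] (mod q)" for n using cong_mult[OF m that] by simp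
    show "[n = 1] (mod q)" if "[m = n] (mod q)" for n using m that cong_sym cong_trans by metis
  qed auto
  obtain d where d: "d > 0" "n ^ d \<in> ?H" "\<And>k. k > 0 \<Longrightarrow> n ^ k \<in> ?H \<Longrightarrow> d \<le> k"
    using ex_least_power[OF pc q n(1)] by metis
  have "d \<noteq> 1" using d(2) n(2) by auto
  have "\<exists>z::complex. z ^ d = 1 \<and> z \<noteq> 1"
  proof (rule ccontr)
    assume "\<not> ?thesis"
    then have "{z::complex. z ^ d = 1} \<subseteq> {1}" by auto
    from card_mono[OF _ this] show False
      using card_roots_unity_eq[of d] d(1) \<open>d \<noteq> 1\<close> by simp
  qed
  then obtain z :: complex where z: "z ^ d = 1" "z \<noteq> 1" by blast
  obtain H' f' where H': "partial_char q H' f'" "n \<in> H'" "f' n = z"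
    using partial_char_extend[OF pc q n(1) d, of z] z(1) by metis
  obtain \<psi> where "dirichlet_char q \<psi>" "\<And>h. h \<in> H' \<Longrightarrow> \<psi> h = f' h"
    using partial_char_extend_to_char[OF H'(1) q] by metis
  then show thesis using that[of \<psi>] H' z by auto
qed

section \<open>Orthogonality of characters\<close>

definition dirichlet_chars :: "nat \<Rightarrow> (nat \<Rightarrow> complex) set" where
  "dirichlet_chars q = {\<psi>. dirichlet_char q \<psi>}"

text \<open>A character is determined by its values below \<open>q\<close>, and these are 0 or roots
  of unity of order dividing the totient.\<close>

lemma finite_dirichlet_chars:
  assumes "q > 0" shows "finite (dirichlet_chars q)"
proof (rule inj_on_finite)
  let ?R = "insert 0 {z::complex. z ^ totient q = 1}"
  show "inj_on (\<lambda>\<psi>. restrict \<psi> {..<q}) (dirichlet_chars q)"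
  proof (rule inj_onI)
    fix \<psi> \<psi>' assume *: "\<psi> \<in> dirichlet_chars q" "\<psi>' \<in> dirichlet_chars q" "restrict \<psi> {..<q} = restrict \<psi>' {..<q}"
    interpret a: dirichlet_char q \<psi> using * by (simp add: dirichlet_chars_def)
    interpret b: dirichlet_char q \<psi>' using * by (simp add: dirichlet_chars_def)
    have "\<psi> n = \<psi>' n" for n
    proof -
      have "\<psi> (n mod q) = \<psi>' (n mod q)" using fun_cong[OF *(3), of "n mod q"] assms by simp
      then show ?thesis using a.chi_cong[of n "n mod q"] b.chi_cong[of n "n mod q"] by (simp add: cong_def)
    qed
    then show "\<psi> = \<psi>'" by auto
  qed
  show "(\<lambda>\<psi>. restrict \<psi> {..<q}) ` dirichlet_chars q \<subseteq> {..<q} \<rightarrow>\<^sub>E ?R"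
  proof (intro image_subsetI PiE_I)
    fix \<psi> assume "\<psi> \<in> dirichlet_chars q"
    then interpret a: dirichlet_char q \<psi> by (simp add: dirichlet_chars_def)
    fix n assume "n \<in> {..<q}"
    then show "restrict \<psi> {..<q} n \<in> ?R"
      using a.chi_power_totient[of n] a.chi_eq_0_iff[of n] by auto
  qed auto
  have "finite {z::complex. z ^ totient q = 1}" using assms by (intro finite_roots_unity) (auto simp: Suc_le_eq)
  then show "finite ({..<q} \<rightarrow>\<^sub>E ?R)" by (intro finite_PiE) auto
qed

lemma dirichlet_char_mult:
  assumes "dirichlet_char q \<psi>" "dirichlet_char q \<psi>'"
  shows "dirichlet_char q (\<lambda>n. \<psi> n * \<psi>' n)"
proof -
  interpret a: dirichlet_char q \<psi> by fact
  interpret b: dirichlet_char q \<psi>' by fact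
  show ?thesis
    by unfold_locales
       (use a.q_pos a.chi_one b.chi_one a.chi_mult' b.chi_mult' a.chi_eq_0_iff b.chi_eq_0_iff in auto,
        use a.chi_cong b.chi_cong in metis)
qed

text \<open>Multiplication by a character \<phi> with \<open>\<phi> n \<noteq> 1\<close> permutes
  the finite set of characters, so the sum equals \<open>\<phi> n\<close> times itself.\<close>

lemma sum_dirichlet_chars:
  assumes q: "q > 0" and n: "coprime n q"
  shows "(\<Sum>\<psi>\<in>dirichlet_chars q. \<psi> n) = of_nat (card (dirichlet_chars q)) * of_bool [n = 1] (mod q)"
proof (cases "[n = 1] (mod q)")
  case True
  have "\<psi> n = 1" if "\<psi> \<in> dirichlet_chars q" for \<psi>
    using that dirichlet_char.chi_cong[OF _ True, of \<psi>] dirichlet_char.chi_one[of q \<psi>]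
    by (simp add: dirichlet_chars_def)
  then have "(\<Sum>\<psi>\<in>dirichlet_chars q. \<psi> n) = (\<Sum>\<psi>\<in>dirichlet_chars q. 1)" by (rule sum.cong[OF refl])
  then show ?thesis using True by simp
next
  case False
  obtain \<phi> where \<phi>: "dirichlet_char q \<phi>" "\<phi> n \<noteq> 1" using separating_char[OF q n False] .
  interpret p: dirichlet_char q \<phi> by fact
  let ?m = "\<lambda>\<psi> n. \<phi> n * \<psi> n"
  have inj: "inj_on ?m (dirichlet_chars q)"
  proof (rule inj_onI)
    fix \<psi> \<psi>' assume *: "\<psi> \<in> dirichlet_chars q" "\<psi>' \<in> dirichlet_chars q" "?m \<psi> = ?m \<psi>'"
    show "\<psi> = \<psi>'"
    proof
      fix k show "\<psi> k = \<psi>' k"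
        using fun_cong[OF *(3), of k] p.chi_eq_0_iff[of k] *(1,2) dirichlet_char.chi_eq_0_iff
        unfolding dirichlet_chars_def by (metis mem_Collect_eq mult_cancel_left)
    qed
  qed
  have "?m ` dirichlet_chars q \<subseteq> dirichlet_chars q"
    using dirichlet_char_mult[OF \<phi>(1)] by (auto simp: dirichlet_chars_def)
  then have im: "?m ` dirichlet_chars q = dirichlet_chars q"
    by (rule endo_inj_surj[OF finite_dirichlet_chars[OF q] _ inj])
  have "(\<Sum>\<psi>\<in>dirichlet_chars q. \<psi> n) = (\<Sum>\<psi>\<in>?m ` dirichlet_chars q. \<psi> n)" unfolding im ..
  also have "\<dots> = \<phi> n * (\<Sum>\<psi>\<in>dirichlet_chars q. \<psi> n)"
    by (simp add: sum.reindex[OF inj] sum_distrib_left)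
  finally show ?thesis using \<phi>(2) False by auto
qed

context dirichlet_char begin

text \<open>The dual of the preceding orthogonality: multiplication by some \<open>m\<close> with
  \<open>chi m \<noteq> 1\<close> permutes the residues.\<close>

lemma mean_eq_0:
  assumes "chi \<noteq> (\<lambda>n. of_bool (coprime n q))"
  shows "mean = 0"
proof -
  from assms have "\<exists>m. chi m \<noteq> of_bool (coprime m q)" unfolding fun_eq_iff by simp
  then obtain m where m0: "chi m \<noteq> of_bool (coprime m q)" ..
  then have m: "coprime m q" using chi_eq_0_iff[of m] by (cases "coprime m q") auto
  then have m': "chi m \<noteq> 1" using m0 by simp
  let ?f = "\<lambda>k. m * k mod q"
  have inj: "inj_on ?f {..<q}"
  proof (rule inj_onI)
    fix x y assume "x \<in> {..<q}" "y \<in> {..<q}" "?f x = ?f y"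
    then show "x = y" using cong_mult_lcancel_nat[OF m, of x y] by (auto simp: cong_def)
  qed
  have im: "?f ` {..<q} = {..<q}"
    by (rule endo_inj_surj[OF _ _ inj]) (use q_pos in auto)
  have "(\<Sum>k<q. chi k) = (\<Sum>k\<in>?f ` {..<q}. chi k)" unfolding im ..
  also have "\<dots> = (\<Sum>k<q. chi (m * k mod q))" by (simp add: sum.reindex[OF inj])
  also have "\<dots> = (\<Sum>k<q. chi m * chi k)"
    by (intro sum.cong refl) (metis chi_cong chi_mult' cong_mod_left cong_refl)
  also have "\<dots> = chi m * (\<Sum>k<q. chi k)" by (rule sum_distrib_left[symmetric])
  finally have "(\<Sum>k<q. chi k) = chi m * (\<Sum>k<q. chi k)" .
  then show ?thesis using m' by (auto simp: mean_def)
qed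

end


text \<open>The power \<open>c ^ (totient q - 1)\<close> is the inverse of \<open>c\<close> modulo
  \<open>q\<close>; its character value plays the part of the conjugate of
  \<open>\<psi> c\<close>.\<close>

lemma class_indicator:
  assumes q: "q > 0" and c: "coprime c q"
  shows "(\<Sum>\<psi>\<in>dirichlet_chars q. \<psi> (c ^ (totient q - 1)) * \<psi> n) = of_nat (card (dirichlet_chars q)) * of_bool [n = c] (mod q)"
proof -
  define i where "i = c ^ (totient q - 1)"
  have ci: "coprime i q" using c by (simp add: i_def)
  have "i * c = c ^ totient q" using power_minus_mult[of "totient q" c] q by (simp add: i_def)
  then have ic: "[i * c = 1] (mod q)" using euler_theorem[OF c] by simp
  have "(\<Sum>\<psi>\<in>dirichlet_chars q. \<psi> i * \<psi> n) = (\<Sum>\<psi>\<in>dirichlet_chars q. \<psi> (i * n))"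
    by (intro sum.cong refl) (simp add: dirichlet_chars_def dirichlet_char.chi_mult')
  also have "\<dots> = of_nat (card (dirichlet_chars q)) * of_bool [n = c] (mod q)"
  proof (cases "coprime n q")
    case True
    have "[i * n = 1] (mod q) \<longleftrightarrow> [i * n = i * c] (mod q)"
      using ic cong_sym[OF ic] cong_trans by blast
    also have "\<dots> \<longleftrightarrow> [n = c] (mod q)" by (rule cong_mult_lcancel_nat[OF ci])
    finally show ?thesis using sum_dirichlet_chars[OF q, of "i * n"] True ci by simp
  next
    case False
    have "\<psi> (i * n) = 0" if "\<psi> \<in> dirichlet_chars q" for \<psi>
      using that dirichlet_char.chi_eq_0_iff[of q \<psi> "i * n"] False by (simp add: dirichlet_chars_def)
    then have "(\<Sum>\<psi>\<in>dirichlet_chars q. \<psi> (i * n)) = 0" by (intro sum.neutral ballI)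
    moreover have "\<not> [n = c] (mod q)" using False c coprime_cong_cong_left[of n c q] by blast
    ultimately show ?thesis by simp
  qed
  finally show ?thesis by (simp only: i_def)
qed

section \<open>The von Mangoldt series of a residue class\<close>

lemma dseries_sum:
  assumes "finite C" "\<And>x. x \<in> C \<Longrightarrow> abs_conv (f x) \<sigma>0" "Re s > \<sigma>0"
  shows "dseries (\<lambda>n. \<Sum>x\<in>C. a x * f x n) s = (\<Sum>x\<in>C. a x * dseries (f x) s)"
proof -
  have "(\<lambda>n. \<Sum>x\<in>C. a x * (f x n * of_nat n powr (-s))) sums (\<Sum>x\<in>C. a x * dseries (f x) s)"
    by (intro sums_sum sums_mult dseries_sums[OF assms(2,3)])
  then show ?thesis
    unfolding dseries_def[of "\<lambda>n. \<Sum>x\<in>C. a x * f x n"] by (simp add: sums_iff sum_distrib_right mult.assoc)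
qed

lemma mangoldt_class_continuation:
  assumes q: "q > 1" and c: "coprime c q"
  obtains W R where "open W" "{s. Re s \<ge> 1} \<subseteq> W" "R holomorphic_on W"
    "\<And>s. Re s > 1 \<Longrightarrow> dseries (\<lambda>n. of_real (of_bool [n = c] (mod q) * mangoldt n)) s =
       1 / of_nat (card (dirichlet_chars q)) / (s - 1) + R s"
proof -
  let ?C = "dirichlet_chars q"
  let ?N = "of_nat (card ?C) :: complex"
  let ?p = "\<lambda>n. of_bool (coprime n q) :: complex"
  have fin: "finite ?C" using finite_dirichlet_chars q by simp
  have p: "?p \<in> ?C" using dirichlet_char_principal[of q] q by (simp add: dirichlet_chars_def)
  have N: "?N \<noteq> 0" using fin p by (auto simp: card_eq_0_iff)
  define i where "i = c ^ (totient q - 1)"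
  let ?d = "\<lambda>\<psi> n. \<psi> n * of_real (mangoldt n) :: complex"
  let ?m = "\<lambda>\<psi>. dirichlet_char.mean q \<psi>"
  let ?P = "\<lambda>\<psi> p. open (fst p) \<and> {s. Re s \<ge> 1} \<subseteq> fst p \<and> snd p holomorphic_on fst p \<and>
      (\<forall>s. Re s > 1 \<longrightarrow> dseries (?d \<psi>) s = of_bool (?m \<psi> \<noteq> 0) / (s - 1) + snd p s)"
  have "\<forall>\<psi>\<in>?C. \<exists>p. ?P \<psi> p"
  proof
    fix \<psi> assume "\<psi> \<in> ?C"
    then interpret dirichlet_char q \<psi> by (simp add: dirichlet_chars_def)
    obtain W R where "open W" "{s. Re s \<ge> 1} \<subseteq> W" "R holomorphic_on W"
      "\<And>s. Re s > 1 \<Longrightarrow> dseries (?d \<psi>) s = of_bool (mean \<noteq> 0) / (s - 1) + R s"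
      by (rule log_deriv_continuation[OF q]) (rule that)
    then show "\<exists>p. ?P \<psi> p" by (intro exI[of _ "(W, R)"]) simp
  qed
  from bchoice[OF this] obtain p where pp: "\<forall>\<psi>\<in>?C. ?P \<psi> (p \<psi>)" ..
  define W where "W = (\<lambda>\<psi>. fst (p \<psi>))"
  define R where "R = (\<lambda>\<psi>. snd (p \<psi>))"
  have WR: "open (W \<psi>)" "{s. Re s \<ge> 1} \<subseteq> W \<psi>" "R \<psi> holomorphic_on W \<psi>"
    "Re s > 1 \<Longrightarrow> dseries (?d \<psi>) s = of_bool (?m \<psi> \<noteq> 0) / (s - 1) + R \<psi> s" if "\<psi> \<in> ?C" for \<psi> s
    using bspec[OF pp that] by (simp_all only: W_def R_def)
  have ac: "abs_conv (?d \<psi>) 1" if "\<psi> \<in> ?C" for \<psi>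
  proof -
    interpret dirichlet_char q \<psi> using that by (simp add: dirichlet_chars_def)
    interpret cm: completely_multiplicative \<psi> by (rule completely_multiplicative)
    show ?thesis using cm.abs_conv_chi_mangoldt unfolding cm.chi_mangoldt_def[abs_def] .
  qed
  show thesis
  proof (rule that[of "\<Inter>\<psi>\<in>?C. W \<psi>" "\<lambda>s. \<Sum>\<psi>\<in>?C. \<psi> i / ?N * R \<psi> s"])
    show "open (\<Inter>\<psi>\<in>?C. W \<psi>)" using fin WR(1) by (intro open_INT) auto
    show "{s. Re s \<ge> 1} \<subseteq> (\<Inter>\<psi>\<in>?C. W \<psi>)" using WR(2) by blast
    show "(\<lambda>s. \<Sum>\<psi>\<in>?C. \<psi> i / ?N * R \<psi> s) holomorphic_on (\<Inter>\<psi>\<in>?C. W \<psi>)"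
      by (intro holomorphic_on_sum holomorphic_on_mult holomorphic_on_const holomorphic_on_subset[OF WR(3)]) auto
    fix s :: complex assume s: "Re s > 1"
    have coeff: "complex_of_real (of_bool [n = c] (mod q) * mangoldt n) = (\<Sum>\<psi>\<in>?C. \<psi> i / ?N * ?d \<psi> n)" for n
    proof -
      have "(\<Sum>\<psi>\<in>?C. \<psi> i / ?N * ?d \<psi> n) = (\<Sum>\<psi>\<in>?C. \<psi> i * \<psi> n) * (of_real (mangoldt n) / ?N)"
        unfolding sum_distrib_right by (rule sum.cong) simp_all
      also have "(\<Sum>\<psi>\<in>?C. \<psi> i * \<psi> n) = ?N * of_bool [n = c] (mod q)"
        unfolding i_def using class_indicator[OF _ c] q by simp
      finally show ?thesis using N by simp
    qed
    have "dseries (\<lambda>n. of_real (of_bool [n = c] (mod q) * mangoldt n)) s = (\<Sum>\<psi>\<in>?C. \<psi> i / ?N * dseries (?d \<psi>) s)"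
      unfolding coeff using ac by (intro dseries_sum[OF fin _ s]) auto
    also have "\<dots> = (\<Sum>\<psi>\<in>?C. \<psi> i / ?N * (of_bool (?m \<psi> \<noteq> 0) / (s - 1)) + \<psi> i / ?N * R \<psi> s)"
      by (intro sum.cong refl) (simp only: WR(4)[OF _ s] distrib_left)
    also have "\<dots> = (\<Sum>\<psi>\<in>?C. \<psi> i / ?N * (of_bool (?m \<psi> \<noteq> 0) / (s - 1))) + (\<Sum>\<psi>\<in>?C. \<psi> i / ?N * R \<psi> s)"
      by (rule sum.distrib)
    \<comment> \<open>Only the principal character has nonzero mean, so it alone contributes a pole,
      and its value at \<open>i\<close> is 1.\<close>
    also have "(\<Sum>\<psi>\<in>?C. \<psi> i / ?N * (of_bool (?m \<psi> \<noteq> 0) / (s - 1))) = (\<Sum>\<psi>\<in>{?p}. \<psi> i / ?N * (of_bool (?m \<psi> \<noteq> 0) / (s - 1)))"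
    proof (rule sum.mono_neutral_right[OF fin])
      show "\<forall>\<psi>\<in>?C - {?p}. \<psi> i / ?N * (of_bool (?m \<psi> \<noteq> 0) / (s - 1)) = 0"
        using dirichlet_char.mean_eq_0[of q] by (auto simp: dirichlet_chars_def)
    qed (use p in auto)
    also have "\<dots> = 1 / ?N / (s - 1)"
      using c principal_mean[OF q] by (simp add: i_def)
    finally show "dseries (\<lambda>n. of_real (of_bool [n = c] (mod q) * mangoldt n)) s =
       1 / ?N / (s - 1) + (\<Sum>\<psi>\<in>?C. \<psi> i / ?N * R \<psi> s)" .
  qed
qed

section \<open>Newman's Tauberian theorem\<close>

lemma powr_neg_le_diff:
  assumes "x > 0" "m > 0"
  shows "real (Suc m) powr (-1-x) \<le> (real m powr (-x) - real (Suc m) powr (-x)) / x"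
proof -
  have "\<exists>z. real m < z \<and> z < real (Suc m) \<and> (- (real (Suc m) powr (-x)) / x) - (- (real m powr (-x)) / x) = (real (Suc m) - real m) * z powr (-1-x)"
  proof (rule MVT2)
    fix t assume "real m \<le> t" "t \<le> real (Suc m)"
    then show "((\<lambda>t. - (t powr (-x)) / x) has_real_derivative t powr (-1-x)) (at t)"
      using assms by (auto intro!: derivative_eq_intros simp: minus_diff_commute)
  qed auto
  then obtain z where z: "real m < z" "z < real (Suc m)"
    "(- (real (Suc m) powr (-x)) / x) - (- (real m powr (-x)) / x) = z powr (-1-x)" by auto
  have "real (Suc m) powr (-1-x) \<le> z powr (-1-x)"
    using z assms by (intro powr_mono2') auto
  then show ?thesis using z(3) by (simp add: diff_divide_distrib)
qed

text \<open>Comparison with the integral of \<open>t powr (y - 1)\<close>. For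
  \<open>y \<le> 1\<close> each summand is charged to the unit interval on its left. For
  \<open>y > 1\<close> it is charged to the one on its right, which leaves the last summand over;
  that one is the term \<open>1 / N\<close>.\<close>

lemma sum_powr_le:
  assumes y: "y > 0" and N: "N > 0"
  shows "(\<Sum>n=1..N. real n powr (y - 1)) \<le> real N powr y * (1 / real N + 1 / y)"
proof -
  have mvt: "\<exists>z. real m < z \<and> z < real (Suc m) \<and> real (Suc m) powr y / y - real m powr y / y = z powr (y - 1)" for m
  proof -
    \<comment> \<open>This form of the mean value theorem asks for derivatives only inside the
      interval, because at \<open>m = 0\<close> the power need not be differentiable at the left
      end.\<close>
    have "\<exists>l z. real m < z \<and> z < real (Suc m) \<and> ((\<lambda>t. t powr y / y) has_real_derivative l) (at z) \<and>
        real (Suc m) powr y / y - real m powr y / y = (real (Suc m) - real m) * l"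
    proof (rule MVT)
      show "continuous_on {real m..real (Suc m)} (\<lambda>t. t powr y / y)"
        using y by (intro continuous_on_divide continuous_on_powr' continuous_on_id continuous_on_const) auto
      fix t assume "real m < t" "t < real (Suc m)"
      then have "((\<lambda>t. t powr y / y) has_real_derivative t powr (y - 1)) (at t)"
        using y by (auto intro!: derivative_eq_intros)
      then show "(\<lambda>t. t powr y / y) differentiable (at t)" using real_differentiable_def by blast
    qed auto
    then obtain l z where z: "real m < z" "z < real (Suc m)" "((\<lambda>t. t powr y / y) has_real_derivative l) (at z)"
        "real (Suc m) powr y / y - real m powr y / y = (real (Suc m) - real m) * l" by blast
    have "z > 0" using z(1) by (meson le_less_trans of_nat_0_le_iff)
    then have "((\<lambda>t. t powr y / y) has_real_derivative z powr (y - 1)) (at z)"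
      using y by (auto intro!: derivative_eq_intros)
    then have "l = z powr (y - 1)" using z(3) DERIV_unique by blast
    then show ?thesis using z by auto
  qed
  have eq: "real N powr y * (1 / real N) = real N powr (y - 1)" using N by (simp add: powr_diff)
  show ?thesis
  proof (cases "y \<le> 1")
    case True
    have "(\<Sum>n=1..N. real n powr (y - 1)) \<le> real N powr y / y"
    proof (induction N)
      case (Suc N)
      obtain z where z: "real N < z" "z < real (Suc N)" "real (Suc N) powr y / y - real N powr y / y = z powr (y - 1)"
        using mvt by blast
      have "z > 0" using z(1) by (meson le_less_trans of_nat_0_le_iff)
      then have "real (Suc N) powr (y - 1) \<le> z powr (y - 1)" using z True by (intro powr_mono2') auto
      then show ?case using Suc z(3) by simp
    qed auto
    then show ?thesis using eq by (simp add: distrib_left add_increasing)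
  next
    case False
    have "(\<Sum>n=1..N. real n powr (y - 1)) \<le> real (Suc N) powr y / y" for N
    proof (induction N)
      case (Suc N)
      obtain z where z: "real (Suc N) < z" "z < real (Suc (Suc N))"
        "real (Suc (Suc N)) powr y / y - real (Suc N) powr y / y = z powr (y - 1)"
        using mvt by blast
      have "real (Suc N) powr (y - 1) \<le> z powr (y - 1)" using z False by (intro powr_mono2) auto
      then show ?case using Suc z(3) by simp
    qed (use y in auto)
    from this[of "N - 1"] have "(\<Sum>n=1..N-1. real n powr (y - 1)) \<le> real N powr y / y" using N by simp
    moreover have "(\<Sum>n=1..N. real n powr (y - 1)) = (\<Sum>n=1..N-1. real n powr (y - 1)) + real N powr (y - 1)"
      using N by (cases N) auto
    ultimately show ?thesis using eq by (simp add: distrib_left)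
  qed
qed

text \<open>Each term is dominated by a difference of values of \<open>n powr (- Re z)\<close>, and
  these telescope. The factor \<open>1 / Re z\<close>, which blows up at the imaginary axis, is the
  one that Newman's kernel cancels.\<close>

lemma dirichlet_tail_bound:
  fixes b :: "nat \<Rightarrow> complex"
  assumes b: "\<And>n. norm (b n) \<le> C" and z: "Re z > 0" and N: "N > 0"
  shows "norm (dseries b (1 + z) - (\<Sum>n=1..N. b n * of_nat n powr (-(1+z)))) \<le> C * real N powr (- Re z) / Re z"
proof -
  let ?x = "Re z"
  let ?t = "\<lambda>n. b n * of_nat n powr (-(1+z))"
  have C: "C \<ge> 0" using order_trans[OF norm_ge_zero b[of 0]] .
  have "?t sums dseries b (1 + z)" using z by (intro dseries_sums[OF abs_conv_bounded[OF b]]) auto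
  then have "(\<lambda>n. ?t (n + Suc N)) sums (dseries b (1 + z) - (\<Sum>n<Suc N. ?t n))" by (rule sums_split_initial_segment)
  moreover have "(\<Sum>n<Suc N. ?t n) = (\<Sum>n=1..N. ?t n)"
    by (rule sum.mono_neutral_cong_right) (auto simp: less_Suc_eq_le)
  ultimately have 1: "(\<lambda>n. ?t (n + Suc N)) sums (dseries b (1 + z) - (\<Sum>n=1..N. ?t n))" by simp
  let ?g = "\<lambda>n. C / ?x * (real (n + N) powr (-?x) - real (Suc n + N) powr (-?x))"
  have "(\<lambda>n. real (n + N) powr (-?x)) \<longlonglongrightarrow> 0"
  proof -
    have "(\<lambda>n. real n powr (-?x)) \<longlonglongrightarrow> 0"
      using z by real_asymp
    then show ?thesis by (rule LIMSEQ_ignore_initial_segment)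
  qed
  then have 2: "?g sums (C / ?x * (real (0 + N) powr (-?x) - 0))"
    by (intro sums_mult telescope_sums')
  have le: "norm (?t (n + Suc N)) \<le> ?g n" for n
  proof -
    have "norm (?t (n + Suc N)) = norm (b (n + Suc N)) * real (Suc (n + N)) powr (-1-?x)"
      by (simp add: norm_mult norm_nat_powr del: of_nat_Suc)
    also have "\<dots> \<le> C * ((real (n + N) powr (-?x) - real (Suc (n + N)) powr (-?x)) / ?x)"
      using z N C by (intro mult_mono b powr_neg_le_diff) auto
    finally show ?thesis by (simp add: field_simps)
  qed
  have "norm (\<Sum>n. ?t (n + Suc N)) \<le> (\<Sum>n. ?g n)"
    by (rule norm_suminf_le[OF le]) (use 2 in \<open>simp add: sums_iff\<close>)
  then show ?thesis using 1 2 by (simp add: sums_iff)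
qed

lemma dirichlet_poly_bound:
  fixes b :: "nat \<Rightarrow> complex"
  assumes b: "\<And>n. norm (b n) \<le> C" and z: "Re z < 0" and N: "N > 0"
  shows "norm (\<Sum>n=1..N. b n * of_nat n powr (-(1+z))) \<le> C * (real N powr (- Re z) * (1 / real N + 1 / - Re z))"
proof -
  have C: "C \<ge> 0" using order_trans[OF norm_ge_zero b[of 0]] .
  have "norm (\<Sum>n=1..N. b n * of_nat n powr (-(1+z))) \<le> (\<Sum>n=1..N. C * real n powr (- Re z - 1))"
    by (rule order_trans[OF norm_sum sum_mono]) (auto simp: norm_mult norm_nat_powr minus_diff_commute intro!: mult_mono b C)
  also have "\<dots> = C * (\<Sum>n=1..N. real n powr (- Re z - 1))" by (simp add: sum_distrib_left)
  also have "\<dots> \<le> C * (real N powr (- Re z) * (1 / real N + 1 / - Re z))"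
    using z by (intro mult_left_mono[OF sum_powr_le[OF _ N] C]) auto
  finally show ?thesis .
qed

text \<open>On the circle \<open>R^2 = z * cnj z\<close>, hence
  \<open>R^2 + z^2 = z * (cnj z + z)\<close>, a multiple of \<open>Re z\<close>.\<close>

lemma norm_newman_kernel:
  assumes "norm z = R" "R > 0"
  shows "norm ((1 + z^2 / of_real R^2) / z) = 2 * \<bar>Re z\<bar> / R^2"
proof -
  have z: "z \<noteq> 0" using assms by auto
  have "z * cnj z = of_real R ^ 2" using complex_norm_square[of z] assms by simp
  then have "of_real R ^ 2 + z^2 = z * (cnj z + z)" by (simp add: power2_eq_square algebra_simps)
  also have "cnj z + z = of_real (2 * Re z)" by (simp add: complex_eq_iff)
  finally have eq: "of_real R ^ 2 + z^2 = z * of_real (2 * Re z)" .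
  have "(1 + z^2 / of_real R^2) / z = (of_real R^2 + z^2) / of_real R^2 / z"
    using assms by (simp add: add_divide_distrib)
  also have "\<dots> = of_real (2 * Re z) / of_real R^2" unfolding eq using z by simp
  finally have "norm ((1 + z^2 / of_real R^2) / z) = norm (complex_of_real (2 * Re z) / of_real R^2)" by simp
  also have "\<dots> = 2 * \<bar>Re z\<bar> / R^2" using assms by (simp add: norm_divide norm_power norm_mult)
  finally show ?thesis .
qed

section \<open>Contour integrals around the origin\<close>

lemma part_circlepath_inverse:
  assumes "R > 0" "s < t"
  shows "((\<lambda>z. 1 / z) has_contour_integral (\<i> * of_real (t - s))) (part_circlepath 0 R s t)"
proof (subst has_contour_integral_part_circlepath_iff[OF assms(2)])
  have "((\<lambda>x. \<i>) has_integral (t - s) *\<^sub>R \<i>) {s..t}"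
    using has_integral_const_real[of \<i> s t] assms by simp
  moreover have "1 / (0 + of_real R * cis x) * of_real R * \<i> * cis x = \<i>" for x
    using assms by simp
  ultimately show "((\<lambda>x. 1 / (0 + of_real R * cis x) * of_real R * \<i> * cis x) has_integral \<i> * of_real (t - s)) {s..t}"
    by (simp only: scaleR_conv_of_real mult.commute)
qed

text \<open>A residue formula in which winding numbers are replaced by the hypothesis on the
  integral of \<open>1 / z\<close> along \<open>p\<close>: the half circle supplies the other
  \<open>\<i> * pi\<close>. Removing \<open>g 0 / z\<close> leaves a holomorphic integrand on a
  convex set. The path \<open>p\<close> will be both the left half circle and the polygon.\<close>

lemma half_circle_Cauchy:
  assumes V: "open V" "convex V" "0 \<in> V" and g: "g holomorphic_on V" and R: "R > 0"
    and C: "path_image (part_circlepath 0 R (-pi/2) (pi/2)) \<subseteq> V"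
    and p: "valid_path p" "path_image p \<subseteq> V - {0}" "pathstart p = \<i> * of_real R" "pathfinish p = - \<i> * of_real R"
    and p1: "contour_integral p (\<lambda>z. 1 / z) = \<i> * pi"
  shows "contour_integral (part_circlepath 0 R (-pi/2) (pi/2)) (\<lambda>z. g z / z) + contour_integral p (\<lambda>z. g z / z) = 2 * pi * \<i> * g 0"
proof -
  let ?c = "part_circlepath 0 R (-pi/2) (pi/2)"
  define Q where "Q = (\<lambda>z. if z = 0 then deriv g 0 else (g z - g 0) / (z - 0))"
  have Q: "Q holomorphic_on V" unfolding Q_def by (rule pole_lemma_open[OF g V(1)])
  have c0: "path_image ?c \<subseteq> V - {0}"
    using C path_image_part_circlepath_subset[of "-pi/2" "pi/2" R 0] R by auto
  have ends: "pathfinish ?c = pathstart p" "pathstart ?c = pathfinish p"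
    using p by (auto simp: cis_conv_exp[symmetric] exp_eq_polar complex_eq_iff)
  have "(Q has_contour_integral 0) (?c +++ p)"
    by (rule Cauchy_theorem_convex_simple[OF Q V(2)]) (use p C ends in \<open>auto intro!: valid_path_join simp: path_image_join\<close>)
  then have "contour_integral (?c +++ p) Q = 0" by (rule contour_integral_unique)
  moreover have "Q contour_integrable_on ?c" "Q contour_integrable_on p"
    using p C by (auto intro!: contour_integrable_holomorphic_simple[OF Q V(1)])
  ultimately have sum0: "contour_integral ?c Q + contour_integral p Q = 0" using p by simp
  have opn: "open (V - {0})" using V by (intro open_delete)
  have split: "contour_integral q Q = contour_integral q (\<lambda>z. g z / z) - g 0 * contour_integral q (\<lambda>z. 1 / z)"
    if q: "valid_path q" "path_image q \<subseteq> V - {0}" for q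
  proof -
    have i1: "(\<lambda>z. g z / z) contour_integrable_on q"
      by (rule contour_integrable_holomorphic_simple[OF _ opn q]) (auto intro!: holomorphic_intros holomorphic_on_subset[OF g])
    have i2: "(\<lambda>z. 1 / z) contour_integrable_on q"
      by (rule contour_integrable_holomorphic_simple[OF _ opn q]) (auto intro!: holomorphic_intros)
    have "contour_integral q Q = contour_integral q (\<lambda>z. g z / z - g 0 * (1 / z))"
      by (rule contour_integral_eq) (use q(2) in \<open>auto simp: Q_def diff_divide_distrib\<close>)
    also have "\<dots> = contour_integral q (\<lambda>z. g z / z) - g 0 * contour_integral q (\<lambda>z. 1 / z)"
      using i1 i2 by (simp only: contour_integral_diff contour_integrable_lmul contour_integral_lmul)
    finally show ?thesis .
  qed
  have "contour_integral ?c (\<lambda>z. 1 / z) = \<i> * of_real (pi/2 - (-pi/2))"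
    by (rule contour_integral_unique[OF part_circlepath_inverse[OF R]]) simp
  then have c1: "contour_integral ?c (\<lambda>z. 1 / z) = \<i> * pi" by simp
  have "I1 + I2 = 2 * (c * d)" if "Q1 = I1 - c * d" "Q2 = I2 - c * d" "Q1 + Q2 = 0" for Q1 Q2 I1 I2 c d :: complex
  proof -
    have "I1 = Q1 + c * d" "I2 = Q2 + c * d" using that(1,2) by simp_all
    then have "I1 + I2 = (Q1 + Q2) + 2 * (c * d)" by simp
    then show ?thesis using that(3) by simp
  qed
  from this[OF split[OF valid_path_part_circlepath c0, unfolded c1] split[OF p(1,2), unfolded p1] sum0]
  show ?thesis by (simp add: mult_ac)
qed


lemma compact_continuous_norm_le:
  assumes "compact K" "continuous_on K (h :: complex \<Rightarrow> complex)"
  obtains M where "M > 0" "\<And>z. z \<in> K \<Longrightarrow> norm (h z) \<le> M"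
proof -
  have "bounded (h ` K)" by (rule compact_imp_bounded[OF compact_continuous_image[OF assms(2,1)]])
  then obtain M where "M > 0" "\<forall>x\<in>h ` K. norm x \<le> M" using bounded_pos by blast
  then show thesis using that by blast
qed

text \<open>Newman's contour: on \<open>\<bar>z\<bar> = R\<close> the kernel \<open>N\<^sup>z (1 + z\<^sup>2/R\<^sup>2) / z\<close> has modulus
  \<open>2 N\<^sup>x \<bar>x\<bar> / R\<^sup>2\<close> with \<open>x = Re z\<close>, which cancels the growth of the tail on the right half and of the
  partial sum on the left half. Only the continuation itself is moved to the polygonal path \<open>p\<close>
  at distance \<open>\<eta>\<close> from the imaginary axis; choosing \<open>\<eta>\<close> before \<open>N\<close> makes that part small.\<close>

lemma newman_bound:
  fixes b :: "nat \<Rightarrow> complex"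
  assumes b: "\<And>n. norm (b n) \<le> C" and W: "open W" "{s. Re s \<ge> 1} \<subseteq> W" and f: "f holomorphic_on W"
    and eq: "\<And>s. Re s > 1 \<Longrightarrow> dseries b s = f s" and R: "R > 0" and \<epsilon>: "\<epsilon> > 0"
  shows "\<forall>\<^sub>F N in sequentially. norm (f 1 - (\<Sum>n=1..N. b n / of_nat n)) \<le> 2 * C / R + \<epsilon>"
proof -
  have C: "C \<ge> 0" using order_trans[OF norm_ge_zero b[of 0]] .
  define F where "F = (\<lambda>z. f (1 + z))"
  define S where "S = (\<lambda>N z. \<Sum>n=1..N. b n * of_nat n powr (-(1+z)))"
  define k where "k = (\<lambda>N z. of_nat N powr z * (1 + z^2 / of_real R^2) :: complex)"
  define cp where "cp = part_circlepath 0 R (-pi/2) (pi/2)"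
  define cm where "cm = part_circlepath 0 R (pi/2) (3*pi/2)"
  let ?iR = "\<i> * complex_of_real R"
  \<comment> \<open>The rectangle \<open>[0, 2R] x [-2R, 2R]\<close>. By compactness it has a
    uniform margin \<delta> in the domain of holomorphy, so the contour may be pushed slightly to
    the left of the imaginary axis.\<close>
  define A where "A = cbox 0 (Complex (2*R) (2*R)) \<union> cbox (Complex 0 (-2*R)) (Complex (2*R) 0)"
  have A_iff: "z \<in> A \<longleftrightarrow> 0 \<le> Re z \<and> Re z \<le> 2*R \<and> -2*R \<le> Im z \<and> Im z \<le> 2*R" for z
    using R by (auto simp: A_def in_cbox_complex_iff)
  define W' where "W' = (\<lambda>z. 1 + z) -` W"
  have W': "open W'" unfolding W'_def by (intro open_vimage W continuous_intros)
  have "A \<subseteq> W'" using subsetD[OF W(2)] by (auto simp: A_iff W'_def)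
  moreover have "compact A" unfolding A_def by (intro compact_Un compact_cbox)
  ultimately obtain \<delta> where \<delta>: "\<delta> > 0" "(\<Union>x\<in>A. ball x \<delta>) \<subseteq> W'"
    using compact_subset_open_imp_ball_epsilon_subset[OF _ W'] by metis
  define V where "V = {z. - \<delta> < Re z} \<inter> ({z. Re z < 2*R} \<inter> ({z. Im z > -2*R} \<inter> {z. Im z < 2*R}))"
  have V_iff: "z \<in> V \<longleftrightarrow> - \<delta> < Re z \<and> Re z < 2*R \<and> -2*R < Im z \<and> Im z < 2*R" for z
    by (auto simp: V_def)
  have V: "open V" "convex V"
    unfolding V_def by (auto intro!: open_Int convex_Int open_halfspace_Re_gt open_halfspace_Re_lt open_halfspace_Im_gt open_halfspace_Im_lt
            convex_halfspace_Re_gt convex_halfspace_Re_lt convex_halfspace_Im_gt convex_halfspace_Im_lt)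
  have VW: "V \<subseteq> W'"
  proof
    fix z assume z: "z \<in> V"
    define y where "y = Complex (max 0 (Re z)) (Im z)"
    have "y \<in> A" using z R by (auto simp: A_iff V_iff y_def)
    moreover have "dist y z < \<delta>" using z \<delta>(1) by (auto simp: y_def V_iff dist_norm cmod_def max_def)
    ultimately have "z \<in> (\<Union>x\<in>A. ball x \<delta>)" by auto
    then show "z \<in> W'" using \<delta>(2) by blast
  qed
  have F: "F holomorphic_on V"
    unfolding F_def using VW
    by (intro holomorphic_on_compose_gen[of "\<lambda>z. 1 + z" V f W, unfolded o_def] holomorphic_intros f) (auto simp: W'_def)
  have powr_hol: "(\<lambda>z. of_nat n powr (-(1+z)) :: complex) holomorphic_on T" for n T
    by (cases "n = 0") (auto intro!: holomorphic_intros)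
  have S: "S N holomorphic_on T" for N T
    unfolding S_def by (intro holomorphic_intros powr_hol)
  have k: "k N holomorphic_on T" if "N > 0" for N T
    unfolding k_def using that R by (intro holomorphic_intros) auto
  have cp_pt: "norm z = R \<and> Re z \<ge> 0" if "z \<in> path_image cp" for z
  proof -
    from that obtain x where x: "z = of_real R * exp (\<i> * of_real x)" "-pi/2 \<le> x" "x \<le> pi/2"
      unfolding cp_def by (auto simp: path_image_part_circlepath)
    then show ?thesis using R cos_ge_zero[of x] by (simp add: norm_mult Re_exp)
  qed
  have cm_pt: "norm z = R \<and> Re z \<le> 0" if "z \<in> path_image cm" for z
  proof -
    from that obtain x where x: "z = of_real R * exp (\<i> * of_real x)" "pi/2 \<le> x" "x \<le> 3*pi/2"
      unfolding cm_def by (auto simp: path_image_part_circlepath)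
    moreover have "cos x \<le> 0" using cos_ge_zero[of "x - pi"] x by (simp add: cos_diff)
    ultimately show ?thesis using R by (simp add: norm_mult Re_exp mult_nonneg_nonpos)
  qed
  have Re0: "z \<in> {?iR, -?iR}" if "norm z = R" "Re z = 0" for z
  proof -
    have "\<bar>Im z\<bar> = R" using that R by (simp add: cmod_def)
    then show ?thesis using that(2) by (auto simp: complex_eq_iff)
  qed
  let ?H = "\<lambda>\<eta> \<sigma>. closed_segment (\<sigma> * ?iR) (\<sigma> * ?iR - of_real \<eta>)"
  have H_iff: "z \<in> ?H \<eta> (of_real \<sigma>) \<longleftrightarrow> Im z = \<sigma> * R \<and> - \<eta> \<le> Re z \<and> Re z \<le> 0" if "\<eta> > 0" for z \<eta> \<sigma>
    using that by (subst closed_segment_same_Im) (auto simp: closed_segment_eq_real_ivl)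
  define h where "h = (\<lambda>z. F z * ((1 + z^2 / of_real R^2) / z))"
  have h_cont: "continuous_on K h" if "K \<subseteq> V - {0}" for K
    unfolding h_def using that R
    by (intro continuous_intros continuous_on_subset[OF holomorphic_on_imp_continuous_on[OF F]]) auto
  have HV: "?H (\<delta>/2) (of_real \<sigma>) \<subseteq> V - {0}" if "\<bar>\<sigma>\<bar> = 1" for \<sigma>
  proof
    fix z assume "z \<in> ?H (\<delta>/2) (of_real \<sigma>)"
    then have "Im z = \<sigma> * R \<and> - (\<delta>/2) \<le> Re z \<and> Re z \<le> 0" using H_iff[of "\<delta>/2" z \<sigma>] \<delta>(1) by simp
    moreover have "\<sigma> = 1 \<or> \<sigma> = -1" using that by auto
    ultimately show "z \<in> V - {0}" using R \<delta>(1) by (auto simp: V_iff)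
  qed
  \<comment> \<open>The bound is taken on segments of the full length \<open>\<delta>/2\<close>, so
    that \<open>M\<close> does not depend on the smaller \<eta> chosen from it.\<close>
  obtain M1 where M1: "M1 > 0" "\<And>z. z \<in> ?H (\<delta>/2) (of_real 1) \<Longrightarrow> norm (h z) \<le> M1"
    using compact_continuous_norm_le[OF compact_segment h_cont[OF HV[of 1]]] by auto
  obtain M2 where M2: "M2 > 0" "\<And>z. z \<in> ?H (\<delta>/2) (of_real (-1)) \<Longrightarrow> norm (h z) \<le> M2"
    using compact_continuous_norm_le[OF compact_segment h_cont[OF HV[of "-1"]]] by auto
  define M where "M = M1 + M2"
  have M: "M > 0" using M1 M2 by (simp add: M_def)
  \<comment> \<open>The two horizontal sides together then contribute at most \<epsilon>. The bound
    \<open>M3\<close> on the vertical side depends on \<eta> but not on \<open>N\<close>, and is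
    beaten by \<open>N powr (-\<eta>)\<close>.\<close>
  define \<eta> where "\<eta> = min (\<delta>/2) (\<epsilon> / (2 * M))"
  have \<eta>: "\<eta> > 0" "\<eta> \<le> \<delta>/2" "2 * M * \<eta> \<le> \<epsilon>"
    using \<delta>(1) \<epsilon> M by (auto simp: \<eta>_def min_def field_simps)
  define a2 where "a2 = ?iR - of_real \<eta>"
  define a3 where "a3 = -?iR - of_real \<eta>"
  have seg1: "z \<in> closed_segment ?iR a2 \<longleftrightarrow> Im z = R \<and> - \<eta> \<le> Re z \<and> Re z \<le> 0" for z
    using H_iff[OF \<eta>(1), of z 1] by (simp add: a2_def)
  have seg3: "z \<in> closed_segment a3 (-?iR) \<longleftrightarrow> Im z = -R \<and> - \<eta> \<le> Re z \<and> Re z \<le> 0" for z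
    using H_iff[OF \<eta>(1), of z "-1"] by (simp add: a3_def closed_segment_commute)
  have seg2: "z \<in> closed_segment a2 a3 \<longleftrightarrow> Re z = -\<eta> \<and> - R \<le> Im z \<and> Im z \<le> R" for z
    unfolding a2_def a3_def using R by (subst closed_segment_same_Re) (auto simp: closed_segment_eq_real_ivl)
  have seg2V: "closed_segment a2 a3 \<subseteq> V - {0}"
    using \<eta> \<delta>(1) R by (auto simp: seg2 V_iff)
  obtain M3 where M3: "M3 > 0" "\<And>z. z \<in> closed_segment a2 a3 \<Longrightarrow> norm (h z) \<le> M3"
    using compact_continuous_norm_le[OF compact_segment h_cont[OF seg2V]] by auto
  define p where "p = linepath ?iR a2 +++ (linepath a2 a3 +++ linepath a3 (-?iR))"
  have p_img: "path_image p = closed_segment ?iR a2 \<union> (closed_segment a2 a3 \<union> closed_segment a3 (-?iR))"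
    by (simp add: p_def path_image_join)
  have p_valid: "valid_path p" unfolding p_def by (intro valid_path_join) auto
  have pV: "path_image p \<subseteq> V - {0}"
    unfolding p_img using \<eta> \<delta>(1) R by (auto simp: seg1 seg2 seg3 V_iff)
  have p1: "contour_integral p (\<lambda>z. 1 / z) = \<i> * pi"
  proof -
    \<comment> \<open>The plane cut along the nonnegative reals: the path runs around the left of
      the origin, so \<open>Ln (- z)\<close> is a primitive of \<open>1 / z\<close> along
      it.\<close>
    let ?T = "{z::complex. - z \<notin> \<real>\<^sub>\<le>\<^sub>0}"
    have "((\<lambda>z. 1 / z) has_contour_integral (Ln (- pathfinish p) - Ln (- pathstart p))) p"
    proof (rule contour_integral_primitive[of ?T])
      fix z :: complex assume "z \<in> ?T"
      then show "((\<lambda>z. Ln (- z)) has_field_derivative 1 / z) (at z within ?T)"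
        by (auto intro!: derivative_eq_intros simp: field_simps)
    next
      show "path_image p \<subseteq> ?T"
        unfolding p_img using \<eta> R by (auto simp: seg1 seg2 seg3 complex_nonpos_Reals_iff)
    qed (rule p_valid)
    moreover have "Ln (- pathfinish p) = of_real (ln R) + \<i> * of_real pi / 2"
      using Ln_times_of_real[of R \<i>] R by (simp add: p_def mult.commute Ln_of_real)
    moreover have "Ln (- pathstart p) = of_real (ln R) - \<i> * of_real pi / 2"
      using Ln_times_of_real[of R "-\<i>"] R by (simp add: p_def mult.commute Ln_of_real)
    ultimately show ?thesis by (simp add: contour_integral_unique)
  qed
  have cm1: "contour_integral cm (\<lambda>z. 1 / z) = \<i> * pi"
  proof -
    have "contour_integral cm (\<lambda>z. 1 / z) = \<i> * of_real (3*pi/2 - pi/2)"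
      unfolding cm_def by (rule contour_integral_unique[OF part_circlepath_inverse[OF R]]) simp
    then show ?thesis by simp
  qed
  have cpV: "path_image cp \<subseteq> V"
  proof
    fix z assume "z \<in> path_image cp"
    then have z: "norm z = R" "Re z \<ge> 0" using cp_pt by auto
    then have "Re z \<le> R" "\<bar>Im z\<bar> \<le> R" using abs_Re_le_cmod[of z] abs_Im_le_cmod[of z] by auto
    then show "z \<in> V" using z(2) R \<delta>(1) unfolding V_iff by (intro conjI) linarith+
  qed
  \<comment> \<open>Cauchy's formula is applied to \<open>F\<close> on the right half circle
    followed by the polygon, and to the entire function \<open>S N\<close> on the full circle.
    Subtracting leaves the tail on the right, \<open>S N\<close> on the left half circle and
    \<open>F\<close> on the polygon.\<close>
  have main: "norm (F 0 - S N 0) \<le> 2 * C / R + C / real N + \<epsilon> / 2 + M3 * R * real N powr (-\<eta>)" if N: "N > 0" for N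
  proof -
    let ?F = "\<lambda>z. F z * k N z / z" and ?S = "\<lambda>z. S N z * k N z / z"
    have k0: "k N 0 = 1" using N by (simp add: k_def)
    have "contour_integral cp ?F + contour_integral p ?F = 2 * pi * \<i> * (F 0 * k N 0)"
      unfolding cp_def
      by (rule half_circle_Cauchy[OF V _ holomorphic_on_mult[OF F k[OF N]] R cpV[unfolded cp_def] p_valid pV _ _ p1])
         (use \<delta>(1) R in \<open>auto simp: V_iff p_def\<close>)
    then have 1: "contour_integral cp ?F + contour_integral p ?F = 2 * pi * \<i> * F 0" by (simp add: k0)
    have "contour_integral cp ?S + contour_integral cm ?S = 2 * pi * \<i> * (S N 0 * k N 0)"
      unfolding cp_def
    proof (rule half_circle_Cauchy[OF open_UNIV convex_UNIV _ holomorphic_on_mult[OF S k[OF N]] R _ _ _ _ _ cm1])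
      show "path_image cm \<subseteq> UNIV - {0}" using cm_pt R by fastforce
      have "3 * pi / 2 = 3 / 2 * pi" by simp
      then have "cos (3 * pi / 2) = 0" "sin (3 * pi / 2) = -1"
        using cos_3over2_pi sin_3over2_pi by metis+
      then have "exp (\<i> * (3 * complex_of_real pi / 2)) = - \<i>"
        by (simp add: exp_eq_polar complex_eq_iff)
      then show "pathfinish cm = - \<i> * of_real R" by (simp add: cm_def mult.commute)
      show "pathstart cm = \<i> * of_real R" by (simp add: cm_def exp_eq_polar complex_eq_iff)
    qed (auto simp: cm_def)
    then have 2: "contour_integral cp ?S + contour_integral cm ?S = 2 * pi * \<i> * S N 0" by (simp add: k0)
    have opn: "open (V - {0})" using V by (intro open_delete)
    have cp0: "path_image cp \<subseteq> V - {0}" using cpV cp_pt R by fastforce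
    have iF: "?F contour_integrable_on cp"
      by (rule contour_integrable_holomorphic_simple[OF _ opn _ cp0])
         (auto simp: cp_def intro!: holomorphic_intros k N holomorphic_on_subset[OF F])
    have iS: "?S contour_integrable_on cp"
      by (rule contour_integrable_holomorphic_simple[OF _ opn _ cp0])
         (auto simp: cp_def intro!: holomorphic_intros k N S)
    have iSm: "?S contour_integrable_on cm"
      by (rule contour_integrable_holomorphic_simple[of _ "UNIV - {0}"])
         (use cm_pt[of 0] R in \<open>auto simp: cm_def intro!: holomorphic_intros k N S\<close>)
    have norm_k: "norm (k N z / z) = real N powr Re z * (2 * \<bar>Re z\<bar> / R^2)" if "norm z = R" for z
    proof -
      have "k N z / z = of_nat N powr z * ((1 + z^2 / of_real R^2) / z)" by (simp add: k_def)
      then show ?thesis using norm_newman_kernel[OF that R] by (simp only: norm_mult norm_nat_powr)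
    qed
    \<comment> \<open>The estimate of the tail divides by \<open>Re z\<close>, so the endpoints
      \<open>?iR\<close> and \<open>-?iR\<close> are excluded; finitely many exceptional points do
      not affect the arc bound.\<close>
    have Bp: "norm (contour_integral cp (\<lambda>z. ?F z - ?S z)) \<le> 2 * C / R^2 * R * (pi/2 - (-pi/2))"
      unfolding cp_def
    proof (rule contour_integral_bound_part_circlepath_strong[where k = "{?iR, -?iR}"])
      show "(\<lambda>z. ?F z - ?S z) contour_integrable_on part_circlepath 0 R (-pi/2) (pi/2)"
        using iF iS contour_integrable_diff unfolding cp_def by blast
      fix z assume z: "z \<in> path_image (part_circlepath 0 R (-pi/2) (pi/2)) - {?iR, -?iR}"
      then have z': "norm z = R" "Re z > 0" using cp_pt[of z] Re0[of z] unfolding cp_def by fastforce+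
      have "norm (F z - S N z) \<le> C * real N powr (- Re z) / Re z"
        using dirichlet_tail_bound[where b = b and C = C, OF b z'(2) N] eq[of "1 + z"] z'(2) by (simp add: F_def S_def)
      then have "norm ((F z - S N z) * (k N z / z)) \<le> C * real N powr (- Re z) / Re z * (real N powr Re z * (2 * \<bar>Re z\<bar> / R^2))"
        unfolding norm_mult norm_k[OF z'(1)] by (intro mult_right_mono) auto
      also have "\<dots> = 2 * C / R^2"
        using z'(2) N R by (simp add: powr_minus field_simps)
      finally show "norm (?F z - ?S z) \<le> 2 * C / R^2" by (simp add: left_diff_distrib diff_divide_distrib)
    qed (use C R in auto)
    have Bm: "norm (contour_integral cm ?S) \<le> (2 * C / R^2 + 2 * C / (real N * R)) * R * (3*pi/2 - pi/2)"
      unfolding cm_def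
    proof (rule contour_integral_bound_part_circlepath_strong[where k = "{?iR, -?iR}"])
      show "?S contour_integrable_on part_circlepath 0 R (pi/2) (3*pi/2)" using iSm unfolding cm_def .
      fix z assume z: "z \<in> path_image (part_circlepath 0 R (pi/2) (3*pi/2)) - {?iR, -?iR}"
      then have z': "norm z = R" "Re z < 0" using cm_pt[of z] Re0[of z] unfolding cm_def by fastforce+
      define y where "y = - Re z"
      have y: "y > 0" "y \<le> R" using z' abs_Re_le_cmod[of z] by (auto simp: y_def)
      have "norm (S N z) \<le> C * (real N powr y * (1 / real N + 1 / y))"
        using dirichlet_poly_bound[where b = b and C = C, OF b z'(2) N] by (simp add: S_def y_def)
      then have "norm (S N z * (k N z / z)) \<le> C * (real N powr y * (1 / real N + 1 / y)) * (real N powr (-y) * (2 * y / R^2))"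
      proof -
        have "real N powr Re z * (2 * \<bar>Re z\<bar> / R^2) = real N powr (-y) * (2 * y / R^2)" using z'(2) by (simp add: y_def)
        then have nk: "norm (k N z / z) = real N powr (-y) * (2 * y / R^2)" using norm_k[OF z'(1)] by simp
        show ?thesis unfolding norm_mult nk by (intro mult_right_mono) (use y \<open>norm (S N z) \<le> _\<close> in auto)
      qed
      also have "\<dots> = 2 * C / R^2 + 2 * C / real N * (y / R^2)"
        using y N R by (simp add: powr_minus field_simps)
      also have "\<dots> \<le> 2 * C / R^2 + 2 * C / real N * (R / R^2)"
        using y C R by (intro add_left_mono mult_left_mono divide_right_mono) auto
      also have "\<dots> = 2 * C / R^2 + 2 * C / (real N * R)" using R by (simp add: power2_eq_square)
      finally show "norm (?S z) \<le> 2 * C / R^2 + 2 * C / (real N * R)" by simp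
    qed (use C R in auto)
    have Fh: "?F z = h z * of_nat N powr z" for z by (simp add: h_def k_def)
    have le1: "real N powr x \<le> 1" if "x \<le> 0" for x
      using that N powr_mono[of x 0 "real N"] by simp
    have Fc: "continuous_on (closed_segment x y) ?F" if "closed_segment x y \<subseteq> V - {0}" for x y
      using that by (intro continuous_intros continuous_on_subset[OF holomorphic_on_imp_continuous_on[OF F]]
          holomorphic_on_imp_continuous_on[OF k[OF N]]) auto
    have segV: "closed_segment ?iR a2 \<subseteq> V - {0}" "closed_segment a3 (-?iR) \<subseteq> V - {0}"
      using pV unfolding p_img by auto
    have B1: "norm (contour_integral (linepath ?iR a2) ?F) \<le> M * norm (a2 - ?iR)"
    proof (rule contour_integral_bound_linepath)
      show "?F contour_integrable_on linepath ?iR a2" by (rule contour_integrable_continuous_linepath[OF Fc[OF segV(1)]])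
      fix z assume "z \<in> closed_segment ?iR a2"
      then have z: "Im z = R" "- \<eta> \<le> Re z" "Re z \<le> 0" by (auto simp: seg1)
      then have "norm (h z) \<le> M" using M1(2)[of z] M2 \<eta>(2) H_iff[of "\<delta>/2" z 1] \<delta>(1) by (simp add: M_def)
      then show "norm (?F z) \<le> M" using le1[OF z(3)] M unfolding Fh norm_mult norm_nat_powr
        using mult_mono[of "norm (h z)" M "real N powr Re z" 1] by simp
    qed (use M in simp)
    have B3: "norm (contour_integral (linepath a3 (-?iR)) ?F) \<le> M * norm (-?iR - a3)"
    proof (rule contour_integral_bound_linepath)
      show "?F contour_integrable_on linepath a3 (-?iR)" by (rule contour_integrable_continuous_linepath[OF Fc[OF segV(2)]])
      fix z assume "z \<in> closed_segment a3 (-?iR)"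
      then have z: "Im z = -R" "- \<eta> \<le> Re z" "Re z \<le> 0" by (auto simp: seg3)
      then have "norm (h z) \<le> M" using M2(2)[of z] M1 \<eta>(2) H_iff[of "\<delta>/2" z "-1"] \<delta>(1) by (simp add: M_def)
      then show "norm (?F z) \<le> M" using le1[OF z(3)] M unfolding Fh norm_mult norm_nat_powr
        using mult_mono[of "norm (h z)" M "real N powr Re z" 1] by simp
    qed (use M in simp)
    have B2: "norm (contour_integral (linepath a2 a3) ?F) \<le> M3 * real N powr (-\<eta>) * norm (a3 - a2)"
    proof (rule contour_integral_bound_linepath)
      show "?F contour_integrable_on linepath a2 a3" by (rule contour_integrable_continuous_linepath[OF Fc[OF seg2V]])
      fix z assume z: "z \<in> closed_segment a2 a3"
      then show "norm (?F z) \<le> M3 * real N powr (-\<eta>)" using M3(2)[OF z] unfolding Fh norm_mult norm_nat_powr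
        by (auto simp: seg2 intro!: mult_right_mono)
    qed (use M3 in simp)
    have pint: "contour_integral p ?F = contour_integral (linepath ?iR a2) ?F + (contour_integral (linepath a2 a3) ?F + contour_integral (linepath a3 (-?iR)) ?F)"
    proof -
      note ci = contour_integrable_continuous_linepath[OF Fc[OF segV(1)]] contour_integrable_continuous_linepath[OF Fc[OF seg2V]]
        contour_integrable_continuous_linepath[OF Fc[OF segV(2)]]
      show ?thesis unfolding p_def
        by (subst contour_integral_join, (simp_all add: ci contour_integrable_join valid_path_join)[4], subst contour_integral_join)
           (simp_all add: ci)
    qed
    have "norm (contour_integral p ?F) \<le> M * \<eta> + (M3 * real N powr (-\<eta>) * (2 * R) + M * \<eta>)"
    proof -
      have n1: "norm (a2 - ?iR) = \<eta>" "norm (-?iR - a3) = \<eta>" using \<eta> by (simp_all add: a2_def a3_def)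
      have "a3 - a2 = - (2 * ?iR)" by (simp add: a2_def a3_def)
      then have n2: "norm (a3 - a2) = 2 * R" using R by (simp add: norm_mult)
      show ?thesis unfolding pint
        using B1 B2 B3 unfolding n1 n2 by (intro order_trans[OF norm_triangle_ineq] add_mono) auto
    qed
    then have Bpoly: "norm (contour_integral p ?F) \<le> \<epsilon> + 2 * (M3 * R * real N powr (-\<eta>))" using \<eta>(3) by (simp add: algebra_simps)
    have cd: "contour_integral cp (\<lambda>z. ?F z - ?S z) = contour_integral cp ?F - contour_integral cp ?S"
      by (rule contour_integral_diff[OF iF iS])
    have E: "2 * pi * \<i> * (F 0 - S N 0) = contour_integral cp (\<lambda>z. ?F z - ?S z) + (contour_integral p ?F - contour_integral cm ?S)"
      unfolding cd right_diff_distrib 1[symmetric] 2[symmetric] by simp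
    have "norm (2 * pi * \<i> * (F 0 - S N 0)) \<le> norm (contour_integral cp (\<lambda>z. ?F z - ?S z)) + (norm (contour_integral p ?F) + norm (contour_integral cm ?S))"
      unfolding E using norm_triangle_ineq[of "contour_integral cp (\<lambda>z. ?F z - ?S z)" "contour_integral p ?F - contour_integral cm ?S"]
        norm_triangle_ineq4[of "contour_integral p ?F" "contour_integral cm ?S"] by linarith
    then have "2 * pi * norm (F 0 - S N 0) \<le> 2 * C / R^2 * R * pi + (\<epsilon> + 2 * (M3 * R * real N powr (-\<eta>)) + (2 * C / R^2 + 2 * C / (real N * R)) * R * pi)"
      using Bp Bm Bpoly by (simp add: norm_mult)
    also have "\<dots> = 2 * pi * (2 * C / R + C / real N) + (\<epsilon> + 2 * (M3 * R * real N powr (-\<eta>)))"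
      using R N by (simp add: power2_eq_square field_simps)
    \<comment> \<open>A crude use of \<open>pi \<ge> 1\<close>, so that the common factor
      \<open>2 * pi\<close> can be cancelled.\<close>
    also have "\<dots> \<le> 2 * pi * (2 * C / R + C / real N) + pi * (\<epsilon> + 2 * (M3 * R * real N powr (-\<eta>)))"
      using pi_ge_two \<epsilon> M3(1) R by (intro add_left_mono mult_right_mono[of 1 pi, simplified]) auto
    also have "\<dots> = 2 * pi * (2 * C / R + C / real N + \<epsilon> / 2 + M3 * R * real N powr (-\<eta>))" by (simp add: algebra_simps)
    finally show ?thesis by (simp add: pi_gt_zero)
  qed
  have "(\<lambda>N. real N powr (-\<eta>)) \<longlonglongrightarrow> 0" "(\<lambda>N. 1 / real N) \<longlonglongrightarrow> 0"
    using \<eta>(1) by real_asymp+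
  then have "(\<lambda>N. C * (1 / real N) + M3 * R * real N powr (-\<eta>)) \<longlonglongrightarrow> C * 0 + M3 * R * 0"
    by (intro tendsto_intros)
  then have "(\<lambda>N. C / real N + M3 * R * real N powr (-\<eta>)) \<longlonglongrightarrow> 0" by simp
  then have "\<forall>\<^sub>F N in sequentially. C / real N + M3 * R * real N powr (-\<eta>) < \<epsilon> / 2"
    by (rule order_tendstoD(2)) (use \<epsilon> in auto)
  then show ?thesis using eventually_gt_at_top[of 0]
  proof eventually_elim
    case (elim N)
    have F0: "F 0 = f 1" by (simp add: F_def)
    have S0: "S N 0 = (\<Sum>n=1..N. b n / of_nat n)"
      unfolding S_def by (intro sum.cong) (auto simp: powr_minus divide_inverse)
    show ?case using main[OF elim(2), unfolded F0 S0] elim(1) by linarith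
  qed
qed

theorem newman_tauberian:
  fixes b :: "nat \<Rightarrow> complex"
  assumes b: "\<And>n. norm (b n) \<le> C" and W: "open W" "{s. Re s \<ge> 1} \<subseteq> W" and f: "f holomorphic_on W"
    and eq: "\<And>s. Re s > 1 \<Longrightarrow> dseries b s = f s"
  shows "(\<lambda>N. \<Sum>n=1..N. b n / of_nat n) \<longlonglongrightarrow> f 1"
proof (rule tendstoI)
  fix e :: real assume e: "e > 0"
  have C: "C \<ge> 0" using order_trans[OF norm_ge_zero b[of 0]] .
  \<comment> \<open>Makes \<open>2 * C / R\<close> at most \<open>e / 4\<close>; the summand 1 keeps
    \<open>R\<close> positive when \<open>C = 0\<close>.\<close>
  define R where "R = 8 * (C + 1) / e"
  have R: "R > 0" using C e by (simp add: R_def)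
  have "2 * C / R \<le> e / 4" using C e by (simp add: R_def field_simps)
  then show "\<forall>\<^sub>F N in sequentially. dist (\<Sum>n=1..N. b n / of_nat n) (f 1) < e"
    using newman_bound[OF assms R, of "e/4"] e
    by (auto elim!: eventually_mono simp: dist_norm norm_minus_commute)
qed

section \<open>Chebyshev's upper bound\<close>

definition cheb :: "nat \<Rightarrow> real" where "cheb n = (\<Sum>k=1..n. mangoldt k)"

text \<open>Legendre's formula for the logarithm of the factorial: \<open>d\<close> has
  \<open>n div d\<close> multiples up to \<open>n\<close>.\<close>

lemma sum_ln_eq: "(\<Sum>k=1..n. ln (real k)) = (\<Sum>d=1..n. mangoldt d * real (n div d))"
proof -
  have "(\<Sum>k=1..n. ln (real k)) = (\<Sum>k=1..n. \<Sum>d=1..n. if d dvd k then mangoldt d else 0)"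
  proof (rule sum.cong)
    fix k assume k: "k \<in> {1..n}"
    have "ln (real k) = (\<Sum>d | d dvd k. mangoldt d)" using mangoldt_sum[of k, where 'a = real] k by simp
    also have "\<dots> = (\<Sum>d\<in>{d\<in>{1..n}. d dvd k}. mangoldt d)"
      using k by (intro sum.cong) (auto dest: dvd_imp_le intro: Suc_leI dvd_pos_nat)
    also have "\<dots> = (\<Sum>d=1..n. if d dvd k then mangoldt d else 0)"
      by (rule sum.inter_filter) simp
    finally show "ln (real k) = (\<Sum>d=1..n. if d dvd k then mangoldt d else 0)" .
  qed auto
  also have "\<dots> = (\<Sum>d=1..n. \<Sum>k=1..n. if d dvd k then mangoldt d else 0)" by (rule sum.swap)
  also have "\<dots> = (\<Sum>d=1..n. mangoldt d * real (n div d))"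
  proof (rule sum.cong)
    fix d assume d: "d \<in> {1..n}"
    have "(\<Sum>k=1..n. if d dvd k then mangoldt d else 0) = mangoldt d * real (card {k\<in>{1..n}. d dvd k})"
      by (simp add: sum.inter_filter[symmetric])
    also have "{k\<in>{1..n}. d dvd k} = (\<lambda>j. d * j) ` {1..n div d}"
    proof (intro equalityI subsetI)
      fix k assume k: "k \<in> {k\<in>{1..n}. d dvd k}"
      then obtain j where j: "k = d * j" by auto
      then have "j \<ge> 1" "j \<le> n div d" using k d by (auto simp: less_eq_div_iff_mult_less_eq mult.commute Suc_le_eq)
      then show "k \<in> (\<lambda>j. d * j) ` {1..n div d}" using j by auto
    next
      fix k assume "k \<in> (\<lambda>j. d * j) ` {1..n div d}"
      then obtain j where "k = d * j" "j \<in> {1..n div d}" by (elim imageE)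
      then show "k \<in> {k\<in>{1..n}. d dvd k}" using d
        by (auto simp: less_eq_div_iff_mult_less_eq mult.commute Suc_le_eq)
    qed
    also have "card \<dots> = n div d" using d by (subst card_image) (auto simp: inj_on_def)
    finally show "(\<Sum>k=1..n. if d dvd k then mangoldt d else 0) = mangoldt d * real (n div d)" .
  qed auto
  finally show ?thesis .
qed

text \<open>Compares \<open>ln\<close> of the central binomial coefficient, at most
  \<open>2 * m * ln 2\<close>, with its expansion by Legendre's formula. There
  \<open>mangoldt d\<close> carries the weight \<open>(2*m) div d - 2 * (m div d)\<close>, which is
  never negative and equals 1 for \<open>m < d \<le> 2*m\<close>.\<close>

lemma cheb_double: "cheb (2 * m) \<le> cheb m + 2 * real m"
proof -
  have "ln (fact (2 * m) :: real) = 2 * ln (fact m) + ln (real (2 * m choose m))"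
  proof -
    have "(fact (2 * m) :: real) = fact m * fact m * real (2 * m choose m)"
      using binomial_fact_lemma[of m "2 * m"] by (metis add_diff_cancel_right' le_add1 mult_2 of_nat_fact of_nat_mult)
    moreover have "real (2 * m choose m) > 0" by simp
    ultimately show ?thesis by (simp add: ln_mult)
  qed
  moreover have "ln (real (2 * m choose m)) \<le> 2 * real m"
  proof -
    have "real (2 * m choose m) \<le> real (2 ^ (2 * m))" using binomial_le_pow2[of "2 * m" m] by (intro of_nat_mono)
    then have "ln (real (2 * m choose m)) \<le> ln (real (2 ^ (2 * m)))" by (subst ln_le_cancel_iff) auto
    also have "\<dots> = 2 * real m * ln 2" by (simp add: ln_realpow)
    also have "\<dots> \<le> 2 * real m * 1" using ln_2_less_1 by (intro mult_left_mono) auto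
    finally show ?thesis by simp
  qed
  moreover have lnf: "ln (fact n :: real) = (\<Sum>k=1..n. ln (real k))" for n
    by (induction n) (simp_all add: ln_mult del: of_nat_Suc)
  ultimately have "(\<Sum>d=1..2*m. mangoldt d * real ((2*m) div d)) \<le> 2 * (\<Sum>d=1..m. mangoldt d * real (m div d)) + 2 * real m"
    unfolding lnf sum_ln_eq by linarith
  moreover have "(\<Sum>d=1..m. mangoldt d * real (m div d)) = (\<Sum>d=1..2*m. mangoldt d * real (m div d))"
    by (rule sum.mono_neutral_left) auto
  moreover have "(\<Sum>d=1..2*m. mangoldt d * (real ((2*m) div d) - 2 * real (m div d))) =
      (\<Sum>d=1..2*m. mangoldt d * real ((2*m) div d)) - 2 * (\<Sum>d=1..2*m. mangoldt d * real (m div d))"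
    by (simp add: right_diff_distrib sum_subtractf sum_distrib_left mult.left_commute)
  ultimately have "(\<Sum>d=1..2*m. mangoldt d * (real ((2*m) div d) - 2 * real (m div d))) \<le> 2 * real m"
    by linarith
  moreover have "(\<Sum>d=Suc m..2*m. mangoldt d) \<le> (\<Sum>d=1..2*m. mangoldt d * (real ((2*m) div d) - 2 * real (m div d)))"
  proof -
    have ge: "real ((2*m) div d) - 2 * real (m div d) \<ge> 0" for d
    proof -
      have "2 * (m div d) \<le> (2 * m) div d"
      proof (cases "d = 0")
        case False
        then show ?thesis by (simp add: less_eq_div_iff_mult_less_eq)
      qed auto
      then show ?thesis by linarith
    qed
    have "(\<Sum>d=Suc m..2*m. mangoldt d) = (\<Sum>d=Suc m..2*m. mangoldt d * (real ((2*m) div d) - 2 * real (m div d)))"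
    proof (rule sum.cong)
      fix d assume d: "d \<in> {Suc m..2*m}"
      then have "(2 * m) div d = 1" by (intro div_nat_eqI) auto
      moreover have "m div d = 0" using d by auto
      ultimately show "mangoldt d = mangoldt d * (real ((2*m) div d) - 2 * real (m div d))" by simp
    qed auto
    also have "\<dots> \<le> (\<Sum>d=1..2*m. mangoldt d * (real ((2*m) div d) - 2 * real (m div d)))"
      using ge mangoldt_nonneg by (intro sum_mono2) auto
    finally show ?thesis .
  qed
  moreover have "cheb (2 * m) = cheb m + (\<Sum>d=Suc m..2*m. mangoldt d)"
    unfolding cheb_def using sum.ub_add_nat[of 1 m mangoldt m] by (simp add: mult_2)
  ultimately show ?thesis by linarith
qed

lemma cheb_le: "cheb n \<le> 4 * real n"
proof (induction n rule: less_induct)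
  case (less n)
  show ?case
  proof (cases "n = 0")
    case False
    define m where "m = n div 2"
    have m: "m < n" using False by (simp add: m_def)
    show ?thesis
    proof (cases "even n")
      case True
      then have n: "n = 2 * m" by (simp add: m_def)
      show ?thesis using cheb_double[of m] less[OF m] unfolding n by simp
    next
      \<comment> \<open>The constant 4 leaves room for the extra term:
        \<open>4*m + 2*m + 2*m \<le> 4 * (2*m + 1)\<close>.\<close>
      case odd: False
      then have n: "n = Suc (2 * m)" by (simp add: m_def)
      have "mangoldt (Suc (2 * m)) \<le> ln (real (Suc (2 * m)))" by (rule mangoldt_le) simp
      also have "\<dots> \<le> 2 * real m" using ln_le_minus_one[of "real (Suc (2 * m))"] by simp
      finally show ?thesis using cheb_double[of m] less[OF m] unfolding n by (simp add: cheb_def)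
    qed
  qed (simp add: cheb_def)
qed

section \<open>From the Mangoldt function to primes\<close>

text \<open>If \<open>f n / n\<close> exceeds \<kappa> by \<epsilon>, monotonicity keeps
  \<open>f j / j\<close> above \<open>\<kappa> + \<epsilon>/2\<close> for \<open>j\<close> up to
  \<open>(1 + \<delta>) * n\<close>. That block contributes a fixed positive amount to the sum,
  against the Cauchy criterion. Values that are too small are excluded in the same way by a block to
  the left of \<open>n\<close>.\<close>

lemma mono_tauberian:
  fixes f :: "nat \<Rightarrow> real"
  assumes mono: "\<And>m n. m \<le> n \<Longrightarrow> f m \<le> f n" and nonneg: "\<And>n. f n \<ge> 0" and k: "\<kappa> > 0"
    and conv: "convergent (\<lambda>N. \<Sum>n=1..N. (f n / real n - \<kappa>) / real n)"
  shows "(\<lambda>n. f n / real n) \<longlonglongrightarrow> \<kappa>"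
proof (rule tendstoI)
  fix \<epsilon> :: real assume \<epsilon>: "\<epsilon> > 0"
  \<comment> \<open>Chosen so that \<open>\<delta> * (\<kappa> + \<epsilon>) = \<epsilon>/2\<close>:
    stretching \<open>n\<close> by \<open>1 + \<delta>\<close> uses up only half of the
    excess.\<close>
  define \<delta> where "\<delta> = \<epsilon> / (2 * (\<kappa> + \<epsilon>))"
  have \<delta>: "\<delta> > 0" "\<delta> < 1" "\<delta> * (\<kappa> + \<epsilon>) = \<epsilon> / 2" using \<epsilon> k by (auto simp: \<delta>_def field_simps)
  have \<delta>2: "\<delta> \<le> 1/2" using \<epsilon> k by (auto simp: \<delta>_def field_simps)
  define g where "g = (\<lambda>n. (f n / real n - \<kappa>) / real n)"
  define P where "P = (\<lambda>N. \<Sum>n=1..N. g n)"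
  \<comment> \<open>A block has at least \<open>\<delta> * n / 2\<close> members, half of the ideal
    length being reserved for rounding, and each contributes at least
    \<open>\<epsilon> / 2 / ((1 + \<delta>) * n)\<close>.\<close>
  define \<eta> where "\<eta> = \<epsilon> * \<delta> / (4 * (1 + \<delta>))"
  have \<eta>: "\<eta> > 0" using \<epsilon> \<delta> by (simp add: \<eta>_def)
  have "Cauchy P" using conv unfolding P_def g_def by (simp add: convergent_Cauchy)
  then obtain N0 where N0: "\<And>m n. m \<ge> N0 \<Longrightarrow> n \<ge> N0 \<Longrightarrow> \<bar>P m - P n\<bar> < \<eta>"
    using \<eta> unfolding Cauchy_def dist_real_def by blast
  have P_diff: "P m - P n = (\<Sum>j=Suc n..m. g j)" if nm: "n \<le> m" for m n
  proof -
    obtain d where "m = n + d" using le_Suc_ex[OF nm] by blast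
    then show ?thesis unfolding P_def using sum.ub_add_nat[of 1 n g d] by simp
  qed
  have upper: "f n / real n < \<kappa> + \<epsilon>" if n: "n \<ge> N0" "real n \<ge> 2 / \<delta>" for n
  proof (rule ccontr)
    assume "\<not> f n / real n < \<kappa> + \<epsilon>"
    moreover have n0: "real n > 0" by (rule less_le_trans[OF divide_pos_pos n(2)]) (use \<delta>(1) in auto)
    ultimately have fn: "f n \<ge> (\<kappa> + \<epsilon>) * real n" by (simp add: not_less field_simps)
    define m where "m = nat \<lfloor>(1 + \<delta>) * real n\<rfloor>"
    have m: "real m \<le> (1 + \<delta>) * real n" "(1 + \<delta>) * real n < real m + 1"
    proof -
      have "0 \<le> \<lfloor>(1 + \<delta>) * real n\<rfloor>" using \<delta>(1) n0 by simp
      then have "real m = of_int \<lfloor>(1 + \<delta>) * real n\<rfloor>" by (simp add: m_def)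
      then show "real m \<le> (1 + \<delta>) * real n" "(1 + \<delta>) * real n < real m + 1"
        using floor_correct[of "(1 + \<delta>) * real n"] by simp_all
    qed
    have dn: "\<delta> * real n \<ge> 2" using n(2) \<delta>(1) by (simp add: field_simps)
    have "(1 + \<delta>) * real n = real n + \<delta> * real n" by (simp add: distrib_right)
    then have mn_ge: "real m - real n \<ge> \<delta> * real n / 2" using m(2) dn by linarith
    then have nm: "n \<le> m" using dn by linarith
    have ge: "g j \<ge> \<epsilon> / 2 / ((1 + \<delta>) * real n)" if j: "j \<in> {Suc n..m}" for j
    proof -
      have j': "real j > 0" "real j \<le> (1 + \<delta>) * real n" using j m(1) by auto
      have "(\<kappa> + \<epsilon>/2) * (1 + \<delta>) = \<kappa> + \<epsilon>/2 + \<delta> * (\<kappa> + \<epsilon>) - \<delta> * \<epsilon> / 2" by (simp add: algebra_simps)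
      also have "\<dots> \<le> \<kappa> + \<epsilon>" using \<delta>(3) mult_nonneg_nonneg[of \<delta> \<epsilon>] \<delta>(1) \<epsilon> by linarith
      finally have "(\<kappa> + \<epsilon>/2) * (1 + \<delta>) * real n \<le> (\<kappa> + \<epsilon>) * real n" using n0 by (intro mult_right_mono) auto
      moreover have "(\<kappa> + \<epsilon>/2) * real j \<le> (\<kappa> + \<epsilon>/2) * ((1 + \<delta>) * real n)" using j' k \<epsilon> by (intro mult_left_mono) auto
      moreover have "f j \<ge> f n" using j by (intro mono) auto
      ultimately have "(\<kappa> + \<epsilon>/2) * real j \<le> f j" using fn by (simp add: mult.assoc)
      then have "f j / real j - \<kappa> \<ge> \<epsilon> / 2" using j' by (simp add: field_simps)
      then show ?thesis unfolding g_def using j' \<epsilon> by (intro frac_le) linarith+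
    qed
    have "e * d / (4 * c) = (d * x / 2) * (e / 2 / (c * x))" if "x \<noteq> 0" "c \<noteq> 0" for e d c x :: real
      using that by (simp add: field_simps)
    then have "\<eta> = (\<delta> * real n / 2) * (\<epsilon> / 2 / ((1 + \<delta>) * real n))" using n0 \<delta>(1) unfolding \<eta>_def by simp
    also have "\<dots> \<le> real (m - n) * (\<epsilon> / 2 / ((1 + \<delta>) * real n))"
      using mn_ge nm \<epsilon> \<delta>(1) by (intro mult_right_mono) (auto simp: of_nat_diff)
    also have "\<dots> = (\<Sum>j=Suc n..m. \<epsilon> / 2 / ((1 + \<delta>) * real n))" by simp
    also have "\<dots> \<le> P m - P n" unfolding P_diff[OF nm] by (intro sum_mono ge)
    finally show False using N0[of m n] n nm by simp
  qed
  \<comment> \<open>The left block starts no earlier than \<open>n / 2\<close>, since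
    \<open>\<delta> \<le> 1/2\<close>; hence the doubled threshold.\<close>
  have lower: "f n / real n > \<kappa> - \<epsilon>" if n: "n \<ge> 2 * N0 + 2" "real n \<ge> 2 / \<delta>" for n
  proof (rule ccontr)
    assume *: "\<not> f n / real n > \<kappa> - \<epsilon>"
    have n0: "real n > 0" using n(1) by simp
    have fn: "f n \<le> (\<kappa> - \<epsilon>) * real n" using * n0 by (simp add: not_less field_simps)
    have ke: "\<kappa> - \<epsilon> \<ge> 0" using order_trans[OF nonneg fn] n0 by (simp add: zero_le_mult_iff)
    define m where "m = nat \<lceil>(1 - \<delta>) * real n\<rceil>"
    have pos: "(1 - \<delta>) * real n \<ge> 0" using \<delta>2 n0 by simp
    have m: "real m \<ge> (1 - \<delta>) * real n" "real m < (1 - \<delta>) * real n + 1"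
    proof -
      have "0 \<le> \<lceil>(1 - \<delta>) * real n\<rceil>" using pos by simp
      then have "real m = of_int \<lceil>(1 - \<delta>) * real n\<rceil>" by (simp add: m_def)
      then show "real m \<ge> (1 - \<delta>) * real n" "real m < (1 - \<delta>) * real n + 1"
        using ceiling_correct[of "(1 - \<delta>) * real n"] by simp_all
    qed
    have dn: "\<delta> * real n \<ge> 2" using n(2) \<delta>(1) by (simp add: field_simps)
    have "(1 - \<delta>) * real n = real n - \<delta> * real n" by (simp add: left_diff_distrib)
    then have mn_ge: "real n - real m \<ge> \<delta> * real n / 2" using m(2) dn by linarith
    then have mn: "m \<le> n" using dn by linarith
    have "1 / 2 * real n \<le> (1 - \<delta>) * real n" using \<delta>2 by (intro mult_right_mono) auto
    then have "real m \<ge> real N0" using m(1) n(1) by linarith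
    then have mN0: "m \<ge> N0" by simp
    have le: "g j \<le> - (\<epsilon> / 2 / real n)" if j: "j \<in> {Suc m..n}" for j
    proof -
      have j': "real j > 0" "real j \<ge> (1 - \<delta>) * real n" "real j \<le> real n" using j m(1) by auto
      have "\<delta> * (\<kappa> - \<epsilon>/2) \<le> \<delta> * (\<kappa> + \<epsilon>)" using \<delta> \<epsilon> by (intro mult_left_mono) auto
      moreover have "(\<kappa> - \<epsilon>/2) * (1 - \<delta>) = \<kappa> - \<epsilon>/2 - \<delta> * (\<kappa> - \<epsilon>/2)"
        by (simp add: field_simps)
      ultimately have "(\<kappa> - \<epsilon>/2) * (1 - \<delta>) \<ge> \<kappa> - \<epsilon>" using \<delta>(3) by linarith
      then have "(\<kappa> - \<epsilon>/2) * (1 - \<delta>) * real n \<ge> (\<kappa> - \<epsilon>) * real n" using n0 by (intro mult_right_mono) auto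
      moreover have "(\<kappa> - \<epsilon>/2) * real j \<ge> (\<kappa> - \<epsilon>/2) * ((1 - \<delta>) * real n)" using j' ke \<epsilon> by (intro mult_left_mono) auto
      moreover have "f j \<le> f n" using j by (intro mono) auto
      ultimately have "f j \<le> (\<kappa> - \<epsilon>/2) * real j" using fn by (simp add: mult.assoc)
      then have "f j / real j - \<kappa> \<le> - (\<epsilon> / 2)" using j' by (simp add: field_simps)
      then have "g j \<le> - (\<epsilon> / 2) / real j" unfolding g_def using j' by (intro divide_right_mono) auto
      also have "\<dots> \<le> - (\<epsilon> / 2 / real n)" using j' \<epsilon> by (simp add: frac_le)
      finally show ?thesis .
    qed
    have "\<eta> \<le> \<epsilon> * \<delta> / 4" unfolding \<eta>_def using \<epsilon> \<delta> by (intro divide_left_mono) auto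
    also have "\<dots> = (\<delta> * real n / 2) * (\<epsilon> / 2 / real n)" using n0 by (simp add: field_simps)
    also have "\<dots> \<le> real (n - m) * (\<epsilon> / 2 / real n)"
      using mn_ge mn \<epsilon> by (intro mult_right_mono) (auto simp: of_nat_diff)
    finally have "\<eta> \<le> - (\<Sum>j=Suc m..n. - (\<epsilon> / 2 / real n))" by simp
    also have "\<dots> \<le> - (P n - P m)" unfolding P_diff[OF mn] using sum_mono[of "{Suc m..n}" g, OF le] by linarith
    finally show False using N0[of n m] n(1) mN0 by simp
  qed
  have "\<forall>\<^sub>F n in sequentially. n \<ge> 2 * N0 + 2 \<and> real n \<ge> 2 / \<delta>"
    by (intro eventually_conj eventually_ge_at_top eventually_compose_filterlim[OF eventually_ge_at_top filterlim_real_sequentially])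
  then show "\<forall>\<^sub>F n in sequentially. dist (f n / real n) \<kappa> < \<epsilon>"
  proof eventually_elim
    case (elim n)
    then show ?case using upper[of n] lower[of n] by (auto simp: dist_real_def abs_less_iff)
  qed
qed

section \<open>From the weighted sum to the number of primes in a class\<close>

definition class_primes :: "nat \<Rightarrow> nat \<Rightarrow> nat \<Rightarrow> nat set" where
  "class_primes q c n = {p. prime p \<and> p \<le> n \<and> [p = c] (mod q)}"

definition class_theta :: "nat \<Rightarrow> nat \<Rightarrow> nat \<Rightarrow> real" where
  "class_theta q c n = (\<Sum>p\<in>class_primes q c n. ln (real p))"

lemma finite_class_primes [simp]: "finite (class_primes q c n)"
  by (rule finite_subset[of _ "{..n}"]) (auto simp: class_primes_def)

text \<open>A proper power \<open>p ^ j \<le> n\<close> has \<open>j \<ge> 2\<close>, which leaves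
  at most \<open>sqrt n\<close> bases and \<open>log 2 n\<close> exponents.\<close>

lemma card_proper_prime_powers:
  "real (card {k\<in>{1..n}. primepow k \<and> \<not> prime k}) \<le> sqrt (real n) * log 2 (real n)"
proof (cases "n = 0")
  case False
  let ?A = "{1..nat \<lfloor>sqrt (real n)\<rfloor>}" and ?B = "{1..nat \<lfloor>log 2 (real n)\<rfloor>}"
  have "{k\<in>{1..n}. primepow k \<and> \<not> prime k} \<subseteq> (\<lambda>(p, j). p ^ j) ` (?A \<times> ?B)"
  proof
    fix k assume k: "k \<in> {k\<in>{1..n}. primepow k \<and> \<not> prime k}"
    then obtain p j where pj: "prime p" "j > 0" "k = p ^ j" by (auto simp: primepow_def)
    then have "j \<noteq> 1" using k by auto
    then have j: "j \<ge> 2" using pj by simp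
    have p2: "p \<ge> 2" using pj prime_ge_2_nat by blast
    have "p ^ 2 \<le> p ^ j" using j p2 by (intro power_increasing) auto
    then have "real p ^ 2 \<le> real n" using k pj by (auto simp flip: of_nat_power)
    then have "real p \<le> sqrt (real n)" by (rule real_le_rsqrt)
    then have "p \<in> ?A" using p2 by (auto simp: le_nat_floor)
    moreover have "2 ^ j \<le> p ^ j" using p2 by (intro power_mono) auto
    then have "2 ^ j \<le> n" by (rule order_trans) (use k pj in auto)
    then have "2 powr real j \<le> real n" by (simp add: powr_realpow)
    then have "real j \<le> log 2 (real n)" using False by (simp add: le_log_iff)
    then have "j \<in> ?B" using j by (auto simp: le_nat_floor)
    ultimately show "k \<in> (\<lambda>(p, j). p ^ j) ` (?A \<times> ?B)" using pj(3) by force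
  qed
  then have "card {k\<in>{1..n}. primepow k \<and> \<not> prime k} \<le> card (?A \<times> ?B)"
    by (intro surj_card_le) auto
  then have "real (card {k\<in>{1..n}. primepow k \<and> \<not> prime k}) \<le> real (card (?A \<times> ?B))" by (rule of_nat_mono)
  also have "\<dots> = real (nat \<lfloor>sqrt (real n)\<rfloor>) * real (nat \<lfloor>log 2 (real n)\<rfloor>)"
    by (simp only: card_cartesian_product card_atLeastAtMost of_nat_mult) simp
  also have "\<dots> \<le> sqrt (real n) * log 2 (real n)"
    using False by (intro mult_mono of_nat_floor) auto
  finally show ?thesis .
qed auto

lemma class_psi_theta:
  fixes q c n :: nat
  defines "\<psi> \<equiv> (\<Sum>k=1..n. of_bool [k = c] (mod q) * mangoldt k :: real)"
  shows "class_theta q c n \<le> \<psi>" "\<psi> \<le> class_theta q c n + sqrt (real n) * log 2 (real n) * ln (real n)"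
proof -
  let ?t = "\<lambda>k. of_bool [k = c] (mod q) * mangoldt k :: real"
  let ?Q = "{k\<in>{1..n}. primepow k \<and> \<not> prime k}"
  have sub: "class_primes q c n \<subseteq> {1..n}" by (auto simp: class_primes_def Suc_le_eq prime_gt_0_nat)
  have th: "class_theta q c n = sum ?t (class_primes q c n)"
    unfolding class_theta_def by (intro sum.cong) (auto simp: class_primes_def)
  then show "class_theta q c n \<le> \<psi>"
    unfolding \<psi>_def using sub mangoldt_nonneg by (auto intro!: sum_mono2)
  have "\<psi> = sum ?t (class_primes q c n) + sum ?t ({1..n} - class_primes q c n)"
    unfolding \<psi>_def by (subst sum.subset_diff[OF sub]) auto
  also have "sum ?t ({1..n} - class_primes q c n) \<le> (\<Sum>k\<in>{1..n}. if primepow k \<and> \<not> prime k then ln (real n) else 0)"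
  proof (rule sum_le_included[where i = id])
    show "\<forall>k\<in>{1..n} - class_primes q c n. \<exists>j\<in>{1..n}. id j = k \<and> ?t k \<le> (if primepow j \<and> \<not> prime j then ln (real n) else 0)"
    proof
      fix k assume k: "k \<in> {1..n} - class_primes q c n"
      have "?t k \<le> (if primepow k \<and> \<not> prime k then ln (real n) else 0)"
      proof (cases "primepow k \<and> \<not> prime k")
        case True
        have "mangoldt k \<le> ln (real k)" using k by (intro mangoldt_le) auto
        also have "\<dots> \<le> ln (real n)" using k by auto
        finally show ?thesis using True k mangoldt_nonneg[of k] by (auto simp: of_bool_def)
      next
        case False
        then show ?thesis using k by (auto simp: class_primes_def mangoldt_def)
      qed
      then show "\<exists>j\<in>{1..n}. id j = k \<and> ?t k \<le> (if primepow j \<and> \<not> prime j then ln (real n) else 0)"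
        using k by (intro bexI[of _ k]) auto
    qed
  qed auto
  also have "(\<Sum>k\<in>{1..n}. if primepow k \<and> \<not> prime k then ln (real n) else 0) = real (card ?Q) * ln (real n)"
    by (simp add: sum.inter_filter[symmetric])
  also have "\<dots> \<le> sqrt (real n) * log 2 (real n) * ln (real n)"
    by (intro mult_right_mono card_proper_prime_powers) (cases "n = 0", auto)
  finally show "\<psi> \<le> class_theta q c n + sqrt (real n) * log 2 (real n) * ln (real n)" using th by simp
qed

lemma class_primes_asymp:
  assumes psi: "(\<lambda>n. (\<Sum>k=1..n. of_bool [k = c] (mod q) * mangoldt k) / real n) \<longlonglongrightarrow> \<kappa>"
  shows "(\<lambda>n. real (card (class_primes q c n)) * ln (real n) / real n) \<longlonglongrightarrow> \<kappa>"
proof -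
  let ?psi = "\<lambda>n. (\<Sum>k=1..n. of_bool [k = c] (mod q) * mangoldt k) / real n"
  let ?th = "\<lambda>n. class_theta q c n / real n"
  have th: "?th \<longlonglongrightarrow> \<kappa>"
  proof (rule tendsto_sandwich[OF _ _ _ psi])
    have "(\<lambda>n. sqrt (real n) * log 2 (real n) * ln (real n) / real n) \<longlonglongrightarrow> 0" by real_asymp
    from tendsto_diff[OF psi this] show "(\<lambda>n. ?psi n - sqrt (real n) * log 2 (real n) * ln (real n) / real n) \<longlonglongrightarrow> \<kappa>" by simp
    show "\<forall>\<^sub>F n in sequentially. ?psi n - sqrt (real n) * log 2 (real n) * ln (real n) / real n \<le> ?th n"
    proof (rule always_eventually, rule allI)
      fix n
      have "((\<Sum>k=1..n. of_bool [k = c] (mod q) * mangoldt k) - sqrt (real n) * log 2 (real n) * ln (real n)) / real n \<le> class_theta q c n / real n"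
        using class_psi_theta(2)[where q = q and c = c and n = n] by (intro divide_right_mono) auto
      then show "?psi n - sqrt (real n) * log 2 (real n) * ln (real n) / real n \<le> ?th n" by (simp only: diff_divide_distrib)
    qed
    show "\<forall>\<^sub>F n in sequentially. ?th n \<le> ?psi n"
      by (intro always_eventually allI divide_right_mono class_psi_theta) auto
  qed
  show ?thesis
  proof (rule tendsto_sandwich[OF _ _ th])
    show "\<forall>\<^sub>F n in sequentially. ?th n \<le> real (card (class_primes q c n)) * ln (real n) / real n"
    proof (intro always_eventually allI divide_right_mono)
      fix n
      have "class_theta q c n \<le> (\<Sum>p\<in>class_primes q c n. ln (real n))"
        unfolding class_theta_def
      proof (rule sum_mono)
        fix p assume "p \<in> class_primes q c n"
        then have "0 < p" "p \<le> n" by (auto simp: class_primes_def prime_gt_0_nat)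
        then show "ln (real p) \<le> ln (real n)" by simp
      qed
      then show "class_theta q c n \<le> real (card (class_primes q c n)) * ln (real n)" by simp
    qed auto
    \<comment> \<open>The cut is low enough that all integers below it are negligible against
      \<open>n / ln n\<close>, and high enough that \<open>ln\<close> of it is asymptotic to
      \<open>ln n\<close>, so that primes above it have nearly full weight.\<close>
    let ?y = "\<lambda>n. real n / ln (real n) ^ 2"
    let ?u = "\<lambda>n. 1 / ln (real n) + ?th n * (ln (real n) / ln (?y n))"
    have "(\<lambda>n. ln (real n) / ln (?y n)) \<longlonglongrightarrow> 1" by real_asymp
    moreover have "(\<lambda>n. 1 / ln (real n)) \<longlonglongrightarrow> 0" by real_asymp
    ultimately have "?u \<longlonglongrightarrow> 0 + \<kappa> * 1" by (intro tendsto_add tendsto_mult th)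
    then show "?u \<longlonglongrightarrow> \<kappa>" by simp
    have ev: "\<forall>\<^sub>F n in sequentially. ?y n > 1" "\<forall>\<^sub>F n in sequentially. ln (real n) > 0" "\<forall>\<^sub>F n in sequentially. real n > 0"
      by real_asymp+
    show "\<forall>\<^sub>F n in sequentially. real (card (class_primes q c n)) * ln (real n) / real n \<le> ?u n"
      using ev
    proof eventually_elim
      case (elim n)
      define A where "A = {p \<in> class_primes q c n. real p \<le> ?y n}"
      define B where "B = {p \<in> class_primes q c n. real p > ?y n}"
      have AB: "class_primes q c n = A \<union> B" "A \<inter> B = {}" "finite A" "finite B" by (auto simp: A_def B_def)
      have "A \<subseteq> {1..nat \<lfloor>?y n\<rfloor>}" by (auto simp: A_def class_primes_def le_nat_floor Suc_le_eq prime_gt_0_nat)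
      then have "card A \<le> nat \<lfloor>?y n\<rfloor>" using card_mono[of "{1..nat \<lfloor>?y n\<rfloor>}" A] by simp
      then have "real (card A) \<le> real (nat \<lfloor>?y n\<rfloor>)" by (rule of_nat_mono)
      also have "\<dots> \<le> ?y n" by (rule of_nat_floor) (use elim(1) in linarith)
      finally have cA: "real (card A) \<le> ?y n" .
      have "real (card B) * ln (?y n) = (\<Sum>p\<in>B. ln (?y n))" by simp
      also have "\<dots> \<le> (\<Sum>p\<in>B. ln (real p))"
        using elim(1) by (intro sum_mono) (auto simp: B_def intro!: ln_mono)
      also have "\<dots> \<le> class_theta q c n" unfolding class_theta_def
        by (intro sum_mono2) (auto simp: B_def class_primes_def prime_gt_0_nat Suc_le_eq)
      finally have cB: "real (card B) \<le> class_theta q c n / ln (?y n)"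
        using elim(1) by (simp add: pos_le_divide_eq)
      have "real (card (class_primes q c n)) \<le> ?y n + class_theta q c n / ln (?y n)"
        unfolding AB(1) card_Un_disjoint[OF AB(3,4,2)] using cA cB by simp
      then have "real (card (class_primes q c n)) * ln (real n) / real n \<le> (?y n + class_theta q c n / ln (?y n)) * ln (real n) / real n"
        using elim by (intro divide_right_mono mult_right_mono) auto
      also have "\<dots> = ?y n * ln (real n) / real n + class_theta q c n / ln (?y n) * ln (real n) / real n"
        by (simp only: distrib_right add_divide_distrib)
      also have "?y n * ln (real n) / real n = 1 / ln (real n)"
        using elim(2,3) by (simp add: power2_eq_square)
      also have "class_theta q c n / ln (?y n) * ln (real n) / real n = ?th n * (ln (real n) / ln (?y n))" by simp
      finally show ?case .
    qed
  qed
qed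

section \<open>Primes in residue classes\<close>

lemma dseries_cmult:
  assumes "abs_conv c \<sigma>0" "Re s > \<sigma>0"
  shows "dseries (\<lambda>n. x * c n) s = x * dseries c s"
  using sums_mult[OF dseries_sums[OF assms], of x]
  by (simp add: dseries_def[of "\<lambda>n. x * c n"] sums_iff mult.assoc)

lemma class_mangoldt_asymp:
  assumes q: "q > 1" and c: "coprime c q"
  shows "(\<lambda>n. (\<Sum>k=1..n. of_bool [k = c] (mod q) * mangoldt k) / real n) \<longlonglongrightarrow> 1 / real (card (dirichlet_chars q))"
proof -
  define \<kappa> where "\<kappa> = 1 / real (card (dirichlet_chars q))"
  have "(\<lambda>n. of_bool (coprime n q)) \<in> dirichlet_chars q"
    using dirichlet_char_principal[of q] q by (simp add: dirichlet_chars_def)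
  then have "card (dirichlet_chars q) \<noteq> 0" using finite_dirichlet_chars[of q] q by (auto simp: card_eq_0_iff)
  then have \<kappa>: "\<kappa> > 0" by (simp add: \<kappa>_def)
  define a where "a = (\<lambda>k. of_bool [k = c] (mod q) * mangoldt k :: real)"
  define psi where "psi = (\<lambda>n. \<Sum>k=1..n. a k)"
  have a0: "a k \<ge> 0" "a k \<le> mangoldt k" for k using mangoldt_nonneg[of k] by (auto simp: a_def)
  have psi0: "psi n \<ge> 0" for n unfolding psi_def by (intro sum_nonneg a0)
  have psi_le: "psi n \<le> 4 * real n" for n
  proof -
    have "psi n \<le> cheb n" unfolding psi_def cheb_def by (intro sum_mono a0)
    then show ?thesis using cheb_le[of n] by linarith
  qed
  obtain W R where W: "open W" "{s. Re s \<ge> 1} \<subseteq> W" and R: "R holomorphic_on W"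
    and R_eq: "\<And>s. Re s > 1 \<Longrightarrow> dseries (\<lambda>n. of_real (of_bool [n = c] (mod q) * mangoldt n)) s =
       1 / of_nat (card (dirichlet_chars q)) / (s - 1) + R s"
    by (rule mangoldt_class_continuation[OF q c]) (rule that)
  obtain H0 where H0: "H0 holomorphic_on {s. Re s > 0}" "\<And>s. Re s > 1 \<Longrightarrow> dseries (\<lambda>_. 1) s = 1 / (s - 1) + H0 s"
    by (rule zeta_continuation) (rule that)
  \<comment> \<open>Subtracting \<kappa> from the coefficients cancels the pole of the class series
    against that of the zeta series.\<close>
  define d where "d = (\<lambda>n. complex_of_real (a n) + (- of_real \<kappa>) * 1)"
  define A where "A = (\<lambda>n. \<Sum>k=1..n. d k)"
  have A_eq: "A n = of_real (psi n - \<kappa> * real n)" for n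
    by (simp add: A_def d_def psi_def sum_subtractf mult.commute)
  have A_le: "norm (A n) \<le> (4 + \<kappa>) * real n" for n
  proof -
    have "\<kappa> * real n \<ge> 0" using \<kappa> by simp
    then have "\<bar>psi n - \<kappa> * real n\<bar> \<le> 4 * real n + \<kappa> * real n" using psi0[of n] psi_le[of n] by linarith
    then show ?thesis unfolding A_eq norm_of_real by (simp only: distrib_right)
  qed
  have ac1: "abs_conv (\<lambda>n. of_real (a n)) 1"
  proof (rule abs_conv_le[OF abs_conv_ln])
    fix n :: nat
    show "norm (complex_of_real (a n)) \<le> 1 * norm (complex_of_real (ln (real n)))"
    proof (cases "n = 0")
      case False
      then have "mangoldt n \<le> ln (real n)" by (intro mangoldt_le) auto
      then show ?thesis using a0[of n] by simp
    qed (simp add: a_def)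
  qed
  have ac2: "abs_conv (\<lambda>n. (- of_real \<kappa>) * 1) 1"
    by (rule abs_conv_bounded) (rule order_refl)
  have ac: "abs_conv d 1" unfolding d_def by (rule abs_conv_add[OF ac1 ac2])
  have d_eq: "dseries d s = R s - of_real \<kappa> * H0 s" if s: "Re s > 1" for s
  proof -
    have "dseries d s = dseries (\<lambda>n. of_real (a n)) s + (- of_real \<kappa>) * dseries (\<lambda>_. 1) s"
      unfolding d_def by (simp only: dseries_add[OF ac1 ac2 s] dseries_cmult[OF abs_conv_const s])
    also have "dseries (\<lambda>n. of_real (a n)) s = of_real \<kappa> / (s - 1) + R s"
      unfolding a_def using R_eq[OF s] by (simp add: \<kappa>_def)
    also have "\<dots> + (- of_real \<kappa>) * dseries (\<lambda>_. 1) s = R s - of_real \<kappa> * H0 s"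
      unfolding H0(2)[OF s] by (simp add: distrib_left)
    finally show ?thesis .
  qed
  define E where "E = (\<lambda>s. \<Sum>n. A n * powr_diff_rem n s)"
  have E: "E holomorphic_on {s. Re s > 0}" unfolding E_def by (rule powr_diff_rem_series_holomorphic[OF A_le])
  \<comment> \<open>For positive \<open>n\<close> this is \<open>psi n / n - \<kappa>\<close>,
    bounded by Chebyshev's estimate. Summation by parts expresses its series through continued
    functions after division by \<open>s\<close>, which has no zero on the domain used.\<close>
  define b where "b = (\<lambda>n. A n / of_nat n)"
  define f where "f = (\<lambda>s. (R s - of_real \<kappa> * H0 s - E s) / s)"
  have "(\<lambda>N. \<Sum>n=1..N. b n / of_nat n) \<longlonglongrightarrow> f 1"
  proof (rule newman_tauberian)
    show "norm (b n) \<le> 4 + \<kappa>" for n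
      using A_le[of n] \<kappa> by (cases "n = 0") (auto simp: b_def norm_divide pos_divide_le_eq)
    show "open (W \<inter> {s. Re s > 0})" by (intro open_Int W open_Re_gt)
    show "{s. Re s \<ge> 1} \<subseteq> W \<inter> {s. Re s > 0}" using W(2) by auto
    show "f holomorphic_on (W \<inter> {s. Re s > 0})" unfolding f_def
      by (intro holomorphic_intros holomorphic_on_subset[OF R] holomorphic_on_subset[OF H0(1)] holomorphic_on_subset[OF E]) auto
    fix s :: complex assume s: "Re s > 1"
    then have s0: "s \<noteq> 0" by auto
    have "dseries d s = s * dseries b s + E s"
      unfolding b_def E_def A_def using A_le unfolding A_def by (rule dseries_by_parts[OF ac _ s])
    then have "s * dseries b s = R s - of_real \<kappa> * H0 s - E s" using d_eq[OF s] by (simp add: algebra_simps)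
    then show "dseries b s = f s" using s0 by (simp add: f_def eq_divide_eq mult.commute)
  qed
  moreover have "b n / of_nat n = of_real ((psi n / real n - \<kappa>) / real n)" for n
    by (cases "n = 0") (simp_all add: b_def A_eq diff_divide_distrib)
  ultimately have "(\<lambda>N. \<Sum>n=1..N. complex_of_real ((psi n / real n - \<kappa>) / real n)) \<longlonglongrightarrow> f 1" by simp
  from tendsto_Re[OF this] have "(\<lambda>N. \<Sum>n=1..N. (psi n / real n - \<kappa>) / real n) \<longlonglongrightarrow> Re (f 1)" by simp
  then have conv: "convergent (\<lambda>N. \<Sum>n=1..N. (psi n / real n - \<kappa>) / real n)" unfolding convergent_def by blast
  have "(\<lambda>n. psi n / real n) \<longlonglongrightarrow> \<kappa>"
  proof (rule mono_tauberian[OF _ psi0 \<kappa> conv])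
    show "psi m \<le> psi n" if "m \<le> n" for m n
      unfolding psi_def using that by (intro sum_mono2) (auto intro: a0)
  qed
  then show ?thesis by (simp only: psi_def a_def \<kappa>_def)
qed

section \<open>Representations and Frobenius numbers\<close>

text \<open>The admissible second coordinates are \<open>y0 + a * j\<close>, and the condition that
  the first one be nonnegative cuts out an initial segment \<open>J\<close> of indices. An initial
  segment has more than \<open>l\<close> elements iff it contains \<open>l\<close>.\<close>

lemma num_reps_ge_iff:
  assumes a: "a > 0" and b: "b > 0" and cop: "coprime a b" and y0: "y0 < a"
    and n: "[n = int b * int y0] (mod int a)"
  shows "l + 1 \<le> num_reps a b n \<longleftrightarrow> int b * (int y0 + int a * int l) \<le> n"
proof -
  define J where "J = {j::nat. int b * (int y0 + int a * int j) \<le> n}"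
  obtain k where k: "n = int b * int y0 + int a * k" using cong_sym[OF n] unfolding cong_iff_lin by blast
  define h where "h = (\<lambda>j::nat. (nat (k - int b * int j), y0 + a * j))"
  have J_iff: "j \<in> J \<longleftrightarrow> int b * int j \<le> k" for j
  proof -
    have "j \<in> J \<longleftrightarrow> int a * (int b * int j) \<le> int a * k"
      by (simp add: J_def k algebra_simps)
    then show ?thesis using a by simp
  qed
  have sol: "{(x::nat, y::nat). n = int a * int x + int b * int y} = h ` J"
  proof (intro equalityI subsetI)
    fix z assume "z \<in> {(x::nat, y::nat). n = int a * int x + int b * int y}"
    then obtain x y where z: "z = (x, y)" "n = int a * int x + int b * int y" by blast
    have eq: "int b * (int y - int y0) = int a * (k - int x)" using z(2) k by (simp add: algebra_simps)
    then have "int a dvd int b * (int y - int y0)" by simp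
    then have "int a dvd int y - int y0"
      using cop coprime_dvd_mult_right_iff[of "int a" "int b" "int y - int y0"] by simp
    then obtain j where j: "int y - int y0 = int a * j" by (auto elim: dvdE)
    have "j \<ge> 0"
    proof (rule ccontr)
      assume "\<not> j \<ge> 0"
      then have "int a * j \<le> int a * (-1)" using a by (intro mult_left_mono) auto
      then show False using j y0 by linarith
    qed
    then obtain j' where j': "j = int j'" using nonneg_int_cases by blast
    have "int a * (int b * int j') = int a * (k - int x)" using eq j j' by (simp add: mult_ac)
    then have x: "int b * int j' = k - int x" using a by simp
    have "int y = int (y0 + a * j')" using j j' by simp
    then have "y = y0 + a * j'" by (simp only: of_nat_eq_iff)
    then have "z = h j'" using z(1) x by (simp add: h_def)
    moreover have "j' \<in> J" using x by (simp add: J_iff)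
    ultimately show "z \<in> h ` J" by blast
  next
    fix z assume "z \<in> h ` J"
    then obtain j where "j \<in> J" "z = h j" by blast
    then show "z \<in> {(x::nat, y::nat). n = int a * int x + int b * int y}"
      using J_iff[of j] by (auto simp: h_def k algebra_simps)
  qed
  have inj: "inj_on h J" using a by (auto simp: inj_on_def h_def)
  have num: "num_reps a b n = card J"
    unfolding num_reps_def sol by (rule card_image[OF inj])
  have down: "i \<in> J" if "j \<in> J" "i \<le> j" for i j
  proof -
    have "int b * int i \<le> int b * int j" using that(2) by (intro mult_left_mono) auto
    then show ?thesis using that(1) unfolding J_iff by linarith
  qed
  have fin: "finite J"
  proof (rule finite_subset)
    show "J \<subseteq> {..nat k}"
    proof
      fix j assume "j \<in> J"
      then have "int b * int j \<le> k" by (simp add: J_iff)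
      moreover have "1 * int j \<le> int b * int j" using b by (intro mult_right_mono) auto
      ultimately show "j \<in> {..nat k}" by simp
    qed
  qed auto
  have "l + 1 \<le> card J \<longleftrightarrow> l \<in> J"
  proof
    assume "l \<in> J"
    then have "{..l} \<subseteq> J" using down by blast
    then have "card {..l} \<le> card J" by (rule card_mono[OF fin])
    then show "l + 1 \<le> card J" by simp
  next
    assume *: "l + 1 \<le> card J"
    show "l \<in> J"
    proof (rule ccontr)
      assume "l \<notin> J"
      have "J \<subseteq> {..<l}"
      proof
        fix j assume "j \<in> J"
        then show "j \<in> {..<l}" using down[of j l] \<open>l \<notin> J\<close> by (cases "l \<le> j") auto
      qed
      then have "card J \<le> card {..<l}" by (intro card_mono) auto
      then show False using * by simp
    qed
  qed
  then show ?thesis unfolding num by (simp add: J_def)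
qed

lemma ex_residue:
  assumes a: "a > 0" and cop: "coprime a b"
  obtains y0 where "y0 < a" "[n = int b * int y0] (mod int a)"
proof -
  obtain x where x: "[int b * x = 1] (mod int a)"
    using cong_solve_coprime_int[of "int b" "int a"] cop by (auto simp: coprime_commute)
  define y where "y = (x * n) mod int a"
  have y: "0 \<le> y" "y < int a" using a by (auto simp: y_def)
  have "[int b * y = int b * (x * n)] (mod int a)" unfolding y_def by (simp add: cong_def mod_mult_right_eq)
  moreover have "[int b * (x * n) = n] (mod int a)"
    using cong_scalar_right[OF x, of n] by (simp add: mult.assoc)
  ultimately have "[int b * y = n] (mod int a)" by (rule cong_trans)
  then have "[n = int b * int (nat y)] (mod int a)" using y cong_sym by simp
  then show thesis using y by (intro that[of "nat y"]) auto
qed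

text \<open>The class of \<open>y0 = a - 1\<close> has the largest threshold, \<open>?g + a\<close>,
  and \<open>?g\<close> is the last member of that class below it.\<close>

lemma frobenius_eq:
  assumes a: "a > 0" and ab: "a < b" and cop: "coprime a b"
  shows "frobenius l a b = (int l + 1) * int a * int b - int a - int b"
  unfolding frobenius_def
proof (rule Greatest_equality)
  let ?g = "(int l + 1) * int a * int b - int a - int b"
  have b: "b > 0" using ab by simp
  have a1: "int (a - 1) = int a - 1" using a by simp
  have g_cong: "[?g = int b * int (a - 1)] (mod int a)"
  proof -
    have "?g - int b * int (a - 1) = int a * (int l * int b - 1)" unfolding a1 by (simp add: algebra_simps)
    then show ?thesis by (simp add: cong_iff_dvd_diff)
  qed
  have thr: "int b * (int (a - 1) + int a * int l) = ?g + int a" unfolding a1 by (simp add: algebra_simps)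
  show "num_reps a b ?g \<le> l"
    using num_reps_ge_iff[OF a b cop _ g_cong, of l] a unfolding thr by linarith
  fix n assume n: "num_reps a b n \<le> l"
  show "n \<le> ?g"
  proof (rule ccontr)
    assume "\<not> n \<le> ?g"
    then have gt: "n > ?g" by simp
    obtain y0 where y0: "y0 < a" "[n = int b * int y0] (mod int a)" using ex_residue[OF a cop] by blast
    have "n < int b * (int y0 + int a * int l)"
      using num_reps_ge_iff[OF a b cop y0, of l] n by linarith
    moreover have "int b * (int y0 + int a * int l) \<le> n"
    proof (cases "y0 = a - 1")
      case True
      have "[n = ?g] (mod int a)" using y0(2) g_cong unfolding True by (rule cong_trans[OF _ cong_sym])
      then have "int a dvd n - ?g" by (simp add: cong_iff_dvd_diff)
      then have "int a \<le> n - ?g" using gt by (intro zdvd_imp_le) auto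
      then show ?thesis unfolding True thr by simp
    next
      \<comment> \<open>Every other class has threshold at most \<open>?g + a - b\<close>, which is
        below \<open>?g\<close> because \<open>a < b\<close>.\<close>
      case False
      then have "int y0 \<le> int a - 2" using y0(1) by linarith
      then have "int b * (int y0 + int a * int l) \<le> int b * (int a - 2 + int a * int l)"
        by (intro mult_left_mono) auto
      also have "\<dots> = ?g + int a - int b" by (simp add: algebra_simps)
      finally show ?thesis using gt ab by linarith
    qed
    ultimately show False by simp
  qed
qed

text \<open>The reflection \<open>y \<mapsto> a - y\<close> preserves coprimality to
  \<open>a\<close>; for \<open>a > 1\<close> the value 0 is not among the summation indices, so the
  reflection stays below \<open>a\<close>.\<close>

lemma sum_coprime_less:
  assumes "a > (1::nat)"
  shows "2 * (\<Sum>y | y < a \<and> coprime y a. real y) = real a * real (card {y. y < a \<and> coprime y a})"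
proof -
  let ?C = "{y. y < a \<and> coprime y a}"
  have pos: "y > 0" if "y \<in> ?C" for y using that assms by (cases "y = 0") auto
  have "(\<Sum>y\<in>?C. real y) = (\<Sum>y\<in>?C. real (a - y))"
  proof (rule sum.reindex_bij_witness[of _ "\<lambda>y. a - y" "\<lambda>y. a - y"])
    fix y assume y: "y \<in> ?C"
    have "coprime (a - y) a"
    proof (rule coprimeI)
      fix d assume d: "d dvd a - y" "d dvd a"
      have "d dvd a - (a - y)" by (rule dvd_diff_nat[OF d(2,1)])
      moreover have "a - (a - y) = y" using y by simp
      ultimately have "d dvd y" by metis
      moreover have "coprime y a" using y by simp
      ultimately show "d dvd 1" using \<open>d dvd a\<close> coprime_common_divisor by blast
    qed
    then show "a - y \<in> ?C" using pos[OF y] assms by auto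
    show "a - y \<in> ?C" by fact
  qed auto
  also have "\<dots> = (\<Sum>y\<in>?C. real a - real y)" by (intro sum.cong) auto
  also have "\<dots> = real a * real (card ?C) - (\<Sum>y\<in>?C. real y)" by (simp add: sum_subtractf mult.commute)
  finally show ?thesis by simp
qed

section \<open>Primes in the semigroup\<close>

lemma class_primes_cong: "[c = c'] (mod q) \<Longrightarrow> class_primes q c n = class_primes q c' n"
  unfolding class_primes_def by (auto intro: cong_trans cong_sym)

text \<open>The scale \<open>ln b / b\<close> replaces the natural one at
  \<open>\<alpha> * b - \<beta>\<close>, so that counts up to different multiples of
  \<open>b\<close> can be added and subtracted; \<open>ln (\<alpha> * b - \<beta>)\<close> is
  asymptotic to \<open>ln b\<close>.\<close>

lemma class_primes_linear_asymp:
  fixes \<alpha> \<beta> q c :: nat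
  assumes q: "q > 1" and c: "coprime c q" and \<alpha>: "\<alpha> > 0"
  shows "(\<lambda>b. real (card (class_primes q c (\<alpha> * b - \<beta>))) * ln (real b) / real b)
           \<longlonglongrightarrow> real \<alpha> / real (card (dirichlet_chars q))"
proof -
  define m where "m = (\<lambda>b. \<alpha> * b - \<beta>)"
  define T where "T = (\<lambda>n. real (card (class_primes q c n)) * ln (real n) / real n)"
  have T: "T \<longlonglongrightarrow> 1 / real (card (dirichlet_chars q))"
    unfolding T_def by (rule class_primes_asymp[OF class_mangoldt_asymp[OF q c]])
  have ev: "\<forall>\<^sub>F b in sequentially. real (m b) = real \<alpha> * real b - real \<beta>"
    using eventually_ge_at_top[of \<beta>]
  proof eventually_elim
    case (elim b)
    then have "1 * \<beta> \<le> \<alpha> * b" using \<alpha> by (intro mult_mono) auto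
    then show ?case by (simp add: m_def of_nat_diff)
  qed
  have m: "filterlim m at_top sequentially"
  proof -
    have "filterlim (\<lambda>b. real \<alpha> * real b - real \<beta>) at_top sequentially" using \<alpha> by real_asymp
    then have "filterlim (\<lambda>b. real (m b)) at_top sequentially"
      using ev by (subst filterlim_cong[OF refl refl]) auto
    then show ?thesis by (simp add: filterlim_sequentially_iff_filterlim_real)
  qed
  have "(\<lambda>b. T (m b)) \<longlonglongrightarrow> 1 / real (card (dirichlet_chars q))" by (rule filterlim_compose[OF T m])
  moreover have "(\<lambda>b. (real \<alpha> * real b - real \<beta>) / real b * (ln (real b) / ln (real \<alpha> * real b - real \<beta>))) \<longlonglongrightarrow> real \<alpha> * 1"
  proof (rule tendsto_mult)
    show "(\<lambda>b. (real \<alpha> * real b - real \<beta>) / real b) \<longlonglongrightarrow> real \<alpha>" by real_asymp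
    show "(\<lambda>b. ln (real b) / ln (real \<alpha> * real b - real \<beta>)) \<longlonglongrightarrow> 1" using \<alpha> by real_asymp
  qed
  ultimately have "(\<lambda>b. T (m b) * ((real \<alpha> * real b - real \<beta>) / real b * (ln (real b) / ln (real \<alpha> * real b - real \<beta>))))
      \<longlonglongrightarrow> 1 / real (card (dirichlet_chars q)) * (real \<alpha> * 1)" by (rule tendsto_mult)
  moreover have "\<forall>\<^sub>F b in sequentially. T (m b) * ((real \<alpha> * real b - real \<beta>) / real b * (ln (real b) / ln (real \<alpha> * real b - real \<beta>))) =
      real (card (class_primes q c (\<alpha> * b - \<beta>))) * ln (real b) / real b"
  proof -
    have "\<forall>\<^sub>F b in sequentially. real (m b) > 1"
      using eventually_compose_filterlim[OF eventually_gt_at_top[of 1] m] by simp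
    then show ?thesis using ev
    proof eventually_elim
      case (elim b)
      then have "ln (real (m b)) \<noteq> 0" "real (m b) \<noteq> 0" by auto
      then have "T (m b) * (real (m b) / real b * (ln (real b) / ln (real (m b)))) =
          real (card (class_primes q c (m b))) * ln (real b) / real b" by (simp add: T_def)
      then show ?case unfolding elim(2)[symmetric] by (simp only: m_def)
    qed
  qed
  ultimately show ?thesis by (subst (asm) tendsto_cong) auto
qed

text \<open>Serves residue classes that depend on \<open>b\<close>: finitely many limits hold
  simultaneously, hence along any choice among them.\<close>

lemma tendsto_finite_choice:
  assumes C: "finite C" and lim: "\<And>c. c \<in> C \<Longrightarrow> (X c \<longlongrightarrow> x) F" and c: "\<forall>\<^sub>F b in F. c b \<in> C"
  shows "((\<lambda>b. X (c b) b) \<longlongrightarrow> (x :: 'a :: metric_space)) F"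
proof (rule tendstoI)
  fix e :: real assume "e > 0"
  then have "\<forall>\<^sub>F b in F. \<forall>c\<in>C. dist (X c b) x < e"
    using lim by (intro eventually_ball_finite C ballI tendstoD)
  with c show "\<forall>\<^sub>F b in F. dist (X (c b) b) x < e" by eventually_elim blast
qed

theorem theorem1:
  fixes l a :: nat
  assumes "a \<ge> 3"
  shows "\<exists>\<epsilon> :: nat \<Rightarrow> real.
           \<epsilon> \<in> o[inf at_top (principal {b. b > a \<and> coprime a b})](\<lambda>_. 1) \<and>
           (\<forall>b. b > a \<and> coprime a b \<longrightarrow>
              real (frobenius_prime_pi l a b) =
                ((real a - 2) / (2 * (real l * real a + real a - 1)) + \<epsilon> b) *
                real (prime_pi (real_of_int (frobenius l a b))))"
proof -
  let ?B = "{b. b > a \<and> coprime a b}"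
  define FB where "FB = inf at_top (principal ?B)"
  define N where "N = real (card (dirichlet_chars a))"
  \<comment> \<open>The Frobenius number is \<open>\<alpha> * b - a\<close>, so \<alpha> is the
    slope that becomes half the denominator of the claimed density.\<close>
  define \<alpha> where "\<alpha> = (l + 1) * a - 1"
  define G where "G = (\<lambda>b. \<alpha> * b - a)"
  define L where "L = (\<lambda>b::nat. ln (real b) / real b)"
  let ?C = "{y. y < a \<and> coprime y a}"
  have a: "a > 0" "a > 1" using assms by auto
  have \<alpha>: "real \<alpha> = real l * real a + real a - 1" "\<alpha> > 0"
    using assms by (auto simp: \<alpha>_def of_nat_diff algebra_simps)
  have FB_ev: "\<forall>\<^sub>F b in FB. b \<in> ?B" unfolding FB_def by (simp add: eventually_inf_principal)
  have FB_lim: "(X \<longlongrightarrow> x) FB" if "X \<longlonglongrightarrow> x" for X and x :: real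
    unfolding FB_def by (rule tendsto_mono[OF inf_le1 that])
  have frob: "frobenius l a b = int (G b)" if "b \<in> ?B" for b
  proof -
    have "a * 1 \<le> \<alpha> * b" using that \<alpha>(2) by (subst mult.commute) (intro mult_mono, auto)
    moreover have "int \<alpha> = (int l + 1) * int a - 1" using a by (simp add: \<alpha>_def of_nat_diff algebra_simps)
    then have "(int l + 1) * int a * int b - int a - int b = int \<alpha> * int b - int a"
      by (simp add: left_diff_distrib)
    ultimately show ?thesis using that frobenius_eq[of a b l] a by (simp add: G_def of_nat_diff)
  qed
  have card_L: "((\<lambda>b. real (card (class_primes a (c b) (\<alpha>' * b - \<beta>))) * L b) \<longlongrightarrow> real \<alpha>' / N) FB"
    if c: "\<And>b. b \<in> ?B \<Longrightarrow> coprime (c b) a" and "\<alpha>' > 0" for c \<alpha>' \<beta>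
  proof -
    have "((\<lambda>b. real (card (class_primes a (c b mod a) (\<alpha>' * b - \<beta>))) * L b) \<longlongrightarrow> real \<alpha>' / N) FB"
    proof (rule tendsto_finite_choice[where C = ?C and c = "\<lambda>b. c b mod a"
          and X = "\<lambda>y b. real (card (class_primes a y (\<alpha>' * b - \<beta>))) * L b"])
      show "((\<lambda>b. real (card (class_primes a y (\<alpha>' * b - \<beta>))) * L b) \<longlongrightarrow> real \<alpha>' / N) FB" if "y \<in> ?C" for y
        unfolding N_def L_def using class_primes_linear_asymp[OF a(2) _ \<open>\<alpha>' > 0\<close>, of y \<beta>] that
        by (intro FB_lim) simp
      show "\<forall>\<^sub>F b in FB. c b mod a \<in> ?C"
        using FB_ev by eventually_elim (use c a in auto)
    qed auto
    moreover have "class_primes a (c b mod a) n = class_primes a (c b) n" for b n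
      by (rule class_primes_cong) simp
    ultimately show ?thesis by simp
  qed
  have L0: "((\<lambda>b. real (a + 1) * L b) \<longlongrightarrow> 0) FB"
  proof -
    have "L \<longlonglongrightarrow> 0" unfolding L_def by real_asymp
    from FB_lim[OF tendsto_mult_right_zero[OF this]] show ?thesis .
  qed
  \<comment> \<open>A prime not coprime to \<open>a\<close> divides \<open>a\<close>, so there are
    boundedly many of them.\<close>
  have small: "finite X \<and> real (card X) \<le> real (a + 1)" if "\<And>p. p \<in> X \<Longrightarrow> prime p \<and> \<not> coprime p a" for X
  proof -
    have "X \<subseteq> {..a}"
    proof
      fix p assume "p \<in> X"
      then have "p dvd a" using that[of p] by (meson prime_imp_coprime)
      then show "p \<in> {..a}" using a by (simp add: dvd_imp_le)
    qed
    then show ?thesis using card_mono[of "{..a}" X] finite_subset by fastforce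
  qed
  have L_small: "((\<lambda>b. real (card (X b)) * L b) \<longlongrightarrow> 0) FB"
    if "\<And>b p. b \<in> ?B \<Longrightarrow> p \<in> X b \<Longrightarrow> prime p \<and> \<not> coprime p a" for X
  proof (rule tendsto_sandwich[OF _ _ tendsto_const L0])
    show "\<forall>\<^sub>F b in FB. 0 \<le> real (card (X b)) * L b"
      using FB_ev by eventually_elim (auto simp: L_def)
    show "\<forall>\<^sub>F b in FB. real (card (X b)) * L b \<le> real (a + 1) * L b"
      using FB_ev
    proof eventually_elim
      case (elim b)
      then have "real (card (X b)) \<le> real (a + 1)" using small[of "X b"] that by blast
      then show ?case using elim by (intro mult_right_mono) (auto simp: L_def)
    qed
  qed

  define pi_S where "pi_S = (\<lambda>b. real (frobenius_prime_pi l a b))"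
  define pi_G where "pi_G = (\<lambda>b. real (prime_pi (real_of_int (frobenius l a b))))"

  have pi_G_lim: "((\<lambda>b. pi_G b * L b) \<longlongrightarrow> real (card ?C) * (real \<alpha> / N)) FB"
  proof -
    let ?X = "\<lambda>b. {p. prime p \<and> p \<le> G b \<and> \<not> coprime p a}"
    have "((\<lambda>b. (\<Sum>c\<in>?C. real (card (class_primes a c (\<alpha> * b - a))) * L b) + real (card (?X b)) * L b) \<longlongrightarrow> (\<Sum>c\<in>?C. real \<alpha> / N) + 0) FB"
      by (intro tendsto_add tendsto_sum card_L L_small \<alpha>(2)) auto
    moreover have "\<forall>\<^sub>F b in FB. (\<Sum>c\<in>?C. real (card (class_primes a c (\<alpha> * b - a))) * L b) + real (card (?X b)) * L b = pi_G b * L b"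
      using FB_ev
    proof eventually_elim
      case (elim b)
      have "{p. prime p \<and> real p \<le> real_of_int (frobenius l a b)} = (\<Union>c\<in>?C. class_primes a c (G b)) \<union> ?X b" (is "?P = ?U")
      proof (intro equalityI subsetI)
        fix p assume "p \<in> ?P"
        then have p: "prime p" "p \<le> G b" using frob[OF elim] by auto
        show "p \<in> ?U"
        proof (cases "coprime p a")
          case True
          then have "p mod a \<in> ?C" "p \<in> class_primes a (p mod a) (G b)" using p a by (auto simp: class_primes_def cong_def)
          then show ?thesis by blast
        qed (use p in auto)
      qed (use frob[OF elim] in \<open>auto simp: class_primes_def\<close>)
      moreover have "(\<Union>c\<in>?C. class_primes a c (G b)) \<inter> ?X b = {}"
      proof -
        have "coprime p a" if "p \<in> class_primes a c (G b)" "c \<in> ?C" for p c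
          using that coprime_cong_cong_left[of p c a] by (auto simp: class_primes_def)
        then show ?thesis by blast
      qed
      moreover have "card (\<Union>c\<in>?C. class_primes a c (G b)) = (\<Sum>c\<in>?C. card (class_primes a c (G b)))"
      proof (rule card_UN_disjoint)
        show "\<forall>i\<in>?C. \<forall>j\<in>?C. i \<noteq> j \<longrightarrow> class_primes a i (G b) \<inter> class_primes a j (G b) = {}"
          by (auto simp: class_primes_def cong_def)
      qed auto
      ultimately have "pi_G b = (\<Sum>c\<in>?C. real (card (class_primes a c (G b)))) + real (card (?X b))"
        unfolding pi_G_def prime_pi_def by (simp add: card_Un_disjoint)
      then show ?case by (simp add: G_def sum_distrib_right distrib_right)
    qed
    ultimately have "((\<lambda>b. pi_G b * L b) \<longlongrightarrow> (\<Sum>c\<in>?C. real \<alpha> / N) + 0) FB" by (rule Lim_transform_eventually)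
    then show ?thesis by simp
  qed

  \<comment> \<open>Slope of the threshold: a prime in the class of \<open>b * y\<close> belongs to
    \<open>S l a b\<close> iff it is at least \<open>t y * b\<close>.\<close>
  define t where "t = (\<lambda>y. y + a * l)"
  define Q where "Q = (\<lambda>b y. {p. prime p \<and> p \<le> G b \<and> [p = b * y] (mod a) \<and> t y * b \<le> p})"
  have Q_lim: "((\<lambda>b. real (card (Q b y)) * L b) \<longlongrightarrow> of_bool (coprime y a) * (real (a - 1 - y) / N)) FB" if y: "y < a" for y
  \<comment> \<open>For \<open>y = a - 1\<close> the threshold \<open>\<alpha> * b\<close> lies
    beyond the Frobenius number and no prime remains; for \<open>y\<close> not coprime to
    \<open>a\<close> only prime divisors of \<open>a\<close> occur. In the main case the slopes
    satisfy \<open>\<alpha> - t y = a - 1 - y\<close>.\<close>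
  proof (cases "coprime y a \<and> y \<noteq> a - 1")
    case True
    then have "coprime y a" "y \<noteq> a - 1" by auto
    then have "y \<noteq> 0" using a by (cases "y = 0") auto
    then have ty: "t y > 0" by (simp add: t_def)
    have cop: "coprime (b * y) a" if "b \<in> ?B" for b using that True by (auto simp: coprime_commute)
    have "((\<lambda>b. real (card (class_primes a (b * y) (\<alpha> * b - a))) * L b - real (card (class_primes a (b * y) (t y * b - 1))) * L b)
        \<longlongrightarrow> real \<alpha> / N - real (t y) / N) FB"
      by (intro tendsto_diff card_L cop \<alpha>(2) ty)
    moreover have "\<forall>\<^sub>F b in FB. real (card (class_primes a (b * y) (\<alpha> * b - a))) * L b - real (card (class_primes a (b * y) (t y * b - 1))) * L b
        = real (card (Q b y)) * L b"
      using FB_ev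
    proof eventually_elim
      case (elim b)
      have ab: "a < b" using elim by simp
      have "(t y + 1) * b \<le> \<alpha> * b"
        using y \<open>y \<noteq> a - 1\<close> by (intro mult_right_mono) (auto simp: t_def \<alpha>_def mult.commute)
      then have le: "t y * b - 1 \<le> G b" using ab by (simp add: G_def)
      have sub: "class_primes a (b * y) (t y * b - 1) \<subseteq> class_primes a (b * y) (G b)"
        using le by (auto simp: class_primes_def)
      have "Q b y = class_primes a (b * y) (G b) - class_primes a (b * y) (t y * b - 1)"
      proof -
        have "t y * b > 0" using ty ab by simp
        then have "t y * b \<le> p \<longleftrightarrow> \<not> p \<le> t y * b - 1" for p by linarith
        then show ?thesis unfolding Q_def class_primes_def by blast
      qed
      then have "card (Q b y) = card (class_primes a (b * y) (G b)) - card (class_primes a (b * y) (t y * b - 1))"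
        using sub by (simp add: card_Diff_subset)
      then have "real (card (Q b y)) = real (card (class_primes a (b * y) (G b))) - real (card (class_primes a (b * y) (t y * b - 1)))"
        using card_mono[OF _ sub] by (simp add: of_nat_diff)
      then show ?case by (simp add: G_def left_diff_distrib)
    qed
    ultimately have "((\<lambda>b. real (card (Q b y)) * L b) \<longlongrightarrow> real \<alpha> / N - real (t y) / N) FB" by (rule Lim_transform_eventually)
    moreover have "real \<alpha> - real (t y) = real (a - 1 - y)"
      using y \<alpha>(1) by (simp add: t_def of_nat_diff mult.commute)
    ultimately show ?thesis using True by (simp add: diff_divide_distrib[symmetric])
  next
    case False
    have "((\<lambda>b. real (card (Q b y)) * L b) \<longlongrightarrow> 0) FB"
    proof (rule L_small)
      fix b p assume b: "b \<in> ?B" and p: "p \<in> Q b y"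
      have "y \<noteq> a - 1"
      proof
        assume "y = a - 1"
        then have "t y = \<alpha>" using a by (simp add: t_def \<alpha>_def mult.commute)
        then have "\<alpha> * b \<le> \<alpha> * b - a" using p by (auto simp: Q_def G_def)
        moreover have "\<alpha> * b > 0" using b \<alpha>(2) by simp
        ultimately show False using a by linarith
      qed
      then show "prime p \<and> \<not> coprime p a"
        using p False coprime_cong_cong_left[of p "b * y" a] by (auto simp: Q_def)
    qed
    then show ?thesis using False by auto
  qed

  have pi_S_lim: "((\<lambda>b. pi_S b * L b) \<longlongrightarrow> (\<Sum>y<a. of_bool (coprime y a) * (real (a - 1 - y) / N))) FB"
  proof -
    have "((\<lambda>b. \<Sum>y<a. real (card (Q b y)) * L b) \<longlongrightarrow> (\<Sum>y<a. of_bool (coprime y a) * (real (a - 1 - y) / N))) FB"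
      by (intro tendsto_sum Q_lim) auto
    moreover have "\<forall>\<^sub>F b in FB. (\<Sum>y<a. real (card (Q b y)) * L b) = pi_S b * L b"
      using FB_ev
    proof eventually_elim
      case (elim b)
      have b: "b > 0" "coprime a b" using elim by auto
      have S_iff: "p \<in> S l a b \<longleftrightarrow> t y * b \<le> p" if "y < a" "[p = b * y] (mod a)" for p y
      proof -
        have "[int p = int b * int y] (mod int a)" using that(2) by (metis cong_int_iff of_nat_mult)
        from num_reps_ge_iff[OF a(1) b that(1) this, of l]
        have "p \<in> S l a b \<longleftrightarrow> int (t y * b) \<le> int p" by (simp add: S_def t_def algebra_simps)
        then show ?thesis by (simp only: of_nat_le_iff)
      qed
      have "{p. prime p \<and> int p \<le> frobenius l a b \<and> p \<in> S l a b} = (\<Union>y\<in>{..<a}. Q b y)" (is "?P = ?U")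
      proof (intro equalityI subsetI)
        fix p assume "p \<in> ?P"
        then have p: "prime p" "p \<le> G b" "p \<in> S l a b" using frob[OF elim] by auto
        obtain y where y: "y < a" "[int p = int b * int y] (mod int a)" using ex_residue[OF a(1) b(2)] by blast
        then have "[p = b * y] (mod a)" by (metis cong_int_iff of_nat_mult)
        then have "p \<in> Q b y" using p y(1) S_iff by (simp add: Q_def)
        then show "p \<in> ?U" using y(1) by blast
      next
        fix p assume "p \<in> ?U"
        then obtain y where "y < a" "p \<in> Q b y" by blast
        then show "p \<in> ?P" using S_iff frob[OF elim] by (auto simp: Q_def)
      qed
      moreover have "card (\<Union>y\<in>{..<a}. Q b y) = (\<Sum>y<a. card (Q b y))"
      proof (rule card_UN_disjoint)
        show "\<forall>y\<in>{..<a}. finite (Q b y)"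
          by (auto intro!: finite_subset[of _ "{..G b}"] simp: Q_def)
        show "\<forall>i\<in>{..<a}. \<forall>j\<in>{..<a}. i \<noteq> j \<longrightarrow> Q b i \<inter> Q b j = {}"
        proof (intro ballI impI, rule ccontr)
          fix i j assume ij: "i \<in> {..<a}" "j \<in> {..<a}" "i \<noteq> j" "Q b i \<inter> Q b j \<noteq> {}"
          then obtain p where "[p = b * i] (mod a)" "[p = b * j] (mod a)" by (auto simp: Q_def)
          then have "[b * i = b * j] (mod a)" by (meson cong_sym cong_trans)
          then have "[i = j] (mod a)" using b(2) by (simp add: cong_mult_lcancel_nat coprime_commute)
          then show False using ij by (simp add: cong_def)
        qed
      qed auto
      ultimately have "pi_S b = (\<Sum>y<a. real (card (Q b y)))"
        unfolding pi_S_def frobenius_prime_pi_def by simp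
      then show ?case by (simp add: sum_distrib_right)
    qed
    ultimately show ?thesis by (rule Lim_transform_eventually)
  qed
  have sum_eq: "(\<Sum>y<a. of_bool (coprime y a) * (real (a - 1 - y) / N)) = real (card ?C) * (real a - 2) / 2 / N"
  proof -
    have "(\<Sum>y<a. of_bool (coprime y a) * (real (a - 1 - y) / N)) = (\<Sum>y\<in>?C. (real a - 1 - real y) / N)"
      by (rule sum.mono_neutral_cong_right) (auto simp: of_nat_diff)
    also have "\<dots> = ((real a - 1) * real (card ?C) - (\<Sum>y\<in>?C. real y)) / N"
      by (simp add: sum_divide_distrib[symmetric] sum_subtractf mult.commute)
    also have "(\<Sum>y\<in>?C. real y) = real a * real (card ?C) / 2" using sum_coprime_less[OF a(2)] by simp
    finally show ?thesis by (simp add: field_simps)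
  qed
  have "1 \<in> ?C" using a by simp
  then have cC: "real (card ?C) > 0" by (auto simp: card_gt_0_iff)
  have "(\<lambda>n. of_bool (coprime n a)) \<in> dirichlet_chars a"
    using dirichlet_char_principal[of a] a by (simp add: dirichlet_chars_def)
  then have N: "N > 0" using finite_dirichlet_chars[of a] a by (auto simp: N_def card_gt_0_iff)
  define \<gamma> where "\<gamma> = (real a - 2) / (2 * (real l * real a + real a - 1))"
  have quot: "((\<lambda>b. (pi_S b * L b) / (pi_G b * L b)) \<longlongrightarrow> (real (card ?C) * (real a - 2) / 2 / N) / (real (card ?C) * (real \<alpha> / N))) FB"
  proof (rule tendsto_divide[OF pi_S_lim[unfolded sum_eq] pi_G_lim])
    have "real (card ?C) * (real \<alpha> / N) > 0" using cC N \<alpha>(2) by (intro mult_pos_pos divide_pos_pos) auto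
    then show "real (card ?C) * (real \<alpha> / N) \<noteq> 0" by linarith
  qed
  have \<gamma>: "(real (card ?C) * (real a - 2) / 2 / N) / (real (card ?C) * (real \<alpha> / N)) = \<gamma>"
  proof -
    have "(c * x / 2 / n) / (c * (y / n)) = x / (2 * y)" if "c > 0" "n > 0" for c n x y :: real
      using that by simp
    from this[OF cC N] show ?thesis unfolding \<gamma>_def \<alpha>(1)[symmetric] .
  qed
  have "\<forall>\<^sub>F b in FB. (pi_S b * L b) / (pi_G b * L b) = pi_S b / pi_G b"
    using FB_ev
  proof eventually_elim
    case (elim b)
    then have "L b \<noteq> 0" using a by (auto simp: L_def)
    then show ?case by simp
  qed
  then have lim: "((\<lambda>b. pi_S b / pi_G b) \<longlongrightarrow> \<gamma>) FB"
    by (rule Lim_transform_eventually[OF quot[unfolded \<gamma>]])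
  define \<epsilon> where "\<epsilon> = (\<lambda>b. pi_S b / pi_G b - \<gamma>)"
  have "(\<epsilon> \<longlongrightarrow> 0) FB" unfolding \<epsilon>_def using tendsto_diff[OF lim tendsto_const[of \<gamma>]] by simp
  then have "\<epsilon> \<in> o[FB](\<lambda>_. 1)" by (intro smalloI_tendsto) auto
  moreover have "pi_S b = (\<gamma> + \<epsilon> b) * pi_G b" if "b \<in> ?B" for b
  proof (cases "pi_G b = 0")
    \<comment> \<open>The quotient defining \<epsilon> is then a division by zero; the identity
      holds because the smaller count \<open>pi_S b\<close> vanishes too.\<close>
    case True
    have "frobenius_prime_pi l a b \<le> prime_pi (real_of_int (frobenius l a b))"
      unfolding frobenius_prime_pi_def prime_pi_def
    proof (rule card_mono)
      show "finite {p. prime p \<and> real p \<le> real_of_int (frobenius l a b)}"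
        using frob[OF that] by (auto intro!: finite_subset[of _ "{..G b}"])
    qed auto
    then show ?thesis using True by (simp add: pi_S_def pi_G_def)
  next
    case False
    then show ?thesis by (simp add: \<epsilon>_def)
  qed
  ultimately show ?thesis
    unfolding pi_S_def pi_G_def \<gamma>_def FB_def by (intro exI[of _ \<epsilon>]) simp
qed

end
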